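(* Let $N = 2$ and let $1 < p < \infty$, $1 \le q < \infty$, $pq > 2$, $1 < b < 1 + 2q$. Then for each $\nu \in (0,4\pi)$, $$S_\nu := \sup_{u \in U}\, \Psi_\nu(u) < \infty,$$ and the supremum is attained at some $u \in U$ with $\|u\|_{E^{p,q}_b(\mathbb{R}^2)} = 1$.
   Context: $B_\rho = \{x \in \mathbb{R}^2 : |x| < \rho\}$. For a measurable function $u : \mathbb{R}^2 \to \mathbb{R}$, $h_u(\rho) = \int_{B_\rho} |u|^p\, dy$ for $\rho > 0$, and $\|u\|_{L^{p,q}_b(\mathbb{R}^2)} = \left(\int_0^\infty \rho^{-b}\, h_u^q(\rho)\, d\rho\right)^{1/pq}$. $E^{p,q}_b(\mathbb{R}^2)$ is the space of all weakly differentiable functions $u : \mathbb{R}^2 \to \mathbb{R}$ such that $\|\nabla u\|_{L^2(\mathbb{R}^2)} + \|u\|_{L^{p,q}_b(\mathbb{R}^2)} < \infty$, with norm $\|u\|_{E^{p,q}_b(\mathbb{R}^2)} = \left(\|\nabla u\|_{L^2(\mathbb{R}^2)}^{2pq} + \|u\|_{L^{p,q}_b(\mathbb{R}^2)}^{2pq}\right)^{1/2pq}$. $E^{p,q}_{b,\mathrm{rad}}(\mathbb{R}^2)$ is its closed subspace of radially symmetric functions, and $U = \{u \in E^{p,q}_{b,\mathrm{rad}}(\mathbb{R}^2) : \|u\|_{E^{p,q}_b(\mathbb{R}^2)} \le 1\}$. Let $n$ be the smallest integer such that $$2n > \frac{2\,(pq + b - 1)}{2q + 1 - b},$$ let $\psi(t)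 = e^t - \sum_{l=0}^{n-1} \frac{t^l}{l!} = \sum_{l \ge n} \frac{t^l}{l!}$, and for $\nu > 0$ set $\Psi_\nu(u) = \int_{\mathbb{R}^2} \psi(\nu u^2)\, dx$ for $u \in E^{p,q}_{b,\mathrm{rad}}(\mathbb{R}^2)$. *)

theory Defs
  imports "HOL-Analysis.Analysis"
begin

text \<open>
  Real powers of extended nonnegative reals, used only for positive exponents
  (so that \<open>\<infinity> powr a = \<infinity>\<close> and \<open>0 powr a = 0\<close> are the right conventions).
\<close>

definition epowr :: "ennreal \<Rightarrow> real \<Rightarrow> ennreal" where
  "epowr x a = (if x = \<infinity> then \<infinity> else ennreal (enn2real x powr a))"


subsection \<open>Weak derivatives\<close>

definition partial_deriv :: "'n \<Rightarrow> (real^'n \<Rightarrow> real) \<Rightarrow> real^'n \<Rightarrow> real" where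
  "partial_deriv i \<phi> x = frechet_derivative \<phi> (at x) (axis i 1)"

primrec C_k :: "nat \<Rightarrow> (real^'n \<Rightarrow> real) \<Rightarrow> bool" where
  "C_k 0 \<phi> \<longleftrightarrow> continuous_on UNIV \<phi>"
| "C_k (Suc k) \<phi> \<longleftrightarrow> \<phi> differentiable_on UNIV \<and> (\<forall>i. C_k k (partial_deriv i \<phi>))"

definition test_function :: "(real^'n \<Rightarrow> real) \<Rightarrow> bool" where
  "test_function \<phi> \<longleftrightarrow> (\<forall>k. C_k k \<phi>) \<and> compact (closure {x. \<phi> x \<noteq> 0})"

definition locally_integrable :: "(real^'n \<Rightarrow> 'b::{banach, second_countable_topology}) \<Rightarrow> bool" where
  "locally_integrable f \<longleftrightarrow> (\<forall>K. compact K \<longrightarrow> set_integrable lebesgue K f)"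

definition has_weak_gradient :: "(real^'n \<Rightarrow> real) \<Rightarrow> (real^'n \<Rightarrow> real^'n) \<Rightarrow> bool" where
  "has_weak_gradient u g \<longleftrightarrow>
     locally_integrable u \<and> locally_integrable g \<and>
     (\<forall>\<phi> i. test_function \<phi> \<longrightarrow>
        (LINT x|lebesgue. u x * partial_deriv i \<phi> x) = - (LINT x|lebesgue. g x $ i * \<phi> x))"

definition weakly_differentiable :: "(real^'n \<Rightarrow> real) \<Rightarrow> bool" where
  "weakly_differentiable u \<longleftrightarrow> (\<exists>g. has_weak_gradient u g)"

text \<open>The weak gradient is unique up to null sets; we choose a representative.\<close>

definition weak_gradient :: "(real^'n \<Rightarrow> real) \<Rightarrow> real^'n \<Rightarrow> real^'n" where
  "weak_gradient u = (SOME g. has_weak_gradient u g)"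


subsection \<open>The space \<open>E\<close> and its norm\<close>

text \<open>
  Elements of the function spaces are represented by functions rather than by classes of
  functions that agree almost everywhere.  All norms take values in \<^typ>\<open>ennreal\<close>, so that
  finiteness is a genuine condition.
\<close>

definition grad_norm :: "(real^2 \<Rightarrow> real) \<Rightarrow> ennreal" where
  "grad_norm u = epowr (\<integral>\<^sup>+ x. ennreal ((norm (weak_gradient u x))\<^sup>2) \<partial>lebesgue) (1 / 2)"

definition h_fun :: "real \<Rightarrow> (real^2 \<Rightarrow> real) \<Rightarrow> real \<Rightarrow> ennreal" where
  "h_fun p u \<rho> = (\<integral>\<^sup>+ y \<in> ball 0 \<rho>. ennreal (\<bar>u y\<bar> powr p) \<partial>lebesgue)"

definition Lpqb_norm :: "real \<Rightarrow> real \<Rightarrow> real \<Rightarrow> (real^2 \<Rightarrow> real) \<Rightarrow> ennreal" where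
  "Lpqb_norm p q b u =
     epowr (\<integral>\<^sup>+ \<rho> \<in> {0<..}. ennreal (\<rho> powr (- b)) * epowr (h_fun p u \<rho>) q \<partial>lebesgue) (1 / (p * q))"

definition E_space :: "real \<Rightarrow> real \<Rightarrow> real \<Rightarrow> (real^2 \<Rightarrow> real) set" where
  "E_space p q b = {u. weakly_differentiable u \<and> grad_norm u + Lpqb_norm p q b u < \<infinity>}"

definition E_norm :: "real \<Rightarrow> real \<Rightarrow> real \<Rightarrow> (real^2 \<Rightarrow> real) \<Rightarrow> ennreal" where
  "E_norm p q b u =
     epowr (epowr (grad_norm u) (2 * p * q) + epowr (Lpqb_norm p q b u) (2 * p * q)) (1 / (2 * p * q))"

text \<open>Invariant under modification on null sets: some representative is radially symmetric.\<close>

definition radially_symmetric :: "(real^2 \<Rightarrow> real) \<Rightarrow> bool" where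
  "radially_symmetric u \<longleftrightarrow> (\<exists>f. AE x in lebesgue. u x = f (norm x))"

definition E_rad :: "real \<Rightarrow> real \<Rightarrow> real \<Rightarrow> (real^2 \<Rightarrow> real) set" where
  "E_rad p q b = {u \<in> E_space p q b. radially_symmetric u}"

definition U_ball :: "real \<Rightarrow> real \<Rightarrow> real \<Rightarrow> (real^2 \<Rightarrow> real) set" where
  "U_ball p q b = {u \<in> E_rad p q b. E_norm p q b u \<le> 1}"


subsection \<open>The functional\<close>

text \<open>
  In the range of parameters considered the right-hand side is positive, so the least such
  integer is a natural number.
\<close>

definition n_min :: "real \<Rightarrow> real \<Rightarrow> real \<Rightarrow> nat" where
  "n_min p q b = (LEAST n. 2 * real n > 2 * (p * q + b - 1) / (2 * q + 1 - b))"

definition psi :: "nat \<Rightarrow> real \<Rightarrow> real" where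
  "psi n t = exp t - (\<Sum>l<n. t ^ l / fact l)"

text \<open>For \<open>\<nu> > 0\<close> the integrand is nonnegative, so \<open>ennreal\<close> does not truncate it.\<close>

definition Psi :: "real \<Rightarrow> real \<Rightarrow> real \<Rightarrow> real \<Rightarrow> (real^2 \<Rightarrow> real) \<Rightarrow> ennreal" where
  "Psi p q b \<nu> u = (\<integral>\<^sup>+ x. ennreal (psi (n_min p q b) (\<nu> * (u x)\<^sup>2)) \<partial>lebesgue)"

definition S_sup :: "real \<Rightarrow> real \<Rightarrow> real \<Rightarrow> real \<Rightarrow> ennreal" where
  "S_sup p q b \<nu> = (SUP u \<in> U_ball p q b. Psi p q b \<nu> u)"

end

theory Submission
  imports Defs "HOL-Complex_Analysis.Great_Picard"
begin

text \<open>
  Write \<open>s = |x|\<^sup>2\<close>. A radial function \<open>u\<close> on the plane with \<open>\<integral>|\<nabla>u|\<^sup>2 \<le> 1\<close> has a profile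
  \<open>u(x) = F (ln s)\<close> with \<open>|F \<sigma> - F \<tau>|\<^sup>2 \<le> |\<sigma> - \<tau>| / (4 \<pi>)\<close> (\<open>radial_representative\<close>: test the weak
  gradient with fields \<open>x \<zeta>(|x|\<^sup>2)\<close> and apply the Cauchy-Schwarz inequality). Everything else is read
  off from this Hoelder bound and from the growth bound
  \<open>\<integral>\<^bsub>|x|<\<rho>\<^esub> |u|\<^sup>p \<le> C \<rho>\<^bsup>(b-1)/q\<^esup>\<close>, which the weighted part of the norm gives.

  Near the origin the Hoelder bound gives \<open>\<nu> u\<^sup>2 \<le> \<kappa> |ln s| + const\<close> with \<open>\<kappa> < 1\<close>, because
  \<open>\<nu> < 4 \<pi>\<close>, so that \<open>exp (\<nu> u\<^sup>2) \<le> E s\<^bsup>-\<kappa>\<^esup>\<close>, which is integrable at \<open>s = 0\<close>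
  (\<open>log_hoelder_exp_bound\<close>). Away from the origin, if \<open>|F (ln s)| = a\<close>, then \<open>|F| \<ge> a/2\<close> on a logarithmic
  interval of length about \<open>a\<^sup>2\<close>, and the growth bound turns this into the pointwise decay
  \<open>|u|\<^bsup>p+2\<^esup> \<le> A s\<^bsup>-(1-\<beta>)\<^esup>\<close>, where \<open>\<beta> = (b - 1) / (2 q)\<close> (\<open>profile_decay\<close>). Splitting \<open>|u|\<^bsup>2n\<^esup>\<close> as
  \<open>|u|\<^sup>p |u|\<^bsup>2n-p\<^esup>\<close> and summing over dyadic annuli makes the tails \<open>\<integral>\<^bsub>s>N\<^esub> |u|\<^bsup>2n\<^esup>\<close> uniformly small
  when \<open>2n > (p + 2 \<beta>) / (1 - \<beta>)\<close>, which is the condition that defines \<open>n\<close> (\<open>profile_tail\<close>).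
  Hence the functional is bounded on the unit ball, and the limit of its values along pointwise convergent
  profiles is at most its value at the limit (\<open>profile_functional_limit\<close>).

  For a maximizing sequence the profiles are locally equicontinuous, so a subsequence converges
  pointwise. The limit stays in the unit ball: the weighted part of the norm by Fatou's lemma, and the
  gradient part by \<open>weak_gradient_limit\<close>. The latter avoids weak compactness: elements of almost
  minimal \<open>L\<^sup>2\<close> norm in a decreasing sequence of convex sets of approximate weak gradients are
  Cauchy by the parallelogram law. So the limit is a maximizer. The supremum is positive, and
  \<open>\<Psi>\<^sub>\<nu>(c u) \<ge> c\<^sup>2 \<Psi>\<^sub>\<nu>(u)\<close> for \<open>c \<ge> 1\<close>; a maximizer of norm less than 1 could be scaled up, a contradiction.
\<close>

section \<open>Smooth functions and cutoffs\<close>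

text \<open>
  \<open>kdiff k S f\<close>: the function \<open>f\<close> is \<open>k\<close> times differentiable at the points of \<open>S\<close>. For open \<open>S\<close> this
  depends only on the values of \<open>f\<close> on \<open>S\<close>, so such functions can be glued.
\<close>

primrec kdiff :: "nat \<Rightarrow> real set \<Rightarrow> (real \<Rightarrow> real) \<Rightarrow> bool" where
  "kdiff 0 S f \<longleftrightarrow> True"
| "kdiff (Suc k) S f \<longleftrightarrow>
     (\<exists>f'. (\<forall>x\<in>S. (f has_real_derivative f' x) (at x)) \<and> kdiff k S f')"

text \<open>
  Infinitely differentiable functions on the real line.
\<close>

definition smooth :: "(real \<Rightarrow> real) \<Rightarrow> bool" where
  "smooth f \<longleftrightarrow> (\<forall>k. kdiff k UNIV f)"

lemma kdiff_SucD: "kdiff (Suc k) S f \<Longrightarrow> kdiff k S f"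
proof (induction k arbitrary: f)
  case (Suc k)
  then obtain f' where "\<forall>x\<in>S. (f has_real_derivative f' x) (at x)" "kdiff (Suc k) S f'"
    by (metis kdiff.simps(2))
  with Suc.IH show ?case by auto
qed simp

lemma kdiff_const: "kdiff k S (\<lambda>x. c)"
proof (induction k arbitrary: c)
  case (Suc k)
  show ?case
    using Suc[of 0] by (simp add: exI[of _ "\<lambda>x. 0"])
qed simp

lemma kdiff_add: "kdiff k S f \<Longrightarrow> kdiff k S g \<Longrightarrow> kdiff k S (\<lambda>x. f x + g x)"
proof (induction k arbitrary: f g)
  case (Suc k)
  then obtain f' g' where "\<forall>x\<in>S. (f has_real_derivative f' x) (at x)" "kdiff k S f'"
    "\<forall>x\<in>S. (g has_real_derivative g' x) (at x)" "kdiff k S g'"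
    by auto
  with Suc.IH[of f' g'] show ?case
    by (auto intro!: exI[of _ "\<lambda>x. f' x + g' x"] derivative_eq_intros)
qed simp

lemma kdiff_mult: "kdiff k S f \<Longrightarrow> kdiff k S g \<Longrightarrow> kdiff k S (\<lambda>x. f x * g x)"
proof (induction k arbitrary: f g)
  case (Suc k)
  then obtain f' g' where fg: "\<forall>x\<in>S. (f has_real_derivative f' x) (at x)" "kdiff k S f'"
    "\<forall>x\<in>S. (g has_real_derivative g' x) (at x)" "kdiff k S g'"
    by auto
  have "kdiff k S (\<lambda>x. f' x * g x + g' x * f x)"
    using fg Suc.IH kdiff_SucD[OF Suc.prems(1)] kdiff_SucD[OF Suc.prems(2)]
    by (intro kdiff_add) auto
  with fg show ?case
    by (auto intro!: exI[of _ "\<lambda>x. f' x * g x + g' x * f x"] derivative_eq_intros)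
qed simp

lemma DERIV_transform_nhds:
  assumes "eventually (\<lambda>y. f y = g y) (nhds x)" "(f has_real_derivative D) (at x)"
  shows "(g has_real_derivative D) (at x)"
  using DERIV_cong_ev[OF refl assms(1) refl] assms(2) by blast

lemma kdiff_cong:
  assumes "open S" "\<And>x. x \<in> S \<Longrightarrow> f x = g x" "kdiff k S f"
  shows "kdiff k S g"
proof (cases k)
  case (Suc l)
  then obtain f' where f': "\<forall>x\<in>S. (f has_real_derivative f' x) (at x)" "kdiff l S f'"
    using assms by auto
  have "(g has_real_derivative f' x) (at x)" if "x \<in> S" for x
  proof -
    have "eventually (\<lambda>y. f y = g y) (nhds x)"
      using eventually_nhds_in_open[OF assms(1) that] assms(2) by (auto elim: eventually_mono)
    then show ?thesis using DERIV_transform_nhds f'(1) that by blast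
  qed
  with f' Suc show ?thesis by auto
qed simp

lemma kdiff_Un:
  assumes "open S" "open T"
  shows "kdiff k S f \<Longrightarrow> kdiff k T f \<Longrightarrow> kdiff k (S \<union> T) f"
proof (induction k arbitrary: f)
  case (Suc k)
  then obtain f' g' where fg: "\<forall>x\<in>S. (f has_real_derivative f' x) (at x)" "kdiff k S f'"
    "\<forall>x\<in>T. (f has_real_derivative g' x) (at x)" "kdiff k T g'"
    by auto
  define h where "h = (\<lambda>x. if x \<in> S then f' x else g' x)"
  have hT: "h x = g' x" if "x \<in> T" for x
    using fg that DERIV_unique[of f "f' x" x "g' x"] by (auto simp: h_def)
  have "kdiff k S h" "kdiff k T h"
    using kdiff_cong[OF assms(1) _ fg(2), of h] kdiff_cong[OF assms(2) _ fg(4), of h] hT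
    by (auto simp: h_def)
  then have "kdiff k (S \<union> T) h" using Suc.IH by auto
  moreover have "\<forall>x\<in>S \<union> T. (f has_real_derivative h x) (at x)"
    using fg by (auto simp: h_def)
  ultimately show ?case by auto
qed simp

lemma kdiff_inverse: "0 \<notin> S \<Longrightarrow> kdiff k S inverse"
proof (induction k)
  case (Suc k)
  then have "kdiff k S (\<lambda>x. - 1 * (inverse x * inverse x))"
    by (intro kdiff_mult kdiff_const) auto
  moreover have "\<forall>x\<in>S. (inverse has_real_derivative - 1 * (inverse x * inverse x)) (at x)"
  proof
    fix x assume "x \<in> S"
    then have "x \<noteq> 0" using Suc.prems by auto
    then show "(inverse has_real_derivative - 1 * (inverse x * inverse x)) (at x)"
      by (auto intro!: derivative_eq_intros)
  qed
  ultimately show ?case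
    unfolding kdiff.simps by (intro exI[of _ "\<lambda>x. - 1 * (inverse x * inverse x)"] conjI)
qed simp

lemma kdiff_affine: "kdiff k UNIV f \<Longrightarrow> kdiff k UNIV (\<lambda>x. f (c * x + d))"
proof (induction k arbitrary: f)
  case (Suc k)
  then obtain f' where f': "\<forall>x. (f has_real_derivative f' x) (at x)" "kdiff k UNIV f'"
    by auto
  have "((\<lambda>x. f (c * x + d)) has_real_derivative f' (c * x + d) * c) (at x)" for x
    using f'(1) by (intro DERIV_chain2[of f]) (auto intro!: derivative_eq_intros)
  then have "((\<lambda>x. f (c * x + d)) has_real_derivative c * f' (c * x + d)) (at x)" for x
    by (subst mult.commute[of c "f' _"])
  moreover have "kdiff k UNIV (\<lambda>x. c * f' (c * x + d))"
    using Suc.IH[OF f'(2)] by (intro kdiff_mult kdiff_const)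
  ultimately show ?case
    by (simp only: kdiff.simps) (rule exI[of _ "\<lambda>x. c * f' (c * x + d)"], simp)
qed simp

lemma smooth_const: "smooth (\<lambda>x. c)"
  by (simp add: smooth_def kdiff_const)

lemma smooth_add: "smooth f \<Longrightarrow> smooth g \<Longrightarrow> smooth (\<lambda>x. f x + g x)"
  and smooth_mult: "smooth f \<Longrightarrow> smooth g \<Longrightarrow> smooth (\<lambda>x. f x * g x)"
  and smooth_affine: "smooth f \<Longrightarrow> smooth (\<lambda>x. f (c * x + d))"
  by (auto simp: smooth_def kdiff_add kdiff_mult kdiff_affine)

lemma smooth_diff: "smooth f \<Longrightarrow> smooth g \<Longrightarrow> smooth (\<lambda>x. f x - g x)"
  using smooth_add[of f "\<lambda>x. (- 1) * g x"] smooth_mult[OF smooth_const[of "-1"], of g] by simp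

lemma smooth_deriv:
  assumes "smooth f"
  obtains f' where "smooth f'" "\<And>x. (f has_real_derivative f' x) (at x)"
proof
  have *: "\<exists>f'. (\<forall>x. (f has_real_derivative f' x) (at x)) \<and> kdiff k UNIV f'" for k
    using assms[unfolded smooth_def, rule_format, of "Suc k"] by simp
  show D: "(f has_real_derivative deriv f x) (at x)" for x
    using *[of 0] DERIV_imp_deriv by metis
  show "smooth (deriv f)"
    unfolding smooth_def
  proof
    fix k
    from *[of k] obtain f' where f': "\<forall>x. (f has_real_derivative f' x) (at x)" "kdiff k UNIV f'"
      by auto
    then have "f' = deriv f" using D DERIV_unique by blast
    with f' show "kdiff k UNIV (deriv f)" by simp
  qed
qed

lemma smoothI_deriv:
  assumes "\<And>x. (f has_real_derivative f' x) (at x)" "smooth f'"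
  shows "smooth f"
  unfolding smooth_def
proof
  fix k show "kdiff k UNIV f"
    using assms by (cases k) (auto simp: smooth_def)
qed

lemma smooth_continuous: "smooth f \<Longrightarrow> continuous_on UNIV f"
  by (meson DERIV_continuous continuous_at_imp_continuous_on smooth_deriv)

text \<open>
  The standard smooth function that vanishes exactly on the half-line \<open>s \<le> 0\<close>.
\<close>

definition flat :: "real \<Rightarrow> real" where
  "flat s = (if s \<le> 0 then 0 else exp (- inverse s))"

lemma poly_mult_exp_neg_tendsto_0: "((\<lambda>y::real. poly p y * exp (- y)) \<longlongrightarrow> 0) at_top"
proof -
  have "((\<lambda>y. \<Sum>i\<le>degree p. coeff p i * (y ^ i / exp y)) \<longlongrightarrow> (\<Sum>i\<le>degree p. coeff p i * 0)) at_top"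
    by (intro tendsto_sum tendsto_mult tendsto_const tendsto_power_div_exp_0)
  moreover have "(\<lambda>y. \<Sum>i\<le>degree p. coeff p i * (y ^ i / exp y)) = (\<lambda>y. poly p y * exp (- y))"
    by (simp add: poly_altdef sum_distrib_right exp_minus divide_inverse mult.assoc)
  ultimately show ?thesis by simp
qed

lemma kdiff_poly_flat:
  "kdiff k UNIV (\<lambda>s. if s \<le> 0 then 0 else poly p (inverse s) * exp (- inverse s))"
proof (induction k arbitrary: p)
  case (Suc k)
  \<comment> \<open>With \<open>Q = X\<^sup>2 (p - p')\<close>, the derivative of \<open>p(1/s) exp(-1/s)\<close> is \<open>Q(1/s) exp(-1/s)\<close>,
    a function of the same form.\<close>
  define Q where "Q = [:0, 0, 1:] * (p - pderiv p)"
  let ?f = "\<lambda>p s. if s \<le> 0 then 0 else poly p (inverse s) * exp (- inverse s) :: real"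
  have "(?f p has_real_derivative ?f Q s) (at s)" for s
  proof -
    consider "s < 0" | "s > 0" | "s = 0" by linarith
    then show ?thesis
    proof cases
      case 1
      have "((\<lambda>s. 0) has_real_derivative ?f Q s) (at s)" using 1 by auto
      moreover have "eventually (\<lambda>s. 0 = ?f p s) (nhds s)"
        using 1 eventually_nhds_in_open[of "{..<0}" s] by (auto elim: eventually_mono)
      ultimately show ?thesis by (rule DERIV_transform_nhds[rotated])
    next
      case 2
      have inv: "(inverse has_real_derivative - (inverse s * inverse s)) (at s)"
        using 2 by (auto intro!: derivative_eq_intros)
      have "((\<lambda>s. poly p (inverse s) * exp (- inverse s)) has_real_derivative
          poly (pderiv p) (inverse s) * - (inverse s * inverse s) * exp (- inverse s) +
          exp (- inverse s) * - (- (inverse s * inverse s)) * poly p (inverse s)) (at s)"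
        by (intro DERIV_mult DERIV_chain2[OF poly_DERIV] DERIV_chain2[OF DERIV_exp] DERIV_minus inv)
      moreover have "poly (pderiv p) (inverse s) * - (inverse s * inverse s) * exp (- inverse s) +
          exp (- inverse s) * - (- (inverse s * inverse s)) * poly p (inverse s) = ?f Q s"
        using 2 by (simp add: Q_def algebra_simps)
      ultimately have "((\<lambda>s. poly p (inverse s) * exp (- inverse s)) has_real_derivative ?f Q s) (at s)"
        by simp
      moreover have "eventually (\<lambda>s. poly p (inverse s) * exp (- inverse s) = ?f p s) (nhds s)"
        using 2 eventually_nhds_in_open[of "{0<..}" s] by (auto elim: eventually_mono)
      ultimately show ?thesis by (rule DERIV_transform_nhds[rotated])
    next
      case 3
      have "((\<lambda>h. ?f p h / h) \<longlongrightarrow> 0) (at 0)"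
      proof (rule filterlim_split_at)
        show "((\<lambda>h. ?f p h / h) \<longlongrightarrow> 0) (at_left 0)"
          by (rule tendsto_eventually) (auto simp: eventually_at_filter)
        have "((\<lambda>h. poly ([:0,1:] * p) (inverse h) * exp (- inverse h)) \<longlongrightarrow> 0) (at_right 0)"
          using filterlim_compose[OF poly_mult_exp_neg_tendsto_0 filterlim_inverse_at_top_right] .
        then show "((\<lambda>h. ?f p h / h) \<longlongrightarrow> 0) (at_right 0)"
          by (rule Lim_transform_eventually) (auto simp: eventually_at_filter field_simps)
      qed
      then show ?thesis unfolding 3 DERIV_def by (simp only: add_0 order_refl if_True diff_zero)
    qed
  qed
  with Suc.IH[of Q] show ?case
    unfolding kdiff.simps by (intro exI[of _ "?f Q"] conjI) auto
qed simp

lemma smooth_flat: "smooth flat"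
proof -
  have "flat = (\<lambda>s. if s \<le> 0 then 0 else poly [:1:] (inverse s) * exp (- inverse s))"
    by (auto simp: flat_def)
  moreover have "kdiff k UNIV (\<lambda>s. if s \<le> 0 then 0 else poly [:1:] (inverse s) * exp (- inverse s))" for k
    by (rule kdiff_poly_flat)
  ultimately show ?thesis unfolding smooth_def by metis
qed

text \<open>
  Smooth functions with values in \<open>[0, 1]\<close> that vanish outside \<open>(a, b)\<close> and converge pointwise to the
  indicator function of that interval as \<open>m\<close> grows. They need not be equal to 1 anywhere.
\<close>

definition bump :: "nat \<Rightarrow> real \<Rightarrow> real \<Rightarrow> real \<Rightarrow> real" where
  "bump m a b s = flat (real (Suc m) * (s - a)) * flat (real (Suc m) * (b - s))"

lemma smooth_bump: "smooth (bump m a b)"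
proof -
  have "smooth (\<lambda>s. flat (real (Suc m) * s + (- real (Suc m) * a)) * flat ((- real (Suc m)) * s + real (Suc m) * b))"
    by (intro smooth_mult smooth_affine smooth_flat)
  then show ?thesis by (simp add: bump_def[abs_def] algebra_simps)
qed

lemma flat_bounds: "0 \<le> flat s" "flat s \<le> 1"
  by (auto simp: flat_def)

lemma bump_bounds: "0 \<le> bump m a b s" "bump m a b s \<le> 1"
  using flat_bounds by (auto simp: bump_def intro!: mult_le_one)

lemma bump_eq_0: "s \<notin> {a<..<b} \<Longrightarrow> bump m a b s = 0"
  by (auto simp: bump_def flat_def mult_le_0_iff not_less)

lemma flat_tendsto: "s > 0 \<Longrightarrow> (\<lambda>m. flat (real (Suc m) * s)) \<longlonglongrightarrow> 1"
proof -
  assume s: "s > 0"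
  have "(\<lambda>m. exp (- (inverse (real (Suc m)) * inverse s))) \<longlonglongrightarrow> exp (- (0 * inverse s))"
    by (intro tendsto_intros LIMSEQ_inverse_real_of_nat)
  moreover have "\<not> real (Suc m) * s \<le> 0" for m
    using s by (simp add: mult_le_0_iff)
  then have "flat (real (Suc m) * s) = exp (- (inverse (real (Suc m)) * inverse s))" for m
    unfolding flat_def by (simp only: if_False inverse_mult_distrib)
  ultimately show ?thesis by simp
qed

lemma bump_tendsto: "(\<lambda>m. bump m a b s) \<longlonglongrightarrow> indicator {a<..<b} s"
proof (cases "s \<in> {a<..<b}")
  case True
  then show ?thesis
    using tendsto_mult[OF flat_tendsto[of "s - a"] flat_tendsto[of "b - s"]] by (simp add: bump_def)
qed (simp add: bump_eq_0)

lemma borel_measurable_bump [measurable]: "bump m a b \<in> borel_measurable borel"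
  by (intro borel_measurable_continuous_onI smooth_continuous smooth_bump)

text \<open>
  A class of smooth functions on \<open>real^'n\<close> that is closed under partial derivatives; every member
  therefore satisfies \<^const>\<open>C_k\<close> for all \<open>k\<close>. It is generated by the coordinates through sums,
  products and composition with smooth functions of one variable.
\<close>

inductive csmooth :: "(real^'n \<Rightarrow> real) \<Rightarrow> bool" where
  csmooth_coord: "csmooth (\<lambda>x. x $ i)"
| csmooth_add: "csmooth f \<Longrightarrow> csmooth g \<Longrightarrow> csmooth (\<lambda>x. f x + g x)"
| csmooth_mult: "csmooth f \<Longrightarrow> csmooth g \<Longrightarrow> csmooth (\<lambda>x. f x * g x)"
| csmooth_comp: "smooth \<eta> \<Longrightarrow> csmooth f \<Longrightarrow> csmooth (\<lambda>x. \<eta> (f x))"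

lemma csmooth_const: "csmooth (\<lambda>x. c)"
  using csmooth_comp[OF smooth_const csmooth_coord] .

lemma csmooth_sum: "finite I \<Longrightarrow> (\<And>i. i \<in> I \<Longrightarrow> csmooth (f i)) \<Longrightarrow> csmooth (\<lambda>x. \<Sum>i\<in>I. f i x)"
  by (induction I rule: finite_induct) (simp_all add: csmooth_const csmooth_add)

lemma csmooth_prod: "finite I \<Longrightarrow> (\<And>i. i \<in> I \<Longrightarrow> csmooth (f i)) \<Longrightarrow> csmooth (\<lambda>x. \<Prod>i\<in>I. f i x)"
  by (induction I rule: finite_induct) (simp_all add: csmooth_const csmooth_mult)

lemma norm_sq_eq_sum: "(norm (x::real^'n))\<^sup>2 = (\<Sum>i\<in>UNIV. x $ i * x $ i)"
  by (simp add: power2_norm_eq_inner inner_vec_def)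

lemma csmooth_norm_sq: "csmooth (\<lambda>x::real^'n. (norm x)\<^sup>2)"
  unfolding norm_sq_eq_sum by (intro csmooth_sum csmooth_mult csmooth_coord) auto

lemma csmooth_derivative:
  assumes "csmooth f"
  shows "\<exists>D. (\<forall>i. csmooth (\<lambda>x. D x (axis i 1))) \<and> (\<forall>x. (f has_derivative D x) (at x))"
  using assms
proof induction
  case (csmooth_coord j)
  have "((\<lambda>x. x $ j) has_derivative (\<lambda>h. h $ j)) (at x)" for x :: "real^'a"
    by (rule bounded_linear_imp_has_derivative) (rule bounded_linear_vec_nth)
  then show ?case by (intro exI[of _ "\<lambda>x h. h $ j"]) (auto intro: csmooth_const)
next
  case (csmooth_add f g)
  then obtain D E where "\<forall>i. csmooth (\<lambda>x. D x (axis i 1))" "\<forall>x. (f has_derivative D x) (at x)"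
    "\<forall>i. csmooth (\<lambda>x. E x (axis i 1))" "\<forall>x. (g has_derivative E x) (at x)" by auto
  then show ?case
    by (intro exI[of _ "\<lambda>x h. D x h + E x h"] conjI allI)
      (simp_all add: csmooth.csmooth_add has_derivative_add)
next
  case (csmooth_mult f g)
  then obtain D E where "\<forall>i. csmooth (\<lambda>x. D x (axis i 1))" "\<forall>x. (f has_derivative D x) (at x)"
    "\<forall>i. csmooth (\<lambda>x. E x (axis i 1))" "\<forall>x. (g has_derivative E x) (at x)" by auto
  then show ?case using csmooth_mult.hyps
    by (intro exI[of _ "\<lambda>x h. f x * E x h + D x h * g x"] conjI allI)
      (simp_all add: csmooth.csmooth_add csmooth.csmooth_mult has_derivative_mult)
next
  case (csmooth_comp \<eta> f)
  then obtain D where D: "\<forall>i. csmooth (\<lambda>x. D x (axis i 1))" "\<forall>x. (f has_derivative D x) (at x)" by auto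
  obtain \<eta>' where e: "smooth \<eta>'" "\<And>x. (\<eta> has_real_derivative \<eta>' x) (at x)"
    using smooth_deriv csmooth_comp.hyps by blast
  have "((\<lambda>x. \<eta> (f x)) has_derivative (\<lambda>h. \<eta>' (f x) * D x h)) (at x)" for x
    using D(2) e(2) has_derivative_compose[of f "D x" x UNIV \<eta> "(*) (\<eta>' (f x))"]
    by (auto simp: has_field_derivative_def)
  then show ?case using D e csmooth_comp.hyps
    by (intro exI[of _ "\<lambda>x h. \<eta>' (f x) * D x h"] conjI allI)
      (simp_all add: csmooth.csmooth_mult csmooth.csmooth_comp[of \<eta>'])
qed

lemma partial_deriv_eq: "(f has_derivative D) (at x) \<Longrightarrow> partial_deriv i f x = D (axis i 1)"
  by (simp add: partial_deriv_def frechet_derivative_at[symmetric])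

lemma csmooth_imp_C_k: "csmooth f \<Longrightarrow> C_k k f"
proof (induction k arbitrary: f)
  case 0
  then obtain D where "\<forall>x. (f has_derivative D x) (at x)" using csmooth_derivative by blast
  then show ?case
    by (auto intro!: continuous_at_imp_continuous_on has_derivative_continuous)
next
  case (Suc k)
  then obtain D where D: "\<forall>i. csmooth (\<lambda>x. D x (axis i 1))" "\<forall>x. (f has_derivative D x) (at x)"
    using csmooth_derivative by blast
  then have "partial_deriv i f = (\<lambda>x. D x (axis i 1))" for i
    by (auto simp: partial_deriv_eq)
  with D Suc.IH show ?case
    by (simp add: differentiable_on_def differentiable_def) blast
qed

lemma test_functionI:
  assumes "csmooth \<phi>" "\<And>x. \<phi> x \<noteq> 0 \<Longrightarrow> norm x \<le> R"
  shows "test_function \<phi>"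
proof -
  have "closure {x. \<phi> x \<noteq> 0} \<subseteq> cball 0 R"
    using assms(2) by (intro closure_minimal) auto
  then have "compact (closure {x. \<phi> x \<noteq> 0})"
    by (meson bounded_cball bounded_subset closed_closure compact_eq_bounded_closed)
  then show ?thesis using assms(1) csmooth_imp_C_k by (auto simp: test_function_def)
qed

section \<open>Test functions and uniqueness of weak gradients\<close>

text \<open>
  The square of the \<open>L\<^sup>2\<close> norm, possibly infinite.
\<close>

abbreviation sq_integral :: "('a::euclidean_space \<Rightarrow> 'b::real_normed_vector) \<Rightarrow> ennreal" where
  "sq_integral g \<equiv> \<integral>\<^sup>+ x. ennreal ((norm (g x))\<^sup>2) \<partial>lebesgue"

lemma test_functionE:
  fixes \<phi> :: "real^'n \<Rightarrow> real"
  assumes "test_function \<phi>"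
  obtains R M where "R > 0" "M > 0"
    "\<And>x. (\<phi> has_derivative frechet_derivative \<phi> (at x)) (at x)"
    "continuous_on UNIV \<phi>" "\<And>i. continuous_on UNIV (partial_deriv i \<phi>)"
    "\<And>x. norm x > R \<Longrightarrow> \<phi> x = 0" "\<And>x i. norm x > R \<Longrightarrow> partial_deriv i \<phi> x = 0"
    "\<And>x. \<bar>\<phi> x\<bar> \<le> M" "\<And>x i. \<bar>partial_deriv i \<phi> x\<bar> \<le> M"
proof -
  have C: "C_k k \<phi>" for k
    using assms by (auto simp: test_function_def)
  have K: "compact (closure {x. \<phi> x \<noteq> 0})"
    using assms by (auto simp: test_function_def)
  have diff: "(\<phi> has_derivative frechet_derivative \<phi> (at x)) (at x)" for x
    using C[of 1] by (simp add: differentiable_on_def frechet_derivative_works)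
  then have cont: "continuous_on UNIV \<phi>"
    by (auto intro!: continuous_at_imp_continuous_on has_derivative_continuous[OF diff])
  have contp: "continuous_on UNIV (partial_deriv i \<phi>)" for i
    using C[of 1] by simp
  obtain R where R: "R > 0" "closure {x. \<phi> x \<noteq> 0} \<subseteq> cball 0 R"
    using bounded_subset_ballD[OF compact_imp_bounded[OF K], of 0]
      order_trans[OF _ ball_subset_cball[of "0::real^'n"]] by blast
  have 0: "\<phi> x = 0" if "norm x > R" for x
  proof (rule ccontr)
    assume "\<phi> x \<noteq> 0"
    then have "x \<in> closure {x. \<phi> x \<noteq> 0}" using closure_subset[of "{x. \<phi> x \<noteq> 0}"] by auto
    then show False using R(2) that by auto
  qed
  have 1: "partial_deriv i \<phi> x = 0" if "norm x > R" for x i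
  proof -
    have "open (- cball 0 R :: (real^'n) set)" by auto
    then have "(\<phi> has_derivative (\<lambda>h. 0)) (at x)"
      using that 0 has_derivative_transform_within_open[of "\<lambda>x. 0" "\<lambda>h. 0" x UNIV "- cball 0 R" \<phi>]
      by auto
    then show ?thesis by (simp add: partial_deriv_eq)
  qed
  have bd: "\<exists>M. \<forall>x. \<bar>f x\<bar> \<le> M" if "continuous_on UNIV f" "\<And>x. norm x > R \<Longrightarrow> f x = 0"
    for f :: "real^'n \<Rightarrow> real"
  proof -
    have "compact (f ` cball 0 R)"
      using that(1) by (intro compact_continuous_image) (auto intro: continuous_on_subset)
    then obtain M where "\<forall>y\<in>f ` cball 0 R. \<bar>y\<bar> \<le> M"
      using compact_imp_bounded bounded_real by blast
    then have M: "\<bar>f x\<bar> \<le> M" if "x \<in> cball 0 R" for x using that by simp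
    have "\<bar>f x\<bar> \<le> max M 0" for x
      using that(2)[of x] M[of x] by (cases "norm x \<le> R") auto
    then show ?thesis by blast
  qed
  obtain M1 where M1: "\<And>x. \<bar>\<phi> x\<bar> \<le> M1" using bd[OF cont 0] by blast
  obtain M2 where M2: "\<And>i x. \<bar>partial_deriv i \<phi> x\<bar> \<le> M2 i"
    using bd[OF contp 1] by moura
  define M where "M = 1 + \<bar>M1\<bar> + (\<Sum>i\<in>UNIV. \<bar>M2 i\<bar>)"
  have s0: "0 \<le> (\<Sum>i\<in>UNIV. \<bar>M2 i\<bar>)" by (intro sum_nonneg) auto
  have "\<bar>M2 i\<bar> \<le> (\<Sum>i\<in>UNIV. \<bar>M2 i\<bar>)" for i by (intro member_le_sum) auto
  then have M2': "\<bar>partial_deriv i \<phi> x\<bar> \<le> M" for i x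
    using M2[of i x] unfolding M_def by (smt (verit))
  have M1': "\<bar>\<phi> x\<bar> \<le> M" for x using M1[of x] s0 unfolding M_def by linarith
  have "M > 0" using s0 unfolding M_def by linarith
  from that[OF R(1) this diff cont contp 0 1 M1' M2'] show ?thesis .
qed

lemma continuous_lebesgue_measurable:
  fixes f :: "'a::euclidean_space \<Rightarrow> 'b::topological_space"
  shows "continuous_on UNIV f \<Longrightarrow> f \<in> borel_measurable lebesgue"
  by (intro measurable_completion) (simp add: borel_measurable_continuous_onI)

lemma set_integrable_cball_imp_measurable:
  fixes f :: "'a::euclidean_space \<Rightarrow> 'b::{banach, second_countable_topology}"
  assumes "\<And>n::nat. set_integrable lebesgue (cball 0 (real n)) f"
  shows "f \<in> borel_measurable lebesgue"
proof (rule borel_measurable_LIMSEQ_metric)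
  show "(\<lambda>x. indicator (cball 0 (real n)) x *\<^sub>R f x) \<in> borel_measurable lebesgue" for n
    using assms[of n] by (simp add: set_integrable_def)
  show "(\<lambda>n. indicator (cball 0 (real n)) x *\<^sub>R f x) \<longlonglongrightarrow> f x" for x
  proof (rule tendsto_eventually)
    obtain N where "norm x \<le> real N" using real_arch_simple by blast
    then show "eventually (\<lambda>n. indicator (cball 0 (real n)) x *\<^sub>R f x = f x) sequentially"
      by (auto intro!: eventually_sequentiallyI[of N])
  qed
qed

lemma locally_integrable_measurable:
  "locally_integrable f \<Longrightarrow> f \<in> borel_measurable lebesgue"
  by (rule set_integrable_cball_imp_measurable) (auto simp: locally_integrable_def)

lemma locally_integrable_mult:
  fixes w \<phi> :: "real^'n \<Rightarrow> real"
  assumes "locally_integrable w" "\<phi> \<in> borel_measurable lebesgue"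
    "\<And>x. norm x > R \<Longrightarrow> \<phi> x = 0" "\<And>x. \<bar>\<phi> x\<bar> \<le> M"
  shows "integrable lebesgue (\<lambda>x. w x * \<phi> x)"
proof (rule Bochner_Integration.integrable_bound)
  have "set_integrable lebesgue (cball 0 R) w"
    using assms(1) by (auto simp: locally_integrable_def)
  then have "integrable lebesgue (\<lambda>x. indicator (cball 0 R) x * w x)"
    by (simp add: set_integrable_def)
  then show "integrable lebesgue (\<lambda>x. M * (indicator (cball 0 R) x * w x))" by simp
  show "(\<lambda>x. w x * \<phi> x) \<in> borel_measurable lebesgue"
    using locally_integrable_measurable[OF assms(1)] assms(2) by measurable
  have "norm (w x * \<phi> x) \<le> norm (M * (indicator (cball 0 R) x * w x))" for x
  proof (cases "norm x > R")
    case False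
    then show ?thesis using mult_right_mono[OF assms(4)[of x], of "\<bar>w x\<bar>"] assms(4)[of x]
      by (simp add: abs_mult mult_ac)
  qed (simp add: assms(3))
  then show "AE x in lebesgue. norm (w x * \<phi> x) \<le> norm (M * (indicator (cball 0 R) x * w x))"
    by simp
qed

lemma test_function_integrable:
  assumes "test_function \<phi>" "locally_integrable w"
  shows "integrable lebesgue (\<lambda>x. w x * \<phi> x)" "integrable lebesgue (\<lambda>x. w x * partial_deriv i \<phi> x)"
proof -
  obtain R M where *: "continuous_on UNIV \<phi>" "\<And>i. continuous_on UNIV (partial_deriv i \<phi>)"
    "\<And>x. norm x > R \<Longrightarrow> \<phi> x = 0" "\<And>x i. norm x > R \<Longrightarrow> partial_deriv i \<phi> x = 0"
    "\<And>x. \<bar>\<phi> x\<bar> \<le> M" "\<And>x i. \<bar>partial_deriv i \<phi> x\<bar> \<le> M"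
    by (rule test_functionE[OF assms(1)]) (rule that)
  show "integrable lebesgue (\<lambda>x. w x * \<phi> x)"
    by (rule locally_integrable_mult[OF assms(2) continuous_lebesgue_measurable[OF *(1)] *(3) *(5)])
  show "integrable lebesgue (\<lambda>x. w x * partial_deriv i \<phi> x)"
    by (rule locally_integrable_mult[OF assms(2) continuous_lebesgue_measurable[OF *(2)] *(4) *(6)])
qed

text \<open>
  By Lebesgue's differentiation theorem, averages over small cubes converge almost everywhere.
\<close>

lemma integral_boxes_zero_imp_AE_zero:
  fixes w :: "'a::euclidean_space \<Rightarrow> real"
  assumes int: "\<And>a b. set_integrable lebesgue (cbox a b) w"
    and 0: "\<And>a b. (LINT x|lebesgue. w x * indicator (box a b) x) = 0"
  shows "AE x in lebesgue. w x = 0"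
proof -
  have "w absolutely_integrable_on cbox a b" for a b using int by simp
  then have i: "w integrable_on cbox a b" for a b
    using set_lebesgue_integral_eq_integral(1) by blast
  have z: "integral (cbox a b) w = 0" for a b
  proof -
    have s: "set_integrable lebesgue (box a b) w"
      by (rule set_integrable_subset[OF int[of a b]]) (auto simp: box_subset_cbox)
    have "integral (cbox a b) w = integral (box a b) w"
      by (rule integral_open_interval[symmetric])
    also have "\<dots> = (LINT x:box a b|lebesgue. w x)"
      using set_lebesgue_integral_eq_integral(2)[OF s] by simp
    also have "\<dots> = 0" using 0[of a b] by (simp add: set_lebesgue_integral_def mult.commute)
    finally show ?thesis .
  qed
  obtain N where N: "negligible N" "\<And>x e. \<lbrakk>x \<notin> N; 0 < e\<rbrakk> \<Longrightarrow>
      \<exists>d>0. \<forall>h. 0 < h \<and> h < d \<longrightarrow>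
        norm (integral (cbox x (x + h *\<^sub>R One)) w /\<^sub>R h ^ DIM('a) - w x) < e"
    by (rule integrable_ccontinuous_explicit[OF i]) (rule that)
  have "w x = 0" if x: "x \<notin> N" for x
  proof (rule ccontr)
    assume "w x \<noteq> 0"
    then obtain d where "d > 0" "\<And>h. 0 < h \<and> h < d \<Longrightarrow> norm (0 /\<^sub>R h ^ DIM('a) - w x) < \<bar>w x\<bar>"
      using N(2)[OF x, of "\<bar>w x\<bar>"] unfolding z by auto
    note d = this
    from d(2)[of "d / 2"] d(1) show False by simp
  qed
  then show ?thesis
    using N(1) by (auto simp: negligible_iff_null_sets eventually_ae_filter)
qed

text \<open>The fundamental lemma of the calculus of variations.\<close>

lemma test_functions_separate:
  fixes w :: "real^'n \<Rightarrow> real"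
  assumes li: "locally_integrable w"
    and 0: "\<And>\<phi>. test_function \<phi> \<Longrightarrow> (LINT x|lebesgue. w x * \<phi> x) = 0"
  shows "AE x in lebesgue. w x = 0"
proof (rule integral_boxes_zero_imp_AE_zero)
  have wm [measurable]: "w \<in> borel_measurable lebesgue" by (rule locally_integrable_measurable[OF li])
  show int: "set_integrable lebesgue (cbox a b) w" for a b
    using li by (auto simp: locally_integrable_def)
  fix a b :: "real^'n"
  define \<phi> where "\<phi> = (\<lambda>m x. \<Prod>i\<in>UNIV. bump m (a $ i) (b $ i) (x $ i))"
  have sup: "x \<in> box a b" if "\<phi> m x \<noteq> 0" for m x
  proof -
    have "bump m (a $ i) (b $ i) (x $ i) \<noteq> 0" for i using that by (auto simp: \<phi>_def)
    then have "x $ i \<in> {a $ i<..<b $ i}" for i using bump_eq_0 by blast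
    then show ?thesis by (auto simp: mem_box_cart)
  qed
  obtain R where R: "cbox a b \<subseteq> cball 0 R"
    using bounded_subset_ballD[OF bounded_cbox[of a b], of 0]
      order_trans[OF _ ball_subset_cball[of "0::real^'n"]] by blast
  have test: "test_function (\<phi> m)" for m
  proof (rule test_functionI)
    show "csmooth (\<phi> m)" unfolding \<phi>_def
      by (intro csmooth_prod csmooth_comp[OF smooth_bump] csmooth_coord) auto
    show "norm x \<le> R" if "\<phi> m x \<noteq> 0" for x
      using sup[OF that] R box_subset_cbox[of a b] by (auto simp: subset_iff)
  qed
  have m [measurable]: "\<phi> m \<in> borel_measurable lebesgue" for m
    by (rule test_functionE[OF test[of m]]) (rule continuous_lebesgue_measurable)
  have "(\<lambda>m. LINT x|lebesgue. w x * \<phi> m x) \<longlonglongrightarrow> (LINT x|lebesgue. w x * indicator (box a b) x)"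
  proof (rule integral_dominated_convergence)
    show "integrable lebesgue (\<lambda>x. indicator (cbox a b) x * \<bar>w x\<bar>)"
      using integrable_norm[OF int[unfolded set_integrable_def]] by (simp add: abs_mult)
    show "AE x in lebesgue. (\<lambda>m. w x * \<phi> m x) \<longlonglongrightarrow> w x * indicator (box a b) x"
    proof (intro AE_I2 tendsto_mult tendsto_const)
      fix x
      have "(\<lambda>m. \<phi> m x) \<longlonglongrightarrow> (\<Prod>i\<in>UNIV. indicator {a $ i<..<b $ i} (x $ i))"
        unfolding \<phi>_def by (intro tendsto_prod bump_tendsto)
      also have "(\<Prod>i\<in>UNIV. indicator {a $ i<..<b $ i} (x $ i)) = (indicator (box a b) x :: real)"
      proof (cases "x \<in> box a b")
        case False
        then obtain i where "x $ i \<notin> {a $ i<..<b $ i}" by (auto simp: mem_box_cart)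
        then have "(\<Prod>i\<in>UNIV. indicator {a $ i<..<b $ i} (x $ i)) = (0::real)"
          by (intro prod_zero bexI[of _ i]) (auto simp: indicator_def)
        with False show ?thesis by simp
      qed (auto simp: mem_box_cart)
      finally show "(\<lambda>m. \<phi> m x) \<longlonglongrightarrow> indicator (box a b) x" .
    qed
    show "AE x in lebesgue. norm (w x * \<phi> m x) \<le> indicator (cbox a b) x * \<bar>w x\<bar>" for m
    proof (rule AE_I2)
      fix x
      have "0 \<le> \<phi> m x" "\<phi> m x \<le> 1"
        unfolding \<phi>_def by (intro prod_nonneg prod_le_1; simp add: bump_bounds)+
      then have "\<bar>w x\<bar> * \<bar>\<phi> m x\<bar> \<le> \<bar>w x\<bar>" by (intro mult_left_le) auto
      then show "norm (w x * \<phi> m x) \<le> indicator (cbox a b) x * \<bar>w x\<bar>"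
        using sup[of m x] box_subset_cbox[of a b] by (cases "\<phi> m x = 0") (auto simp: abs_mult)
    qed
  qed (auto intro!: borel_measurable_times wm m borel_measurable_indicator)
  then show "(LINT x|lebesgue. w x * indicator (box a b) x) = 0"
    unfolding 0[OF test] by (rule LIMSEQ_unique[OF _ tendsto_const])
qed

lemma locally_integrable_component:
  "locally_integrable (g :: real^'n \<Rightarrow> real^'m) \<Longrightarrow> locally_integrable (\<lambda>x. g x $ i)"
  unfolding locally_integrable_def set_integrable_def
proof (intro allI impI)
  fix K :: "(real^'n) set"
  assume "\<forall>K. compact K \<longrightarrow> integrable lebesgue (\<lambda>x. indicat_real K x *\<^sub>R g x)" "compact K"
  then have "integrable lebesgue (\<lambda>x. indicat_real K x *\<^sub>R g x)" by blast
  from integrable_bounded_linear[OF bounded_linear_vec_nth this]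
  show "integrable lebesgue (\<lambda>x. indicat_real K x *\<^sub>R g x $ i)" by simp
qed

lemma has_weak_gradient_unique:
  assumes "has_weak_gradient u g" "has_weak_gradient u g'"
  shows "AE x in lebesgue. g x = g' x"
proof -
  have l: "locally_integrable (\<lambda>x. g x $ i)" "locally_integrable (\<lambda>x. g' x $ i)" for i
    using assms by (auto simp: has_weak_gradient_def intro: locally_integrable_component)
  have "AE x in lebesgue. g x $ i - g' x $ i = 0" for i
  proof (rule test_functions_separate)
    show "locally_integrable (\<lambda>x. g x $ i - g' x $ i)"
      using l unfolding locally_integrable_def by (auto intro!: set_integral_diff)
    fix \<phi> :: "real^'a \<Rightarrow> real" assume t: "test_function \<phi>"
    have "(LINT x|lebesgue. (g x $ i - g' x $ i) * \<phi> x)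
        = (LINT x|lebesgue. g x $ i * \<phi> x) - (LINT x|lebesgue. g' x $ i * \<phi> x)"
      unfolding left_diff_distrib
      by (intro Bochner_Integration.integral_diff test_function_integrable[OF t] l)
    also have "\<dots> = 0"
    proof -
      have "- (LINT x|lebesgue. g x $ i * \<phi> x) = - (LINT x|lebesgue. g' x $ i * \<phi> x)"
        using assms t unfolding has_weak_gradient_def by simp
      then show ?thesis by simp
    qed
    finally show "(LINT x|lebesgue. (g x $ i - g' x $ i) * \<phi> x) = 0" .
  qed
  then have "AE x in lebesgue. \<forall>i. g x $ i - g' x $ i = 0"
    by (simp add: AE_all_countable)
  then show ?thesis by eventually_elim (simp add: vec_eq_iff)
qed

lemma has_weak_gradient_weak_gradient:
  "has_weak_gradient u g \<Longrightarrow> has_weak_gradient u (weak_gradient u)"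
  unfolding weak_gradient_def by (rule someI[of _ g])

lemma grad_norm_eq:
  assumes "has_weak_gradient u g"
  shows "grad_norm u = epowr (sq_integral g) (1 / 2)"
proof -
  have "AE x in lebesgue. weak_gradient u x = g x"
    using has_weak_gradient_unique[OF has_weak_gradient_weak_gradient[OF assms] assms] .
  then have "(\<integral>\<^sup>+ x. ennreal ((norm (weak_gradient u x))\<^sup>2) \<partial>lebesgue)
    = sq_integral g"
    by (intro nn_integral_cong_AE) (auto elim: eventually_mono)
  then show ?thesis by (simp add: grad_norm_def)
qed

section \<open>The space of square integrable functions\<close>

lemma integrable_sq_nn:
  fixes f :: "'a \<Rightarrow> 'b::{banach, second_countable_topology}"
  assumes "f \<in> borel_measurable M"
  shows "integrable M (\<lambda>x. (norm (f x))\<^sup>2) \<longleftrightarrow> (\<integral>\<^sup>+ x. ennreal ((norm (f x))\<^sup>2) \<partial>M) < \<infinity>"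
  using assms by (simp add: integrable_iff_bounded)

lemma Cauchy_Schwarz_integral:
  fixes f g :: "'a \<Rightarrow> real"
  assumes [measurable]: "f \<in> borel_measurable M" "g \<in> borel_measurable M"
    and f2: "integrable M (\<lambda>x. (f x)\<^sup>2)" and g2: "integrable M (\<lambda>x. (g x)\<^sup>2)"
  shows "integrable M (\<lambda>x. f x * g x)"
    and "(LINT x|M. f x * g x)\<^sup>2 \<le> (LINT x|M. (f x)\<^sup>2) * (LINT x|M. (g x)\<^sup>2)"
proof -
  have "integrable M (\<lambda>x. (f x)\<^sup>2 + (g x)\<^sup>2)" using f2 g2 by simp
  then show i: "integrable M (\<lambda>x. f x * g x)"
  proof (rule Bochner_Integration.integrable_bound)
    have "\<bar>f x * g x\<bar> \<le> (f x)\<^sup>2 + (g x)\<^sup>2" for x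
      using sum_squares_bound[of "\<bar>f x\<bar>" "\<bar>g x\<bar>"] abs_ge_zero[of "f x * g x"]
      unfolding power2_abs abs_mult by linarith
    then show "AE x in M. norm (f x * g x) \<le> norm ((f x)\<^sup>2 + (g x)\<^sup>2)" by simp
  qed measurable
  define I where "I = (LINT x|M. \<bar>f x\<bar> * \<bar>g x\<bar>)"
  have i': "integrable M (\<lambda>x. \<bar>f x\<bar> * \<bar>g x\<bar>)" using integrable_abs[OF i] by (simp add: abs_mult)
  have "(\<integral>\<^sup>+x. ennreal \<bar>f x\<bar> * ennreal \<bar>g x\<bar> \<partial>M)\<^sup>2
      \<le> (\<integral>\<^sup>+x. (ennreal \<bar>f x\<bar>)\<^sup>2 \<partial>M) * (\<integral>\<^sup>+x. (ennreal \<bar>g x\<bar>)\<^sup>2 \<partial>M)"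
    by (rule Cauchy_Schwarz_nn_integral) measurable
  also have "(\<integral>\<^sup>+x. ennreal \<bar>f x\<bar> * ennreal \<bar>g x\<bar> \<partial>M) = ennreal I"
    unfolding I_def using i' by (subst nn_integral_eq_integral[symmetric]) (auto simp: ennreal_mult)
  also have "(\<integral>\<^sup>+x. (ennreal \<bar>f x\<bar>)\<^sup>2 \<partial>M) = ennreal (LINT x|M. (f x)\<^sup>2)"
    using f2 by (subst nn_integral_eq_integral[symmetric]) (auto simp: ennreal_power)
  also have "(\<integral>\<^sup>+x. (ennreal \<bar>g x\<bar>)\<^sup>2 \<partial>M) = ennreal (LINT x|M. (g x)\<^sup>2)"
    using g2 by (subst nn_integral_eq_integral[symmetric]) (auto simp: ennreal_power)
  finally have "ennreal (I\<^sup>2) \<le> ennreal ((LINT x|M. (f x)\<^sup>2) * (LINT x|M. (g x)\<^sup>2))"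
    by (simp add: ennreal_power I_def ennreal_mult)
  then have "I\<^sup>2 \<le> (LINT x|M. (f x)\<^sup>2) * (LINT x|M. (g x)\<^sup>2)"
    by (subst (asm) ennreal_le_iff) auto
  moreover have "\<bar>LINT x|M. f x * g x\<bar> \<le> I"
    unfolding I_def using integral_norm_bound[of M "\<lambda>x. f x * g x"] by (simp add: abs_mult)
  then have "(LINT x|M. f x * g x)\<^sup>2 \<le> I\<^sup>2"
    using power_mono[of "\<bar>LINT x|M. f x * g x\<bar>" I 2] by simp
  ultimately show "(LINT x|M. f x * g x)\<^sup>2 \<le> (LINT x|M. (f x)\<^sup>2) * (LINT x|M. (g x)\<^sup>2)"
    by linarith
qed

text \<open>Completeness of \<open>L\<^sup>2\<close>.\<close>

lemma L2_complete:
  fixes V :: "nat \<Rightarrow> 'a \<Rightarrow> 'b::euclidean_space"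
  assumes m [measurable]: "\<And>m. V m \<in> borel_measurable M"
    and cau: "\<And>m l. m \<le> l \<Longrightarrow> (\<integral>\<^sup>+ x. ennreal ((norm (V m x - V l x))\<^sup>2) \<partial>M) \<le> ennreal (\<delta> m)"
    and \<delta>: "\<delta> \<longlonglongrightarrow> 0"
  obtains v r where "v \<in> borel_measurable M" "strict_mono r" "AE x in M. (\<lambda>j. V (r j) x) \<longlonglongrightarrow> v x"
    "\<And>m. (\<integral>\<^sup>+ x. ennreal ((norm (V m x - v x))\<^sup>2) \<partial>M) \<le> ennreal (\<delta> m)"
proof -
  have "\<exists>n>N. \<delta> n \<le> (1/4)^j" for N j :: nat
  proof -
    have "eventually (\<lambda>n. \<delta> n < (1/4)^j) sequentially"
      using \<delta> by (rule order_tendstoD) auto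
    then have "eventually (\<lambda>n. \<delta> n < (1/4)^j \<and> n > N) sequentially"
      using eventually_gt_at_top by (rule eventually_conj)
    then show ?thesis using eventually_happens[of _ sequentially] by (auto intro: less_imp_le)
  qed
  then obtain nx where nx: "\<And>N j. nx N j > N" "\<And>N j. \<delta> (nx N j) \<le> (1/4)^j" by metis
  \<comment> \<open>A subsequence so sparse that consecutive terms have squared distance at most \<open>4\<^bsup>-j\<^esup>\<close>.\<close>
  define r where "r = rec_nat (nx 0 0) (\<lambda>j N. nx N (Suc j))"
  have rS: "r (Suc j) = nx (r j) (Suc j)" and r0: "r 0 = nx 0 0" for j by (simp_all add: r_def)
  have mono: "strict_mono r" by (auto simp: strict_mono_Suc_iff rS nx)
  have r\<delta>: "\<delta> (r j) \<le> (1/4)^j" for j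
    using nx(2)[where j = j] rS r0 by (cases j) metis+
  define D where "D = (\<lambda>j x. V (r (Suc j)) x - V (r j) x)"
  have "(\<integral>\<^sup>+ x. (\<Sum>j. ennreal (2^j * (norm (D j x))\<^sup>2)) \<partial>M) = (\<Sum>j. (\<integral>\<^sup>+ x. ennreal (2^j * (norm (D j x))\<^sup>2) \<partial>M))"
    unfolding D_def by (rule nn_integral_suminf) measurable
  also have "\<dots> \<le> (\<Sum>j. ennreal ((1/2)^j))"
  proof (rule suminf_le)
    fix j
    have "(\<integral>\<^sup>+ x. ennreal (2^j * (norm (D j x))\<^sup>2) \<partial>M) = ennreal (2^j) * (\<integral>\<^sup>+ x. ennreal ((norm (V (r j) x - V (r (Suc j)) x))\<^sup>2) \<partial>M)"
      unfolding D_def by (subst nn_integral_cmult[symmetric]) (auto simp: ennreal_mult norm_minus_commute)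
    also have "\<dots> \<le> ennreal (2^j) * ennreal (\<delta> (r j))"
      by (intro mult_left_mono cau) (use mono in \<open>auto simp: strict_mono_less_eq\<close>)
    also have "\<dots> \<le> ennreal (2^j) * ennreal ((1/4)^j)"
      by (intro mult_left_mono ennreal_leI r\<delta>) auto
    also have "\<dots> = ennreal ((1/2)^j)"
      by (subst ennreal_mult[symmetric]) (auto simp flip: power_mult_distrib)
    finally show "(\<integral>\<^sup>+ x. ennreal (2^j * (norm (D j x))\<^sup>2) \<partial>M) \<le> ennreal ((1/2)^j)" .
  qed auto
  also have "\<dots> < \<infinity>"
    by (subst suminf_ennreal2) (auto intro: summable_geometric)
  finally have fin: "AE x in M. (\<Sum>j. ennreal (2^j * (norm (D j x))\<^sup>2)) \<noteq> \<infinity>"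
    unfolding D_def by (intro nn_integral_noteq_infinite) auto
  have conv: "AE x in M. convergent (\<lambda>j. V (r j) x)"
    using fin
  proof eventually_elim
    case (elim x)
    then have s: "summable (\<lambda>j. 2^j * (norm (D j x))\<^sup>2)"
      by (intro summable_suminf_not_top) auto
    have "summable (\<lambda>j. (1/2)^j + 2^j * (norm (D j x))\<^sup>2)"
      by (intro summable_add s summable_geometric) auto
    then have "summable (\<lambda>j. D j x)"
    proof (rule summable_comparison_test'[of _ 0])
      fix j
      \<comment> \<open>Young's inequality with weight \<open>2\<^sup>j\<close> bounds \<open>|D\<^sub>j|\<close> by a geometric term plus a summable
        multiple of \<open>|D\<^sub>j|\<^sup>2\<close>.\<close>
      have "2 * (norm (D j x)) * 1 \<le> 2^j * (norm (D j x))\<^sup>2 + (1/2)^j"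
      proof -
        define s where "s = sqrt (2^j)"
        have s: "s > 0" "s\<^sup>2 = 2^j" by (auto simp: s_def)
        have "2 * (s * norm (D j x)) * (1/s) \<le> (s * norm (D j x))\<^sup>2 + (1/s)\<^sup>2"
          by (rule sum_squares_bound)
        then show ?thesis using s by (simp add: power_mult_distrib power_divide)
      qed
      then show "norm (D j x) \<le> (1/2)^j + 2^j * (norm (D j x))\<^sup>2"
        using norm_ge_zero[of "D j x"] by linarith
    qed
    then have "convergent (\<lambda>n. (\<Sum>j<n. V (r (Suc j)) x - V (r j) x))"
      by (simp add: D_def summable_iff_convergent)
    then have "convergent (\<lambda>n. V (r n) x - V (r 0) x)"
      using sum_lessThan_telescope[of "\<lambda>j. V (r j) x"] by simp
    then show "convergent (\<lambda>j. V (r j) x)"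
      by (simp only: convergent_diff_const_right_iff)
  qed
  define v where "v = (\<lambda>x. lim (\<lambda>j. V (r j) x))"
  have vm [measurable]: "v \<in> borel_measurable M"
    unfolding v_def by (rule borel_measurable_lim_metric) measurable
  have lim: "AE x in M. (\<lambda>j. V (r j) x) \<longlonglongrightarrow> v x"
    using conv by (auto simp: v_def convergent_LIMSEQ_iff)
  have "(\<integral>\<^sup>+ x. ennreal ((norm (V m x - v x))\<^sup>2) \<partial>M) \<le> ennreal (\<delta> m)" for m
  proof -
    have "(\<integral>\<^sup>+ x. ennreal ((norm (V m x - v x))\<^sup>2) \<partial>M)
        = (\<integral>\<^sup>+ x. liminf (\<lambda>j. ennreal ((norm (V m x - V (r j) x))\<^sup>2)) \<partial>M)"
    proof (rule nn_integral_cong_AE)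
      show "AE x in M. ennreal ((norm (V m x - v x))\<^sup>2) = liminf (\<lambda>j. ennreal ((norm (V m x - V (r j) x))\<^sup>2))"
        using lim
      proof eventually_elim
        case (elim x)
        then have "(\<lambda>j. ennreal ((norm (V m x - V (r j) x))\<^sup>2)) \<longlonglongrightarrow> ennreal ((norm (V m x - v x))\<^sup>2)"
          by (intro tendsto_intros)
        then show ?case by (rule lim_imp_Liminf[OF trivial_limit_sequentially, symmetric])
      qed
    qed
    also have "\<dots> \<le> liminf (\<lambda>j. \<integral>\<^sup>+ x. ennreal ((norm (V m x - V (r j) x))\<^sup>2) \<partial>M)"
      by (rule nn_integral_liminf) measurable
    also have "\<dots> \<le> liminf (\<lambda>j. ennreal (\<delta> m))"
    proof (rule Liminf_mono, rule eventually_sequentiallyI[of m])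
      fix j assume "m \<le> j"
      then have "m \<le> r j" using seq_suble[OF mono, of j] by linarith
      then show "(\<integral>\<^sup>+ x. ennreal ((norm (V m x - V (r j) x))\<^sup>2) \<partial>M) \<le> ennreal (\<delta> m)" by (rule cau)
    qed
    finally show ?thesis by (simp add: Liminf_const)
  qed
  from that[OF vm mono lim this] show ?thesis .
qed

lemma L2_locally_integrable:
  fixes v :: "real^'n \<Rightarrow> 'b::euclidean_space"
  assumes "v \<in> borel_measurable lebesgue" "integrable lebesgue (\<lambda>x. (norm (v x))\<^sup>2)"
  shows "locally_integrable v"
  unfolding locally_integrable_def
proof (intro allI impI)
  fix K :: "(real^'n) set" assume "compact K"
  then have K: "K \<in> lmeasurable" by (rule lmeasurable_compact)
  have "integrable lebesgue (indicator K :: _ \<Rightarrow> real)"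
    using K by (intro integrable_real_indicator) (auto simp: fmeasurable_def)
  then have "integrable lebesgue (\<lambda>x. indicator K x + (norm (v x))\<^sup>2)" using assms(2) by simp
  then show "set_integrable lebesgue K v"
    unfolding set_integrable_def
  proof (rule Bochner_Integration.integrable_bound)
    show "(\<lambda>x. indicator K x *\<^sub>R v x) \<in> borel_measurable lebesgue"
      using K assms(1) by (intro borel_measurable_scaleR borel_measurable_indicator) auto
    have "norm (indicator K x *\<^sub>R v x) \<le> norm (indicator K x + (norm (v x))\<^sup>2)" for x
      using sum_squares_bound[of 1 "norm (v x)"] norm_ge_zero[of "v x"]
      by (simp add: indicator_def del: norm_ge_zero)
    then show "AE x in lebesgue. norm (indicator K x *\<^sub>R v x) \<le> norm (indicator K x + (norm (v x))\<^sup>2)"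
      by simp
  qed
qed

lemma continuous_locally_integrable:
  fixes f :: "real^'n \<Rightarrow> 'b::euclidean_space"
  assumes "continuous_on UNIV f"
  shows "locally_integrable f"
  unfolding locally_integrable_def
proof (intro allI impI)
  fix K :: "(real^'n) set" assume K: "compact K"
  then obtain a where "K \<subseteq> cbox (-a) a"
    using bounded_subset_cbox_symmetric compact_imp_bounded by metis
  moreover have "set_integrable lebesgue (cbox (-a) a) f"
    using absolutely_integrable_continuous continuous_on_subset[OF assms] by blast
  ultimately show "set_integrable lebesgue K f"
    using set_integrable_subset[of lebesgue "cbox (-a) a" f K] lmeasurable_compact[OF K] by blast
qed

lemma test_function_sq_integrable:
  assumes "test_function (\<phi>::real^'n \<Rightarrow> real)"
  shows "\<phi> \<in> borel_measurable lebesgue" "integrable lebesgue (\<lambda>x. (\<phi> x)\<^sup>2)"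
    "locally_integrable \<phi>"
proof -
  have c: "continuous_on UNIV \<phi>" by (rule test_functionE[OF assms])
  show "\<phi> \<in> borel_measurable lebesgue" by (rule continuous_lebesgue_measurable[OF c])
  show l: "locally_integrable \<phi>"
    by (rule continuous_locally_integrable[OF c])
  show "integrable lebesgue (\<lambda>x. (\<phi> x)\<^sup>2)"
    using test_function_integrable(1)[OF assms l] by (simp add: power2_eq_square)
qed

section \<open>Lower semicontinuity of the Dirichlet integral\<close>

lemma LIMSEQ_const_over_Suc: "(\<lambda>m. c / (real m + 1)) \<longlonglongrightarrow> 0"
  using LIMSEQ_Suc[OF lim_const_over_n[of c]] by (simp add: add.commute)

lemma norm_sq_mid_parallelogram:
  fixes a b :: "'a::real_inner"
  shows "(norm (a - b))\<^sup>2 = 2 * (norm a)\<^sup>2 + 2 * (norm b)\<^sup>2 - 4 * (norm ((1/2) *\<^sub>R (a + b)))\<^sup>2"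
  unfolding power2_norm_eq_inner by (simp add: inner_add inner_diff inner_commute algebra_simps)

lemma norm_add_sq_le:
  fixes a b :: "'a::real_inner"
  shows "(norm (a + b))\<^sup>2 \<le> 2 * (norm a)\<^sup>2 + 2 * (norm b)\<^sup>2"
  using zero_le_power2[of "norm (a - b)"]
  unfolding power2_norm_eq_inner by (simp add: inner_add inner_diff inner_commute algebra_simps)

lemma component_sq_le_norm_sq: "((x::real^'n) $ i)\<^sup>2 \<le> (norm x)\<^sup>2"
  using power_mono[OF component_le_norm_cart[of x i], of 2] by simp

text \<open>
  If \<open>u\<^sub>k\<close> converges to \<open>u0\<close> against derivatives of test functions, then \<open>u0\<close> has a weak gradient whose
  Dirichlet integral is at most the limit of upper bounds for those of the \<open>u\<^sub>k\<close>. The proof finds the gradient as a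
  strong limit. The set \<open>C m\<close> of all square integrable fields whose defect \<open>err\<close> in the weak
  formulation, for every test function, is at most the largest defect of the \<open>G k\<close> with \<open>k \<ge> m\<close>, is convex
  and contains those \<open>G k\<close>. Fields \<open>V m\<close> of nearly minimal norm in \<open>C m\<close> form a Cauchy sequence.
\<close>

lemma weak_gradient_limit:
  fixes u :: "nat \<Rightarrow> real^'n \<Rightarrow> real" and \<gamma> :: "nat \<Rightarrow> real"
  assumes wg: "\<And>k. has_weak_gradient (u k) (G k)"
    and u0: "locally_integrable u0"
    and conv: "\<And>\<phi> i. test_function \<phi> \<Longrightarrow>
      (\<lambda>k. LINT x|lebesgue. u k x * partial_deriv i \<phi> x) \<longlonglongrightarrow> (LINT x|lebesgue. u0 x * partial_deriv i \<phi> x)"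
    and \<gamma>: "\<And>k. sq_integral (G k) \<le> ennreal (\<gamma> k)" "\<gamma> \<longlonglongrightarrow> \<gamma>0" "\<And>k. 0 \<le> \<gamma> k"
  obtains g where "has_weak_gradient u0 g" "sq_integral g \<le> ennreal \<gamma>0"
proof -
  define sq :: "(real^'n \<Rightarrow> real^'n) \<Rightarrow> real" where "sq v = (LINT x|lebesgue. (norm (v x))\<^sup>2)" for v
  define err where "err \<phi> i v = \<bar>(LINT x|lebesgue. u0 x * partial_deriv i \<phi> x) + (LINT x|lebesgue. v x $ i * \<phi> x)\<bar>"
    for \<phi> :: "real^'n \<Rightarrow> real" and i and v :: "real^'n \<Rightarrow> real^'n"
  define e where "e m \<phi> i = (SUP k\<in>{m..}. err \<phi> i (G k))" for m :: nat and \<phi> i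
  have err_tendsto: "(\<lambda>k. err \<phi> i (G k)) \<longlonglongrightarrow> 0" if t: "test_function \<phi>" for \<phi> i
  proof -
    have "err \<phi> i (G k) = \<bar>(LINT x|lebesgue. u0 x * partial_deriv i \<phi> x) - (LINT x|lebesgue. u k x * partial_deriv i \<phi> x)\<bar>" for k
      using wg[of k] t by (simp add: err_def has_weak_gradient_def)
    moreover have "(\<lambda>k. \<bar>(LINT x|lebesgue. u0 x * partial_deriv i \<phi> x) - (LINT x|lebesgue. u k x * partial_deriv i \<phi> x)\<bar>)
       \<longlonglongrightarrow> \<bar>(LINT x|lebesgue. u0 x * partial_deriv i \<phi> x) - (LINT x|lebesgue. u0 x * partial_deriv i \<phi> x)\<bar>"
      by (intro tendsto_intros conv t)
    ultimately show ?thesis by simp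
  qed
  have bdd: "bdd_above ((\<lambda>k. err \<phi> i (G k)) ` A)" if t: "test_function \<phi>" for \<phi> i A
  proof -
    have "Bseq (\<lambda>k. err \<phi> i (G k))" using err_tendsto[OF t] convergent_imp_Bseq convergentI by blast
    then obtain K where "\<And>k. \<bar>err \<phi> i (G k)\<bar> \<le> K" by (auto simp: Bseq_def)
    then show ?thesis by (intro bdd_aboveI2[of _ _ K]) (auto intro: order_trans[OF abs_ge_self])
  qed
  have err_le_e: "err \<phi> i (G k) \<le> e m \<phi> i" if "test_function \<phi>" "m \<le> k" for \<phi> i m k
    unfolding e_def by (rule cSUP_upper) (use bdd that in auto)
  have e_anti: "e l \<phi> i \<le> e m \<phi> i" if "test_function \<phi>" "m \<le> l" for \<phi> i m l
    unfolding e_def by (rule cSUP_subset_mono) (use bdd that in auto)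
  have e_tendsto: "(\<lambda>m. e m \<phi> i) \<longlonglongrightarrow> 0" if t: "test_function \<phi>" for \<phi> i
  proof (rule LIMSEQ_I)
    fix r :: real assume "r > 0"
    then obtain N where N: "\<And>k. k \<ge> N \<Longrightarrow> \<bar>err \<phi> i (G k)\<bar> < r / 2"
      using LIMSEQ_D[OF err_tendsto[OF t, of i], of "r / 2"] by auto
    have "norm (e m \<phi> i - 0) < r" if "m \<ge> N" for m
    proof -
      have "e m \<phi> i \<le> r / 2" unfolding e_def
      proof (rule cSUP_least)
        fix k assume "k \<in> {m..}"
        then show "err \<phi> i (G k) \<le> r / 2" using N[of k] that by simp
      qed simp
      moreover have "0 \<le> e m \<phi> i"
        using err_le_e[OF t, of m m i] by (auto simp: err_def intro: order_trans[OF abs_ge_zero])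
      ultimately show ?thesis using \<open>r > 0\<close> by simp
    qed
    then show "\<exists>N. \<forall>m\<ge>N. norm (e m \<phi> i - 0) < r" by blast
  qed
  define C where "C m = {v. v \<in> borel_measurable lebesgue \<and> integrable lebesgue (\<lambda>x. (norm (v x))\<^sup>2) \<and>
      (\<forall>\<phi> i. test_function \<phi> \<longrightarrow> err \<phi> i v \<le> e m \<phi> i)}" for m
  have Gm: "G k \<in> borel_measurable lebesgue" for k
    using wg[of k] by (auto simp: has_weak_gradient_def intro: locally_integrable_measurable)
  have G2: "integrable lebesgue (\<lambda>x. (norm (G k x))\<^sup>2)" for k
    using \<gamma>(1)[of k] Gm by (auto simp: integrable_sq_nn intro: order_le_less_trans)
  have GC: "G k \<in> C m" if "m \<le> k" for m k
    using Gm G2 err_le_e that by (auto simp: C_def)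
  have sqG: "sq (G k) \<le> \<gamma> k" for k
  proof -
    have "ennreal (sq (G k)) \<le> ennreal (\<gamma> k)"
      using \<gamma>(1)[of k] unfolding sq_def by (subst nn_integral_eq_integral[symmetric]) (use G2 in auto)
    then show ?thesis using \<gamma>(3) by (simp add: ennreal_le_iff)
  qed
  define d where "d m = Inf (sq ` C m)" for m
  have sq0: "0 \<le> sq v" for v by (simp add: sq_def)
  have bb: "bdd_below (sq ` A)" for A by (rule bdd_belowI2[of _ 0]) (rule sq0)
  have d_le: "d m \<le> sq v" if "v \<in> C m" for m v
    unfolding d_def using bb that by (intro cINF_lower)
  have C_anti: "C l \<subseteq> C m" if "m \<le> l" for m l
  proof
    fix v assume v: "v \<in> C l"
    have "err \<phi> i v \<le> e m \<phi> i" if "test_function \<phi>" for \<phi> i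
      using v that by (intro order_trans[OF _ e_anti[OF that \<open>m \<le> l\<close>]]) (simp add: C_def)
    with v show "v \<in> C m" by (simp add: C_def)
  qed
  have d_mono: "d m \<le> d l" if "m \<le> l" for m l
    unfolding d_def using C_anti[OF that] GC[of l l] bb by (intro cINF_superset_mono) auto
  have d_le_\<gamma>: "d m \<le> \<gamma>0" for m
  proof (rule LIMSEQ_le_const[OF \<gamma>(2)], intro exI allI impI)
    fix k assume "m \<le> k"
    show "d m \<le> \<gamma> k" by (rule order_trans[OF d_le[OF GC[OF \<open>m \<le> k\<close>]] sqG])
  qed
  have "\<exists>v\<in>C m. sq v < d m + 1 / (real m + 1)" for m
  proof -
    have "\<exists>y\<in>sq ` C m. y < d m + 1 / (real m + 1)"
      unfolding d_def by (rule cInf_lessD) (use GC in auto)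
    then show ?thesis by blast
  qed
  then obtain V where V: "\<And>m. V m \<in> C m" "\<And>m. sq (V m) < d m + 1 / (real m + 1)" by metis
  have Vm [measurable]: "V m \<in> borel_measurable lebesgue" and V2: "integrable lebesgue (\<lambda>x. (norm (V m x))\<^sup>2)" for m
    using V(1)[of m] by (auto simp: C_def)
  have "incseq d" using d_mono by (auto simp: incseq_def)
  then obtain D where D: "d \<longlonglongrightarrow> D" "\<And>m. d m \<le> D"
    using incseq_convergent[of d \<gamma>0] d_le_\<gamma> by blast
  define \<delta> where "\<delta> m = 2 * (D - d m) + 4 / (real m + 1)" for m
  have \<delta>: "\<delta> \<longlonglongrightarrow> 2 * (D - D) + 0"
    unfolding \<delta>_def by (intro tendsto_intros D LIMSEQ_const_over_Suc)
  \<comment> \<open>The midpoint of \<open>V m\<close> and \<open>V l\<close> lies in \<open>C m\<close>, so its squared norm is at least \<open>d m\<close>; the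
    parallelogram law then bounds the distance of \<open>V m\<close> and \<open>V l\<close>.\<close>
  have cau: "(\<integral>\<^sup>+ x. ennreal ((norm (V m x - V l x))\<^sup>2) \<partial>lebesgue) \<le> ennreal (\<delta> m)" if "m \<le> l" for m l
  proof -
    define mid where "mid = (\<lambda>x. (1/2) *\<^sub>R (V m x + V l x))"
    have midm [measurable]: "mid \<in> borel_measurable lebesgue" unfolding mid_def by measurable
    have i2: "integrable lebesgue (\<lambda>x. (norm (mid x))\<^sup>2)"
    proof (rule Bochner_Integration.integrable_bound)
      show "integrable lebesgue (\<lambda>x. (norm (V m x))\<^sup>2 + (norm (V l x))\<^sup>2)" using V2 by simp
      have "norm ((norm (mid x))\<^sup>2) \<le> norm ((norm (V m x))\<^sup>2 + (norm (V l x))\<^sup>2)" for x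
      proof -
        have "(norm (mid x))\<^sup>2 = (norm (V m x + V l x))\<^sup>2 / 4" by (simp add: mid_def power_divide)
        moreover have "0 \<le> (norm (V m x))\<^sup>2" "0 \<le> (norm (V l x))\<^sup>2" by auto
        ultimately have "(norm (mid x))\<^sup>2 \<le> (norm (V m x))\<^sup>2 + (norm (V l x))\<^sup>2"
          using norm_add_sq_le[of "V m x" "V l x"] by linarith
        then show ?thesis
          by (simp only: real_norm_def abs_of_nonneg[OF zero_le_power2]
              abs_of_nonneg[OF add_nonneg_nonneg[OF zero_le_power2 zero_le_power2]])
      qed
      then show "AE x in lebesgue. norm ((norm (mid x))\<^sup>2) \<le> norm ((norm (V m x))\<^sup>2 + (norm (V l x))\<^sup>2)" by simp
    qed measurable
    have Vl: "V l \<in> C m" using V(1) C_anti[OF that] by blast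
    have midC: "mid \<in> C m"
    proof -
      have "err \<phi> i mid \<le> e m \<phi> i" if t: "test_function \<phi>" for \<phi> i
      proof -
        have I: "integrable lebesgue (\<lambda>x. V k x $ i * \<phi> x)" for k
          by (intro test_function_integrable[OF t] locally_integrable_component L2_locally_integrable Vm V2)
        have "(LINT x|lebesgue. mid x $ i * \<phi> x)
            = (LINT x|lebesgue. (1/2) * (V m x $ i * \<phi> x) + (1/2) * (V l x $ i * \<phi> x))"
          unfolding mid_def by (intro Bochner_Integration.integral_cong) (auto simp: algebra_simps)
        also have "\<dots> = (1/2) * (LINT x|lebesgue. V m x $ i * \<phi> x) + (1/2) * (LINT x|lebesgue. V l x $ i * \<phi> x)"
          using I by (subst Bochner_Integration.integral_add) auto
        finally have mid: "(LINT x|lebesgue. mid x $ i * \<phi> x)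
            = (1/2) * (LINT x|lebesgue. V m x $ i * \<phi> x) + (1/2) * (LINT x|lebesgue. V l x $ i * \<phi> x)" .
        have "\<bar>a + m\<bar> \<le> (1/2) * \<bar>a + b\<bar> + (1/2) * \<bar>a + c\<bar>" if "m = (1/2) * b + (1/2) * c" for a b c m :: real
          unfolding that using abs_triangle_ineq[of "(1/2) * (a + b)" "(1/2) * (a + c)"]
          unfolding abs_mult by (simp add: field_simps)
        from this[OF mid] have "err \<phi> i mid \<le> (1/2) * err \<phi> i (V m) + (1/2) * err \<phi> i (V l)"
          unfolding err_def .
        moreover have "err \<phi> i (V m) \<le> e m \<phi> i" "err \<phi> i (V l) \<le> e m \<phi> i"
          using V(1)[of m] Vl t by (auto simp: C_def)
        ultimately show ?thesis by linarith
      qed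
      then show ?thesis using i2 midm by (auto simp: C_def)
    qed
    have id: "integrable lebesgue (\<lambda>x. (norm (V m x - V l x))\<^sup>2)"
      unfolding norm_sq_mid_parallelogram using i2 V2 by (simp add: mid_def)
    have "(LINT x|lebesgue. (norm (V m x - V l x))\<^sup>2) = 2 * sq (V m) + 2 * sq (V l) - 4 * sq mid"
      unfolding norm_sq_mid_parallelogram sq_def mid_def using i2[unfolded mid_def] V2 by simp
    also have "\<dots> \<le> 2 * (d m + 1 / (real m + 1)) + 2 * (D + 1 / (real m + 1)) - 4 * d m"
    proof -
      have "1 / (real l + 1) \<le> 1 / (real m + 1)" using that by (intro divide_left_mono) auto
      moreover have "2 * a + 2 * b - 4 * c \<le> 2 * (d1 + t) + 2 * (D' + t) - 4 * d1"
        if "s \<le> t" "a < d1 + t" "b < d2 + s" "d2 \<le> D'" "d1 \<le> c" for a b c d1 d2 D' s t :: real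
        using that by argo
      ultimately show ?thesis
        using V(2)[of m] V(2)[of l] D(2)[of l] d_le[OF midC] by blast
    qed
    also have "\<dots> = \<delta> m" by (simp add: \<delta>_def)
    finally show ?thesis using id by (subst nn_integral_eq_integral) (auto intro: ennreal_leI)
  qed
  obtain v r where v: "v \<in> borel_measurable lebesgue" "strict_mono r" "AE x in lebesgue. (\<lambda>j. V (r j) x) \<longlonglongrightarrow> v x"
    "\<And>m. (\<integral>\<^sup>+ x. ennreal ((norm (V m x - v x))\<^sup>2) \<partial>lebesgue) \<le> ennreal (\<delta> m)"
    using L2_complete[of V lebesgue \<delta>] Vm cau \<delta> by auto
  note [measurable] = v(1)
  have lev: "sq_integral v \<le> ennreal \<gamma>0"
  proof -
    have "sq_integral v
        = (\<integral>\<^sup>+ x. liminf (\<lambda>j. ennreal ((norm (V (r j) x))\<^sup>2)) \<partial>lebesgue)"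
    proof (rule nn_integral_cong_AE)
      show "AE x in lebesgue. ennreal ((norm (v x))\<^sup>2) = liminf (\<lambda>j. ennreal ((norm (V (r j) x))\<^sup>2))"
        using v(3)
      proof eventually_elim
        case (elim x)
        then have "(\<lambda>j. ennreal ((norm (V (r j) x))\<^sup>2)) \<longlonglongrightarrow> ennreal ((norm (v x))\<^sup>2)"
          by (intro tendsto_intros)
        then show ?case by (rule lim_imp_Liminf[OF trivial_limit_sequentially, symmetric])
      qed
    qed
    also have "\<dots> \<le> liminf (\<lambda>j. \<integral>\<^sup>+ x. ennreal ((norm (V (r j) x))\<^sup>2) \<partial>lebesgue)"
      by (rule nn_integral_liminf) measurable
    also have "\<dots> \<le> liminf (\<lambda>j. ennreal (\<gamma>0 + 1 / (real (r j) + 1)))"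
    proof (rule Liminf_mono, rule always_eventually, rule allI)
      fix j
      have "(\<integral>\<^sup>+ x. ennreal ((norm (V (r j) x))\<^sup>2) \<partial>lebesgue) = ennreal (sq (V (r j)))"
        unfolding sq_def using V2 by (intro nn_integral_eq_integral) auto
      also have "\<dots> \<le> ennreal (\<gamma>0 + 1 / (real (r j) + 1))"
        using V(2)[of "r j"] d_le_\<gamma>[of "r j"] by (intro ennreal_leI) linarith
      finally show "(\<integral>\<^sup>+ x. ennreal ((norm (V (r j) x))\<^sup>2) \<partial>lebesgue) \<le> ennreal (\<gamma>0 + 1 / (real (r j) + 1))" .
    qed
    also have "liminf (\<lambda>j. ennreal (\<gamma>0 + 1 / (real (r j) + 1))) = ennreal \<gamma>0"
    proof (rule lim_imp_Liminf)
      have "(\<lambda>m. 1 / (real m + 1)) \<longlonglongrightarrow> 0"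
        by (rule LIMSEQ_const_over_Suc)
      then have "(\<lambda>m. 1 / (real (r m) + 1)) \<longlonglongrightarrow> 0"
        using LIMSEQ_subseq_LIMSEQ[OF _ v(2)] by (fastforce simp: o_def)
      then have "(\<lambda>j. ennreal (\<gamma>0 + 1 / (real (r j) + 1))) \<longlonglongrightarrow> ennreal (\<gamma>0 + 0)"
        by (intro tendsto_intros)
      then show "(\<lambda>j. ennreal (\<gamma>0 + 1 / (real (r j) + 1))) \<longlonglongrightarrow> ennreal \<gamma>0" by simp
    qed simp
    finally show ?thesis .
  qed
  have v2: "integrable lebesgue (\<lambda>x. (norm (v x))\<^sup>2)"
    using lev v(1) by (auto simp: integrable_sq_nn intro: order_le_less_trans)
  have vli: "locally_integrable v" by (rule L2_locally_integrable[OF v(1) v2])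
  have "has_weak_gradient u0 v"
    unfolding has_weak_gradient_def
  proof (intro conjI u0 vli allI impI)
    fix \<phi> :: "real^'n \<Rightarrow> real" and i assume t: "test_function \<phi>"
    define A where "A = (LINT x|lebesgue. (\<phi> x)\<^sup>2)"
    note \<phi> = test_function_sq_integrable[OF t]
    have \<delta>0: "0 \<le> \<delta> m" for m using D(2)[of m] by (simp add: \<delta>_def)
    have close: "\<bar>(LINT x|lebesgue. V m x $ i * \<phi> x) - (LINT x|lebesgue. v x $ i * \<phi> x)\<bar> \<le> sqrt (\<delta> m * A)" for m
    proof -
      have wm: "(\<lambda>x. V m x - v x) \<in> borel_measurable lebesgue" by measurable
      have w2: "integrable lebesgue (\<lambda>x. (norm (V m x - v x))\<^sup>2)"
        using v(4)[of m] wm by (auto simp: integrable_sq_nn intro: order_le_less_trans)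
      have cm: "(\<lambda>x. (V m x - v x) $ i) \<in> borel_measurable lebesgue"
        by (rule locally_integrable_measurable[OF locally_integrable_component[OF L2_locally_integrable[OF wm w2]]])
      have ci: "integrable lebesgue (\<lambda>x. ((V m x - v x) $ i)\<^sup>2)"
      proof (rule Bochner_Integration.integrable_bound[OF w2])
        show "(\<lambda>x. ((V m x - v x) $ i)\<^sup>2) \<in> borel_measurable lebesgue" using cm by measurable
        have "norm (((V m x - v x) $ i)\<^sup>2) \<le> norm ((norm (V m x - v x))\<^sup>2)" for x
          unfolding real_norm_def abs_of_nonneg[OF zero_le_power2] by (rule component_sq_le_norm_sq)
        then show "AE x in lebesgue. norm (((V m x - v x) $ i)\<^sup>2) \<le> norm ((norm (V m x - v x))\<^sup>2)" by simp
      qed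
      have "(LINT x|lebesgue. V m x $ i * \<phi> x) - (LINT x|lebesgue. v x $ i * \<phi> x)
          = (LINT x|lebesgue. V m x $ i * \<phi> x - v x $ i * \<phi> x)"
        by (intro Bochner_Integration.integral_diff[symmetric] test_function_integrable[OF t]
            locally_integrable_component vli L2_locally_integrable Vm V2)
      also have "\<dots> = (LINT x|lebesgue. (V m x - v x) $ i * \<phi> x)"
        by (intro Bochner_Integration.integral_cong) (auto simp: algebra_simps)
      finally have "((LINT x|lebesgue. V m x $ i * \<phi> x) - (LINT x|lebesgue. v x $ i * \<phi> x))\<^sup>2
          \<le> (LINT x|lebesgue. ((V m x - v x) $ i)\<^sup>2) * A"
        unfolding A_def using Cauchy_Schwarz_integral(2)[OF cm \<phi>(1) ci \<phi>(2)] by simp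
      also have "\<dots> \<le> \<delta> m * A"
      proof (rule mult_right_mono)
        have "(LINT x|lebesgue. ((V m x - v x) $ i)\<^sup>2) \<le> (LINT x|lebesgue. (norm (V m x - v x))\<^sup>2)"
          by (intro integral_mono ci w2 component_sq_le_norm_sq)
        also have "\<dots> \<le> \<delta> m"
          using v(4)[of m] \<delta>0 w2 by (subst (asm) nn_integral_eq_integral) auto
        finally show "(LINT x|lebesgue. ((V m x - v x) $ i)\<^sup>2) \<le> \<delta> m" .
      qed (simp add: A_def)
      finally show ?thesis by (subst real_sqrt_abs[symmetric]) (rule real_sqrt_le_mono)
    qed
    have "err \<phi> i v \<le> e m \<phi> i + sqrt (\<delta> m * A)" for m
    proof -
      have "err \<phi> i (V m) \<le> e m \<phi> i" using V(1)[of m] t by (auto simp: C_def)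
      moreover have "\<bar>a + v\<bar> \<le> e + s" if "\<bar>a + w\<bar> \<le> e" "\<bar>w - v\<bar> \<le> s" for a v w e s :: real
        using that by linarith
      ultimately show ?thesis using close[of m] unfolding err_def by blast
    qed
    moreover have "(\<lambda>m. e m \<phi> i + sqrt (\<delta> m * A)) \<longlonglongrightarrow> 0 + sqrt ((2 * (D - D) + 0) * A)"
      by (intro tendsto_intros e_tendsto t \<delta>)
    ultimately have "err \<phi> i v \<le> 0 + sqrt ((2 * (D - D) + 0) * A)"
      by (intro LIMSEQ_le_const) auto
    then show "(LINT x|lebesgue. u0 x * partial_deriv i \<phi> x) = - (LINT x|lebesgue. v x $ i * \<phi> x)"
      by (simp add: err_def)
  qed
  with lev that show ?thesis by blast
qed

section \<open>Radial functions on the plane\<close>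

lemma norm_sq_real2: "(norm (x::real^2))\<^sup>2 = (x $ 1)\<^sup>2 + (x $ 2)\<^sup>2"
  unfolding norm_sq_eq_sum sum_2 by (simp add: power2_eq_square)

lemma emeasure_norm_sq_less:
  "emeasure lborel {x::real^2. (norm x)\<^sup>2 < s} = ennreal (pi * max 0 s)"
proof (cases "s > 0")
  case True
  have "{x::real^2. (norm x)\<^sup>2 < s} = ball 0 (sqrt s)"
    using real_less_rsqrt real_sqrt_less_iff by (auto simp: real_less_rsqrt) (metis norm_ge_zero real_sqrt_less_iff real_sqrt_unique)
  then show ?thesis
    using True by (simp add: emeasure_ball unit_ball_vol_2)
next
  case False
  then have "{x::real^2. (norm x)\<^sup>2 < s} = {}"
    by (auto simp: not_less intro: order_trans)
  with False show ?thesis by (simp add: max_def)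
qed

text \<open>
  Polar coordinates for radial functions: in the variable \<open>s = |x|\<^sup>2\<close> planar Lebesgue measure becomes
  \<open>\<pi>\<close> times Lebesgue measure on the positive half-line.
\<close>

lemma distr_norm_sq:
  "distr lborel borel (\<lambda>x::real^2. (norm x)\<^sup>2) = density lborel (\<lambda>s. ennreal pi * indicator {0<..} s)"
  (is "?M = ?N")
proof (rule measure_eqI_generator_eq[where E = "range lessThan" and \<Omega> = UNIV and A = "\<lambda>n. {..<real n}"])
  show "Int_stable (range (lessThan :: real \<Rightarrow> _))"
  proof (rule Int_stableI)
    fix A B :: "real set" assume "A \<in> range lessThan" "B \<in> range lessThan"
    then obtain a b where "A = {..<a}" "B = {..<b}" by auto
    then have "A \<inter> B = {..<min a b}" by auto
    then show "A \<inter> B \<in> range lessThan" by blast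
  qed
  have M: "emeasure ?M {..<s} = ennreal (pi * max 0 s)" for s
    by (subst emeasure_distr) (auto simp: emeasure_norm_sq_less vimage_def)
  have N: "emeasure ?N {..<s} = ennreal (pi * max 0 s)" for s
  proof -
    have "emeasure ?N {..<s} = (\<integral>\<^sup>+ t. ennreal pi * indicator {0<..<s} t \<partial>lborel)"
      by (subst emeasure_density) (auto intro!: nn_integral_cong simp: indicator_def)
    also have "\<dots> = ennreal pi * ennreal (max 0 s)"
      by (subst nn_integral_cmult_indicator) (auto simp: max_def)
    finally show ?thesis by (simp add: ennreal_mult)
  qed
  show "emeasure ?M X = emeasure ?N X" if "X \<in> range lessThan" for X
    using that M N by auto
  show "emeasure ?M {..<real i} \<noteq> \<infinity>" for i unfolding M by simp
  show "(\<Union>i. {..<real i}) = UNIV" by (auto intro: reals_Archimedean2)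
qed (auto simp: borel_Iio sets_density)

lemma nn_integral_radial:
  assumes [measurable]: "H \<in> borel_measurable borel"
  shows "(\<integral>\<^sup>+ x. H ((norm (x::real^2))\<^sup>2) \<partial>lebesgue) = (\<integral>\<^sup>+ s. ennreal pi * indicator {0<..} s * H s \<partial>lborel)"
proof -
  have "(\<integral>\<^sup>+ x. H ((norm (x::real^2))\<^sup>2) \<partial>lebesgue) = (\<integral>\<^sup>+ s. H s \<partial>distr lborel borel (\<lambda>x::real^2. (norm x)\<^sup>2))"
    by (simp add: nn_integral_completion nn_integral_distr)
  also have "\<dots> = (\<integral>\<^sup>+ s. ennreal pi * indicator {0<..} s * H s \<partial>lborel)"
    unfolding distr_norm_sq by (subst nn_integral_density) auto
  finally show ?thesis .
qed

lemma AE_radial: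
  assumes "AE s in lborel. s > 0 \<longrightarrow> P s"
  shows "AE x in lebesgue. P ((norm (x::real^2))\<^sup>2)"
proof (rule AE_completion)
  have "AE s in density lborel (\<lambda>s. ennreal pi * indicator {0<..} s). P s"
    using assms by (subst AE_density) (auto simp: indicator_def elim: eventually_mono)
  then have "AE s in distr lborel borel (\<lambda>x::real^2. (norm x)\<^sup>2). P s"
    unfolding distr_norm_sq .
  then show "AE x in lborel. P ((norm (x::real^2))\<^sup>2)"
    by (intro AE_distrD[of "\<lambda>x::real^2. (norm x)\<^sup>2" lborel borel]) auto
qed

lemma integral_radial:
  fixes H :: "real \<Rightarrow> real"
  assumes [measurable]: "H \<in> borel_measurable borel"
  shows "integrable lebesgue (\<lambda>x::real^2. H ((norm x)\<^sup>2)) \<longleftrightarrow> integrable lborel (\<lambda>s. indicator {0<..} s * H s)"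
    and "(LINT x|lebesgue. H ((norm (x::real^2))\<^sup>2)) = pi * (LINT s|lborel. indicator {0<..} s * H s)"
proof -
  have d: "density lborel (\<lambda>s. ennreal pi * indicator {0<..} s) = density lborel (\<lambda>s. ennreal (pi * indicator {0<..} s))"
    by (intro arg_cong[of _ _ "density lborel"] ext) (auto simp: indicator_def)
  have "integrable lebesgue (\<lambda>x::real^2. H ((norm x)\<^sup>2)) \<longleftrightarrow> integrable (distr lborel borel (\<lambda>x::real^2. (norm x)\<^sup>2)) H"
    by (subst integrable_distr_eq) (auto simp: integrable_completion)
  also have "\<dots> \<longleftrightarrow> integrable lborel (\<lambda>s. pi * (indicator {0<..} s * H s))"
    unfolding distr_norm_sq d by (subst integrable_density) (auto simp: mult.assoc)
  finally show "integrable lebesgue (\<lambda>x::real^2. H ((norm x)\<^sup>2)) \<longleftrightarrow> integrable lborel (\<lambda>s. indicator {0<..} s * H s)"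
    by simp
  have "(LINT x|lebesgue. H ((norm (x::real^2))\<^sup>2)) = (LINT s|distr lborel borel (\<lambda>x::real^2. (norm x)\<^sup>2). H s)"
    by (subst integral_distr) (auto simp: integral_completion)
  also have "\<dots> = (LINT s|lborel. pi * (indicator {0<..} s * H s))"
    unfolding distr_norm_sq d by (subst integral_density) (auto simp: mult.assoc)
  finally show "(LINT x|lebesgue. H ((norm (x::real^2))\<^sup>2)) = pi * (LINT s|lborel. indicator {0<..} s * H s)"
    by simp
qed

text \<open>
  The identification of \<open>real \<times> real\<close> with \<open>real^2\<close>, used to apply Fubini's theorem.
\<close>

definition vec2 :: "real \<times> real \<Rightarrow> real^2" where
  "vec2 z = (\<chi> i. if i = 1 then fst z else snd z)"

lemma vec2_nth [simp]: "vec2 z $ 1 = fst z" "vec2 z $ 2 = snd z"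
  by (simp_all add: vec2_def)

lemma continuous_vec2: "continuous_on S vec2"
proof -
  have "continuous_on S (\<lambda>z. vec2 z $ i)" for i
    using exhaust_2[of i] by (auto simp: continuous_on_fst continuous_on_snd continuous_on_id)
  then show ?thesis by (subst continuous_on_componentwise) (auto simp: Basis_vec_def inner_axis)
qed

lemma measurable_vec2 [measurable]: "vec2 \<in> borel_measurable borel"
  by (intro borel_measurable_continuous_onI continuous_vec2)

lemma distr_vec2: "distr lborel borel vec2 = (lborel :: (real^2) measure)"
proof (rule lborel_eqI[symmetric])
  fix l u :: "real^2" assume lu: "\<And>b. b \<in> Basis \<Longrightarrow> l \<bullet> b \<le> u \<bullet> b"
  have le: "l $ i \<le> u $ i" for i
    using lu[of "axis i 1"] by (auto simp: Basis_vec_def inner_axis)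
  have "vec2 -` box l u = box (l $ 1, l $ 2) (u $ 1, u $ 2)"
    by (auto simp: mem_box_cart forall_2 mem_box Basis_prod_def)
  then have "emeasure (distr lborel borel vec2) (box l u) = emeasure lborel (box (l $ 1, l $ 2) (u $ 1, u $ 2))"
    by (subst emeasure_distr) auto
  also have "\<dots> = (\<Prod>b\<in>Basis. ((u $ 1, u $ 2) - (l $ 1, l $ 2)) \<bullet> b)"
    using le by (subst emeasure_lborel_box) (auto simp: Basis_prod_def)
  also have "(\<Prod>b\<in>Basis. ((u $ 1, u $ 2) - (l $ 1, l $ 2)) \<bullet> b) = (u $ 1 - l $ 1) * (u $ 2 - l $ 2)"
    by (simp add: Basis_prod_def prod.union_disjoint)
  also have "(u $ 1 - l $ 1) * (u $ 2 - l $ 2) = (\<Prod>b\<in>Basis. (u - l) \<bullet> b)"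
  proof -
    have B: "Basis = (\<lambda>i. axis i 1 :: real^2) ` UNIV" by (auto simp: Basis_vec_def)
    have "(\<Prod>b\<in>Basis. (u - l) \<bullet> b) = (\<Prod>i\<in>UNIV. (u - l) \<bullet> axis i 1)"
      unfolding B by (subst prod.reindex) (auto simp: inj_on_def axis_eq_axis)
    also have "\<dots> = (u $ 1 - l $ 1) * (u $ 2 - l $ 2)"
      by (simp add: UNIV_2 inner_axis)
    finally show ?thesis by simp
  qed
  finally show "emeasure (distr lborel borel vec2) (box l u) = ennreal (\<Prod>b\<in>Basis. (u - l) \<bullet> b)" .
qed simp

lemma AE_slices:
  assumes "AE x in (lborel :: (real^2) measure). Q x"
  shows "AE y in lborel. AE t in lborel. Q (vec2 (y, t))"
proof -
  have "AE z in lborel. Q (vec2 z)"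
    using assms by (intro AE_distrD[of vec2 lborel borel Q]) (simp_all only: distr_vec2, measurable)
  then have "AE z in lborel \<Otimes>\<^sub>M lborel. Q (vec2 z)" unfolding lborel_prod .
  then show ?thesis by (rule lborel_pair.AE_pair)
qed

lemma AE_imp_ex_small_pos:
  assumes "AE y in lborel. P y" "e > (0::real)"
  shows "\<exists>y. 0 < y \<and> y < e \<and> P y"
proof (rule ccontr)
  assume "\<not> ?thesis"
  then have "AE y in lborel. y \<notin> {0<..<e}" using assms(1) by (auto elim!: eventually_mono)
  then have "emeasure lborel {0<..<e} = 0" by (subst (asm) AE_iff_measurable[of "{0<..<e}"]) auto
  with assms(2) show False by simp
qed

lemma AE_sqrt_shift:
  assumes "AE t in lborel. P t"
  shows "AE s in lborel. s > y\<^sup>2 \<longrightarrow> P (sqrt (s - y\<^sup>2))"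
proof -
  obtain N where N: "N \<in> null_sets lborel" "\<And>t. t \<notin> N \<Longrightarrow> P t"
    using AE_E3[OF assms] by auto
  then have "negligible N" by (simp add: negligible_iff_null_sets null_sets_completionI)
  then have "negligible ((\<lambda>t. t\<^sup>2 + y\<^sup>2) ` N)"
    by (intro negligible_differentiable_image_negligible) (auto intro!: derivative_intros simp: power2_eq_square)
  then have "AE s in lebesgue. s \<notin> (\<lambda>t. t\<^sup>2 + y\<^sup>2) ` N"
    by (simp add: negligible_iff_null_sets AE_not_in)
  then have "AE s in lborel. s \<notin> (\<lambda>t. t\<^sup>2 + y\<^sup>2) ` N" by (simp only: AE_completion_iff)
  then show ?thesis
  proof eventually_elim
    case (elim s)
    show ?case
    proof
      assume "y\<^sup>2 < s"
      then have "s = (sqrt (s - y\<^sup>2))\<^sup>2 + y\<^sup>2" by simp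
      then have "sqrt (s - y\<^sup>2) \<notin> N" using elim by blast
      then show "P (sqrt (s - y\<^sup>2))" by (rule N(2))
    qed
  qed
qed

text \<open>
  A radial function is almost everywhere a Borel function of the squared radius. The function \<open>f\<close> in the
  definition of radial symmetry need not be measurable; but on almost every line \<open>x $ 1 = y\<close>
  it is read off from a Borel version of \<open>u\<close>. Lines at distances \<open>y n\<close> that tend to 0 reach every \<open>s > 0\<close>.
\<close>

lemma radial_profile:
  assumes um: "u \<in> borel_measurable lebesgue" and rad: "radially_symmetric u"
  obtains w :: "real \<Rightarrow> real" where "w \<in> borel_measurable borel" "AE x in lebesgue. u x = w ((norm x)\<^sup>2)"
proof -
  obtain f where f: "AE x in lebesgue. u x = f (norm x)" using rad by (auto simp: radially_symmetric_def)
  obtain u' where u' [measurable]: "u' \<in> borel_measurable lborel" and uu': "AE x in lborel. u x = u' x"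
    using completion_ex_borel_measurable_real[OF um] by blast
  have u'b [measurable]: "u' \<in> borel_measurable borel" using u' by simp
  have "AE x in lborel. u' x = f (norm x)"
    using uu' f[unfolded AE_completion_iff] by eventually_elim auto
  note ae = AE_slices[OF this]
  have "\<exists>y. 0 < y \<and> y < 1 / (real n + 1) \<and> (AE t in lborel. u' (vec2 (y, t)) = f (norm (vec2 (y, t))))" for n
    by (rule AE_imp_ex_small_pos[OF ae]) simp
  then obtain y where y: "\<And>n. 0 < y n" "\<And>n. y n < 1 / (real n + 1)"
    "\<And>n. AE t in lborel. u' (vec2 (y n, t)) = f (norm (vec2 (y n, t)))" by metis
  define g where "g n s = u' (vec2 (y n, sqrt (s - (y n)\<^sup>2)))" for n s
  define k where "k s = nat \<lceil>1 / s\<rceil>" for s :: real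
  define w where "w s = g (k s) s" for s
  have gm [measurable]: "g n \<in> borel_measurable borel" for n unfolding g_def by measurable
  have km: "k \<in> measurable borel (count_space UNIV)" unfolding k_def by measurable
  have wm: "w \<in> borel_measurable borel"
    unfolding w_def by (rule measurable_compose_countable[OF _ km]) measurable
  have "AE s in lborel. (y n)\<^sup>2 < s \<longrightarrow> g n s = f (sqrt s)" for n
    using AE_sqrt_shift[OF y(3)[of n], of "y n"]
  proof eventually_elim
    case (elim s)
    show ?case
    proof
      assume s: "(y n)\<^sup>2 < s"
      have "(norm (vec2 (y n, sqrt (s - (y n)\<^sup>2))))\<^sup>2 = s"
        using s by (simp add: norm_sq_real2)
      then have "norm (vec2 (y n, sqrt (s - (y n)\<^sup>2))) = sqrt s"
        by (metis norm_ge_zero real_sqrt_unique)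
      with elim s show "g n s = f (sqrt s)" by (simp add: g_def)
    qed
  qed
  then have "AE s in lborel. \<forall>n. (y n)\<^sup>2 < s \<longrightarrow> g n s = f (sqrt s)"
    by (simp add: AE_all_countable)
  then have "AE s in lborel. s > 0 \<longrightarrow> w s = f (sqrt s)"
  proof eventually_elim
    case (elim s)
    show ?case
    proof
      assume s: "s > 0"
      have "1 / s \<le> real (k s)" unfolding k_def by linarith
      then have "1 / s < real (k s) + 1" by linarith
      then have "1 / (real (k s) + 1) < s" using s by (simp add: field_simps)
      moreover have "(y (k s))\<^sup>2 \<le> y (k s) * 1" unfolding power2_eq_square
      proof (rule mult_left_mono)
        have "1 / (real (k s) + 1) \<le> 1" by simp
        then show "y (k s) \<le> 1" using y(2)[of "k s"] by linarith
      qed (use y(1)[of "k s"] in simp)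
      ultimately have "(y (k s))\<^sup>2 < s" using y(2)[of "k s"] by linarith
      with elim show "w s = f (sqrt s)" by (simp add: w_def)
    qed
  qed
  from AE_radial[OF this] have "AE x in lebesgue. w ((norm (x::real^2))\<^sup>2) = f (norm x)" by simp
  with f have "AE x in lebesgue. u x = w ((norm x)\<^sup>2)" by eventually_elim auto
  with wm that show ?thesis by blast
qed

section \<open>The radial weak derivative\<close>

lemma smooth_div_ident:
  assumes \<theta>: "smooth \<theta>" and a: "a > 0" and 0: "\<And>s. s < a \<Longrightarrow> \<theta> s = 0"
  shows "smooth (\<lambda>s. \<theta> s * inverse s)"
  unfolding smooth_def
proof
  fix k
  have \<theta>k: "kdiff k S \<theta>" for S
  proof -
    have "kdiff k UNIV \<theta>" using \<theta> by (simp add: smooth_def)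
    then have "kdiff k S \<theta>" for S
    proof (induction k arbitrary: \<theta>)
      case (Suc k) then show ?case by auto
    qed simp
    then show ?thesis .
  qed
  have "kdiff k ({0<..} \<union> {..<a}) (\<lambda>s. \<theta> s * inverse s)"
  proof (rule kdiff_Un)
    show "kdiff k {0<..} (\<lambda>s. \<theta> s * inverse s)"
      by (intro kdiff_mult \<theta>k kdiff_inverse) auto
    show "kdiff k {..<a} (\<lambda>s. \<theta> s * inverse s)"
      by (rule kdiff_cong[OF _ _ kdiff_const[of k _ 0]]) (auto simp: 0)
  qed auto
  moreover have "{0<..} \<union> {..<a} = (UNIV :: real set)" using a by auto
  ultimately show "kdiff k UNIV (\<lambda>s. \<theta> s * inverse s)" by simp
qed

text \<open>
  For \<open>\<theta> = s \<zeta>\<close> the field \<open>x \<zeta>(|x|\<^sup>2)\<close> has divergence \<open>2 \<theta>'(|x|\<^sup>2)\<close> and square integral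
  \<open>\<pi> \<integral> \<theta>\<^sup>2 / s \<le> \<pi> ln (b / a)\<close>. Pairing it with the weak gradient gives the estimate.
\<close>

lemma radial_weak_derivative_estimate:
  fixes u :: "real^2 \<Rightarrow> real" and w :: "real \<Rightarrow> real"
  assumes wg: "has_weak_gradient u G"
    and G2: "sq_integral G \<le> 1"
    and w [measurable]: "w \<in> borel_measurable borel"
    and uw: "AE x in lebesgue. u x = w ((norm x)\<^sup>2)"
    and \<theta>: "smooth \<theta>'" "\<And>s. (\<theta> has_real_derivative \<theta>' s) (at s)"
    and ab: "0 < a" "a < b" "\<And>s. s \<notin> {a..b} \<Longrightarrow> \<theta> s = 0" "\<And>s. \<bar>\<theta> s\<bar> \<le> 1"
  shows "(LINT s|lborel. indicator {0<..} s * (w s * \<theta>' s))\<^sup>2 \<le> ln (b / a) / (4 * pi)"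
proof -
  have s\<theta>: "smooth \<theta>" using smoothI_deriv \<theta> by blast
  define \<zeta> where "\<zeta> s = \<theta> s * inverse s" for s
  have s\<zeta>: "smooth \<zeta>"
    unfolding \<zeta>_def by (rule smooth_div_ident[OF s\<theta> ab(1)]) (simp add: ab(3))
  obtain \<zeta>' where \<zeta>': "smooth \<zeta>'" "\<And>s. (\<zeta> has_real_derivative \<zeta>' s) (at s)"
    using smooth_deriv[OF s\<zeta>] by blast
  have \<theta>\<zeta>: "\<theta> s = s * \<zeta> s" for s using ab(1) ab(3)[of s] by (cases "s = 0") (auto simp: \<zeta>_def)
  have \<theta>'\<zeta>: "\<theta>' s = \<zeta> s + s * \<zeta>' s" for s
  proof -
    have "((\<lambda>s. s * \<zeta> s) has_real_derivative 1 * \<zeta> s + \<zeta>' s * s) (at s)"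
      by (intro DERIV_mult \<zeta>'(2) DERIV_ident)
    moreover have "(\<lambda>s. s * \<zeta> s) = \<theta>" using \<theta>\<zeta> by auto
    ultimately have "(\<theta> has_real_derivative \<zeta> s + s * \<zeta>' s) (at s)" by (simp add: mult.commute)
    with \<theta>(2)[of s] show ?thesis by (rule DERIV_unique)
  qed
  define \<phi> where "\<phi> i = (\<lambda>x::real^2. x $ i * \<zeta> ((norm x)\<^sup>2))" for i
  have \<zeta>0: "\<zeta> s = 0" if "s \<notin> {a..b}" for s using ab(3)[OF that] by (simp add: \<zeta>_def)
  have test: "test_function (\<phi> i)" for i
  proof (rule test_functionI)
    show "csmooth (\<phi> i)" unfolding \<phi>_def
      by (intro csmooth_mult csmooth_coord csmooth_comp[OF s\<zeta>] csmooth_norm_sq)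
    show "norm x \<le> sqrt b" if "\<phi> i x \<noteq> 0" for x
    proof -
      have "(norm x)\<^sup>2 \<in> {a..b}" using that \<zeta>0 by (auto simp: \<phi>_def)
      then show ?thesis by (auto intro: real_le_rsqrt)
    qed
  qed
  have pd: "partial_deriv i (\<phi> i) x = \<zeta> ((norm x)\<^sup>2) + 2 * (x $ i)\<^sup>2 * \<zeta>' ((norm x)\<^sup>2)" for i x
  proof -
    have n: "((\<lambda>x::real^2. (norm x)\<^sup>2) has_derivative (\<lambda>h. 2 * (x \<bullet> h))) (at x)"
      unfolding power2_norm_eq_inner
      by (auto intro!: derivative_eq_intros simp: inner_commute)
    have "((\<lambda>x. \<zeta> ((norm x)\<^sup>2)) has_derivative (\<lambda>h. \<zeta>' ((norm x)\<^sup>2) * (2 * (x \<bullet> h)))) (at x)"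
      using has_derivative_compose[OF n, of \<zeta> "(*) (\<zeta>' ((norm x)\<^sup>2))"] \<zeta>'(2)
      by (auto simp: has_field_derivative_def)
    moreover have "((\<lambda>x. x $ i) has_derivative (\<lambda>h. h $ i)) (at x)"
      by (rule bounded_linear_imp_has_derivative) (rule bounded_linear_vec_nth)
    ultimately have "(\<phi> i has_derivative (\<lambda>h. x $ i * (\<zeta>' ((norm x)\<^sup>2) * (2 * (x \<bullet> h))) + h $ i * \<zeta> ((norm x)\<^sup>2))) (at x)"
      unfolding \<phi>_def by (intro has_derivative_mult)
    from partial_deriv_eq[OF this] show ?thesis
      by (simp add: inner_axis power2_eq_square algebra_simps)
  qed
  have divg: "partial_deriv 1 (\<phi> 1) x + partial_deriv 2 (\<phi> 2) x = 2 * \<theta>' ((norm x)\<^sup>2)" for x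
    unfolding pd \<theta>'\<zeta> norm_sq_real2[of x] by (simp add: algebra_simps)
  have li: "locally_integrable u" "locally_integrable G" using wg by (auto simp: has_weak_gradient_def)
  have liG: "locally_integrable (\<lambda>x. G x $ i)" for i using li(2) by (rule locally_integrable_component)
  have Gm [measurable]: "G \<in> borel_measurable lebesgue" by (rule locally_integrable_measurable[OF li(2)])
  have wk: "(LINT x|lebesgue. u x * partial_deriv i (\<phi> i) x) = - (LINT x|lebesgue. G x $ i * \<phi> i x)" for i
    using wg test by (simp add: has_weak_gradient_def)
  note iu = test_function_integrable(2)[OF test li(1)]
  note iG = test_function_integrable(1)[OF test liG]
  have \<theta>'m [measurable]: "\<theta>' \<in> borel_measurable borel"
    by (intro borel_measurable_continuous_onI smooth_continuous \<theta>(1))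
  have "(LINT x|lebesgue. u x * (2 * \<theta>' ((norm x)\<^sup>2)))
      = (LINT x|lebesgue. u x * partial_deriv 1 (\<phi> 1) x) + (LINT x|lebesgue. u x * partial_deriv 2 (\<phi> 2) x)"
    unfolding divg[symmetric] distrib_left by (rule Bochner_Integration.integral_add[OF iu iu])
  also have "\<dots> = - ((LINT x|lebesgue. G x $ 1 * \<phi> 1 x) + (LINT x|lebesgue. G x $ 2 * \<phi> 2 x))"
    by (simp add: wk)
  also have "\<dots> = - (LINT x|lebesgue. G x $ 1 * \<phi> 1 x + G x $ 2 * \<phi> 2 x)"
    by (subst Bochner_Integration.integral_add[OF iG iG]) simp
  finally have eq: "(LINT x|lebesgue. u x * (2 * \<theta>' ((norm x)\<^sup>2))) = - (LINT x|lebesgue. G x $ 1 * \<phi> 1 x + G x $ 2 * \<phi> 2 x)" .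
  have "(LINT x|lebesgue. u x * (2 * \<theta>' ((norm x)\<^sup>2))) = (LINT x|lebesgue. 2 * (w ((norm (x::real^2))\<^sup>2) * \<theta>' ((norm x)\<^sup>2)))"
  proof (rule integral_cong_AE)
    show "(\<lambda>x. u x * (2 * \<theta>' ((norm x)\<^sup>2))) \<in> borel_measurable lebesgue"
    proof (rule borel_measurable_times[OF locally_integrable_measurable[OF li(1)]])
      show "(\<lambda>x::real^2. 2 * \<theta>' ((norm x)\<^sup>2)) \<in> borel_measurable lebesgue"
        by (intro measurable_completion) measurable
    qed
    show "(\<lambda>x::real^2. 2 * (w ((norm x)\<^sup>2) * \<theta>' ((norm x)\<^sup>2))) \<in> borel_measurable lebesgue"
      by (intro measurable_completion) measurable
    show "AE x in lebesgue. u x * (2 * \<theta>' ((norm x)\<^sup>2)) = 2 * (w ((norm x)\<^sup>2) * \<theta>' ((norm x)\<^sup>2))"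
      using uw by eventually_elim simp
  qed
  also have "\<dots> = 2 * (LINT x|lebesgue. w ((norm (x::real^2))\<^sup>2) * \<theta>' ((norm x)\<^sup>2))" by simp
  also have "(LINT x|lebesgue. w ((norm (x::real^2))\<^sup>2) * \<theta>' ((norm x)\<^sup>2))
      = pi * (LINT s|lborel. indicator {0<..} s * (w s * \<theta>' s))"
    by (rule integral_radial(2)[of "\<lambda>s. w s * \<theta>' s"]) measurable
  finally have L: "(LINT x|lebesgue. u x * (2 * \<theta>' ((norm x)\<^sup>2))) = 2 * pi * (LINT s|lborel. indicator {0<..} s * (w s * \<theta>' s))"
    by simp
  define g where "g = (\<lambda>x::real^2. norm x * \<bar>\<zeta> ((norm x)\<^sup>2)\<bar>)"
  have \<zeta>m [measurable]: "\<zeta> \<in> borel_measurable borel"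
    by (intro borel_measurable_continuous_onI smooth_continuous s\<zeta>)
  have \<theta>m [measurable]: "\<theta> \<in> borel_measurable borel"
    by (intro borel_measurable_continuous_onI smooth_continuous s\<theta>)
  have gm: "g \<in> borel_measurable lebesgue" unfolding g_def by (intro measurable_completion) measurable
  have inv: "(inverse has_integral (ln b - ln a)) {a..b}"
    using ab by (intro fundamental_theorem_of_calculus)
      (auto simp flip: has_real_derivative_iff_has_vector_derivative intro!: derivative_eq_intros simp: inverse_eq_divide)
  have inv': "set_integrable lborel {a..b} inverse" "(LINT s:{a..b}|lborel. inverse s) = ln b - ln a"
  proof -
    have c: "continuous_on {a..b} inverse" using ab by (intro continuous_intros) auto
    show i: "set_integrable lborel {a..b} inverse" by (rule borel_integrable_atLeastAtMost'[OF c])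
    show "(LINT s:{a..b}|lborel. inverse s) = ln b - ln a"
      using set_borel_integral_eq_integral(2)[OF i] inv by (simp add: integral_unique)
  qed
  have g2eq: "(g x)\<^sup>2 = (\<theta> ((norm x)\<^sup>2))\<^sup>2 * inverse ((norm x)\<^sup>2)" for x
    by (cases "x = 0") (auto simp: g_def \<theta>\<zeta> power_mult_distrib field_simps power2_eq_square)
  have ile: "indicator {0<..} s * ((\<theta> s)\<^sup>2 * inverse s) \<le> indicator {a..b} s * inverse s" for s
  proof (cases "s \<in> {a..b}")
    case True
    then have "s > 0" using ab by auto
    moreover have "(\<theta> s)\<^sup>2 \<le> 1" using ab(4)[of s] by (simp add: abs_square_le_1)
    ultimately show ?thesis using True mult_right_mono[of "(\<theta> s)\<^sup>2" 1 "inverse s"] by simp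
  qed (simp add: ab(3))
  have ii: "integrable lborel (\<lambda>s. indicator {0<..} s * ((\<theta> s)\<^sup>2 * inverse s))"
  proof (rule Bochner_Integration.integrable_bound)
    show "integrable lborel (\<lambda>s. indicator {a..b} s * inverse s)"
      using inv'(1) by (simp add: set_integrable_def)
    show "AE s in lborel. norm (indicator {0<..} s * ((\<theta> s)\<^sup>2 * inverse s)) \<le> norm (indicator {a..b} s * inverse s)"
    proof (rule AE_I2)
      fix s
      have "0 \<le> indicator {0<..} s * ((\<theta> s)\<^sup>2 * inverse s)" by (auto simp: indicator_def)
      then show "norm (indicator {0<..} s * ((\<theta> s)\<^sup>2 * inverse s)) \<le> norm (indicator {a..b} s * inverse s)"
        using ile[of s] by simp
    qed
  qed measurable
  have g2: "integrable lebesgue (\<lambda>x. (g x)\<^sup>2)"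
    unfolding g2eq by (subst integral_radial(1)[of "\<lambda>s. (\<theta> s)\<^sup>2 * inverse s"]) (use ii in auto)
  have g2int: "(LINT x|lebesgue. (g x)\<^sup>2) \<le> pi * ln (b / a)"
  proof -
    have "(LINT x|lebesgue. (g x)\<^sup>2) = pi * (LINT s|lborel. indicator {0<..} s * ((\<theta> s)\<^sup>2 * inverse s))"
      unfolding g2eq by (rule integral_radial(2)[of "\<lambda>s. (\<theta> s)\<^sup>2 * inverse s"]) measurable
    also have "(LINT s|lborel. indicator {0<..} s * ((\<theta> s)\<^sup>2 * inverse s)) \<le> (LINT s|lborel. indicator {a..b} s * inverse s)"
      using ile inv'(1) by (intro integral_mono ii) (auto simp: set_integrable_def)
    also have "\<dots> = ln (b / a)" using inv'(2) ab by (simp add: set_lebesgue_integral_def ln_div)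
    finally show ?thesis by simp
  qed
  have G2i: "integrable lebesgue (\<lambda>x. (norm (G x))\<^sup>2)"
    using G2 by (auto simp: integrable_sq_nn intro: order_le_less_trans)
  have G2int: "(LINT x|lebesgue. (norm (G x))\<^sup>2) \<le> 1"
    using G2 by (subst (asm) nn_integral_eq_integral[OF G2i]) auto
  have nGm: "(\<lambda>x. norm (G x)) \<in> borel_measurable lebesgue" by measurable
  note CS = Cauchy_Schwarz_integral[OF nGm gm G2i g2]
  have "\<bar>LINT x|lebesgue. G x $ 1 * \<phi> 1 x + G x $ 2 * \<phi> 2 x\<bar> \<le> (LINT x|lebesgue. \<bar>G x $ 1 * \<phi> 1 x + G x $ 2 * \<phi> 2 x\<bar>)"
    by (rule integral_abs_bound)
  also have "\<dots> \<le> (LINT x|lebesgue. norm (G x) * g x)"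
  proof (rule integral_mono)
    show "integrable lebesgue (\<lambda>x. \<bar>G x $ 1 * \<phi> 1 x + G x $ 2 * \<phi> 2 x\<bar>)"
      by (intro integrable_abs Bochner_Integration.integrable_add iG)
    show "integrable lebesgue (\<lambda>x. norm (G x) * g x)" by (rule CS(1))
    fix x
    have "G x $ 1 * \<phi> 1 x + G x $ 2 * \<phi> 2 x = (G x \<bullet> x) * \<zeta> ((norm x)\<^sup>2)"
      unfolding inner_vec_def sum_2 by (simp add: \<phi>_def algebra_simps)
    then have "\<bar>G x $ 1 * \<phi> 1 x + G x $ 2 * \<phi> 2 x\<bar> = \<bar>G x \<bullet> x\<bar> * \<bar>\<zeta> ((norm x)\<^sup>2)\<bar>" by (simp add: abs_mult)
    also have "\<dots> \<le> (norm (G x) * norm x) * \<bar>\<zeta> ((norm x)\<^sup>2)\<bar>"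
      by (intro mult_right_mono Cauchy_Schwarz_ineq2) auto
    finally show "\<bar>G x $ 1 * \<phi> 1 x + G x $ 2 * \<phi> 2 x\<bar> \<le> norm (G x) * g x"
      by (simp add: g_def mult.assoc)
  qed
  finally have "(LINT x|lebesgue. G x $ 1 * \<phi> 1 x + G x $ 2 * \<phi> 2 x)\<^sup>2 \<le> (LINT x|lebesgue. norm (G x) * g x)\<^sup>2"
    using power_mono[of "\<bar>LINT x|lebesgue. G x $ 1 * \<phi> 1 x + G x $ 2 * \<phi> 2 x\<bar>" _ 2] by simp
  also have "\<dots> \<le> (LINT x|lebesgue. (norm (G x))\<^sup>2) * (LINT x|lebesgue. (g x)\<^sup>2)" by (rule CS(2))
  also have "\<dots> \<le> 1 * (pi * ln (b / a))"
    using G2int g2int by (intro mult_mono) auto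
  finally have "(2 * pi * (LINT s|lborel. indicator {0<..} s * (w s * \<theta>' s)))\<^sup>2 \<le> pi * ln (b / a)"
    using eq L by simp
  then have "4 * pi * (pi * (LINT s|lborel. indicator {0<..} s * (w s * \<theta>' s))\<^sup>2) \<le> pi * ln (b / a)"
    by (simp add: power_mult_distrib power2_eq_square mult_ac)
  then have "pi * (4 * pi * (LINT s|lborel. indicator {0<..} s * (w s * \<theta>' s))\<^sup>2) \<le> pi * ln (b / a)"
    by (simp only: mult_ac)
  then have "4 * pi * (LINT s|lborel. indicator {0<..} s * (w s * \<theta>' s))\<^sup>2 \<le> ln (b / a)"
    using pi_gt_zero by (simp only: mult_le_cancel_left_pos)
  then show ?thesis by (simp add: pos_le_divide_eq mult.commute)
qed

section \<open>The logarithmic profile of a radial function\<close>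

lemma bump_shift: "bump m (a + c) (b + c) (s + c) = bump m a b s"
  by (simp add: bump_def)

text \<open>
  A smooth function with values in \<open>[-1, 1]\<close> whose derivative is a difference of two translated bumps;
  it is the difference of two translates of an antiderivative of the bump.
\<close>

lemma smooth_trapezoid:
  fixes s1 s2 h :: real
  assumes "0 < h" "s1 \<le> s2"
  obtains \<theta> where "\<And>s. (\<theta> has_real_derivative (bump m s1 (s1 + h) s - bump m s2 (s2 + h) s) / h) (at s)"
    "\<And>s. s \<notin> {s1..s2 + h} \<Longrightarrow> \<theta> s = 0" "\<And>s. \<bar>\<theta> s\<bar> \<le> 1"
proof -
  define \<rho> where "\<rho> = bump m s1 (s1 + h)"
  have c: "continuous_on UNIV \<rho>" unfolding \<rho>_def by (rule smooth_continuous[OF smooth_bump])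
  have "\<exists>F. \<forall>x::real. -\<infinity> < ereal x \<longrightarrow> ereal x < \<infinity> \<longrightarrow> (F has_vector_derivative \<rho> x) (at x)"
    using c by (intro einterval_antiderivative) (auto simp: continuous_on_eq_continuous_at)
  then obtain F where F: "\<And>x. (F has_real_derivative \<rho> x) (at x)"
    by (auto simp: has_real_derivative_iff_has_vector_derivative)
  have mono: "F x \<le> F y" if "x \<le> y" for x y
    using that F bump_bounds unfolding \<rho>_def by (intro DERIV_nonneg_imp_nondecreasing[of x y F]) blast+
  have const: "F x = F y" if "x \<le> y" "\<And>z. x \<le> z \<Longrightarrow> z \<le> y \<Longrightarrow> \<rho> z = 0" for x y
  proof (rule antisym[OF mono[OF that(1)]])
    have "(F has_real_derivative 0) (at z)" if "x \<le> z" "z \<le> y" for z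
      using F[of z] \<open>\<And>z. x \<le> z \<Longrightarrow> z \<le> y \<Longrightarrow> \<rho> z = 0\<close> that by simp
    then show "F y \<le> F x"
      by (intro DERIV_nonpos_imp_nonincreasing[OF that(1)]) auto
  qed
  have lo: "F s = F s1" if "s \<le> s1" for s
    using that by (intro const) (auto simp: \<rho>_def intro!: bump_eq_0)
  have hi: "F s = F (s1 + h)" if "s \<ge> s1 + h" for s
    using that by (intro const[symmetric]) (auto simp: \<rho>_def intro!: bump_eq_0)
  have len: "F (s1 + h) - F s1 \<le> h"
  proof -
    have "F (s1 + h) - (s1 + h) \<le> F s1 - s1"
    proof (rule DERIV_nonpos_imp_nonincreasing[of s1 "s1 + h" "\<lambda>x. F x - x"])
      fix x
      have "((\<lambda>x. F x - x) has_real_derivative \<rho> x - 1) (at x)" by (intro DERIV_diff F DERIV_ident)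
      moreover have "\<rho> x - 1 \<le> 0" using bump_bounds(2) by (simp add: \<rho>_def)
      ultimately show "\<exists>y. ((\<lambda>x. F x - x) has_real_derivative y) (at x) \<and> y \<le> 0" by blast
    qed (use assms in simp)
    then show ?thesis by simp
  qed
  have bd: "F s1 \<le> F s" "F s \<le> F (s1 + h)" for s
  proof -
    show "F s1 \<le> F s" using mono[of s1 s] lo[of s] by (cases "s1 \<le> s") auto
    show "F s \<le> F (s1 + h)" using mono[of s "s1 + h"] hi[of s] by (cases "s \<le> s1 + h") auto
  qed
  define \<theta> where "\<theta> s = (F s - F (s + (s1 - s2))) / h" for s
  show ?thesis
  proof
    fix s
    have "((\<lambda>s. F (s + (s1 - s2))) has_real_derivative \<rho> (s + (s1 - s2))) (at s)"
      by (rule DERIV_shift[THEN iffD1, OF F])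
    moreover have "\<rho> (s + (s1 - s2)) = bump m s2 (s2 + h) s"
      using bump_shift[of m s1 "s2 - s1" "s1 + h" "s + (s1 - s2)"] by (simp add: \<rho>_def algebra_simps)
    ultimately show "(\<theta> has_real_derivative (bump m s1 (s1 + h) s - bump m s2 (s2 + h) s) / h) (at s)"
      unfolding \<theta>_def using F[of s] by (intro DERIV_cdivide DERIV_diff) (auto simp: \<rho>_def)
  next
    fix s assume "s \<notin> {s1..s2 + h}"
    then consider "s < s1" | "s > s2 + h" by fastforce
    then show "\<theta> s = 0"
    proof cases
      case 1
      then show ?thesis using lo[of s] lo[of "s + (s1 - s2)"] assms by (simp add: \<theta>_def)
    next
      case 2
      then show ?thesis using hi[of s] hi[of "s + (s1 - s2)"] assms by (simp add: \<theta>_def)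
    qed
  next
    fix s
    have "\<bar>F s - F (s + (s1 - s2))\<bar> \<le> h"
      using bd[of s] bd[of "s + (s1 - s2)"] len by linarith
    then show "\<bar>\<theta> s\<bar> \<le> 1" using assms(1) by (simp add: \<theta>_def)
  qed
qed

lemma ln_ratio_limit:
  fixes s1 s2 :: real
  assumes "0 < s1" "0 < s2"
  shows "(\<lambda>n. ln ((s2 + 1 / (real n + 1)) / s1) / (4 * pi)) \<longlonglongrightarrow> ln (s2 / s1) / (4 * pi)"
proof -
  have "(\<lambda>n. ln ((s2 + 1 / (real n + 1)) / s1) / (4 * pi)) \<longlonglongrightarrow> ln ((s2 + 0) / s1) / (4 * pi)"
    using assms by (intro tendsto_intros LIMSEQ_const_over_Suc) auto
  then show ?thesis by simp
qed

lemma sq_le_imp_dist_le_sqrt: "(x - y)\<^sup>2 \<le> c \<Longrightarrow> \<bar>x - y\<bar> \<le> sqrt (c::real)"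
  using real_sqrt_le_mono[of "(x - y)\<^sup>2" c] by simp

text \<open>
  The profile is a function of \<open>ln |x|\<^sup>2\<close>. Its value at \<open>ln 0 = 0\<close> does not matter, since the origin
  is a null set.
\<close>

abbreviation has_profile :: "(real^2 \<Rightarrow> real) \<Rightarrow> (real \<Rightarrow> real) \<Rightarrow> bool" where
  "has_profile u F \<equiv> AE x in lebesgue. u x = F (ln ((norm x)\<^sup>2))"

text \<open>
  Averages of the Borel profile \<open>W\<close> over short intervals inherit the logarithmic Hoelder bound from the
  estimate with trapezoids. By Lebesgue's differentiation theorem they converge to \<open>W\<close> off a null set, and
  a uniformly continuous function on a dense set extends to the line.
\<close>

lemma radial_representative:
  fixes u :: "real^2 \<Rightarrow> real"
  assumes wg: "has_weak_gradient u G"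
    and G2: "sq_integral G \<le> 1"
    and rad: "radially_symmetric u"
  obtains F :: "real \<Rightarrow> real" where "\<And>\<sigma> \<tau>. (F \<sigma> - F \<tau>)\<^sup>2 \<le> \<bar>\<sigma> - \<tau>\<bar> / (4 * pi)"
    "has_profile u F"
proof -
  have li: "locally_integrable u" using wg by (simp add: has_weak_gradient_def)
  obtain w where w [measurable]: "w \<in> borel_measurable borel" and uw: "AE x in lebesgue. u x = w ((norm x)\<^sup>2)"
    using radial_profile[OF locally_integrable_measurable[OF li] rad] .
  define W where "W s = indicator {0<..} s * w s" for s :: real
  have Wm [measurable]: "W \<in> borel_measurable borel" unfolding W_def by measurable
  have Wb: "integrable lborel (\<lambda>s. indicator {..b} s * W s)" for b
  proof -
    define B where "B = cball (0::real^2) (sqrt (max 0 b))"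
    have "set_integrable lebesgue B u" using li by (auto simp: locally_integrable_def B_def)
    then have i: "integrable lebesgue (\<lambda>x. indicator B x * u x)" by (simp add: set_integrable_def)
    have "integrable lebesgue (\<lambda>x::real^2. indicator {..b} ((norm x)\<^sup>2) * w ((norm x)\<^sup>2))"
    proof (rule Bochner_Integration.integrable_bound[OF i])
      show "(\<lambda>x::real^2. indicator {..b} ((norm x)\<^sup>2) * w ((norm x)\<^sup>2)) \<in> borel_measurable lebesgue"
        by (intro measurable_completion) measurable
      show "AE x in lebesgue. norm (indicator {..b} ((norm x)\<^sup>2) * w ((norm x)\<^sup>2)) \<le> norm (indicator B x * u x)"
        using uw
      proof eventually_elim
        case (elim x)
        have "x \<in> B" if "(norm x)\<^sup>2 \<le> b"
          using that by (auto simp: B_def intro!: real_le_rsqrt)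
        then show ?case using elim by (auto simp: indicator_def)
      qed
    qed
    then have "integrable lborel (\<lambda>s. indicator {0<..} s * (indicator {..b} s * w s))"
      by (subst (asm) integral_radial(1)[of "\<lambda>s. indicator {..b} s * w s"]) auto
    then show ?thesis by (simp add: W_def mult_ac)
  qed
  have Wint: "integrable lborel (\<lambda>s. indicator {a..b} s * W s)" for a b
  proof (rule Bochner_Integration.integrable_bound[OF Wb[of b]])
    show "AE s in lborel. norm (indicator {a..b} s * W s) \<le> norm (indicator {..b} s * W s)"
      by (auto simp: indicator_def)
  qed measurable
  define I where "I a b = (LINT s|lborel. W s * indicator {a<..<b} s)" for a b
  have step: "(I s1 (s1 + h) / h - I s2 (s2 + h) / h)\<^sup>2 \<le> ln ((s2 + h) / s1) / (4 * pi)"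
    if h: "0 < h" and s: "0 < s1" "s1 \<le> s2" for s1 s2 h
  proof -
    define \<beta> where "\<beta> m s = (bump m s1 (s1 + h) s - bump m s2 (s2 + h) s) / h" for m s
    have \<beta>m [measurable]: "\<beta> m \<in> borel_measurable borel" for m unfolding \<beta>_def by measurable
    have est: "(LINT s|lborel. indicator {0<..} s * (w s * \<beta> m s))\<^sup>2 \<le> ln ((s2 + h) / s1) / (4 * pi)" for m
    proof -
      obtain \<theta> where \<theta>: "\<And>s. (\<theta> has_real_derivative \<beta> m s) (at s)"
        "\<And>s. s \<notin> {s1..s2 + h} \<Longrightarrow> \<theta> s = 0" "\<And>s. \<bar>\<theta> s\<bar> \<le> 1"
        unfolding \<beta>_def using smooth_trapezoid[OF h s(2), of m] by blast
      have "smooth (\<lambda>s. inverse h * (bump m s1 (s1 + h) s - bump m s2 (s2 + h) s))"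
        by (intro smooth_mult smooth_const smooth_diff smooth_bump)
      then have sm: "smooth (\<beta> m)" by (simp add: \<beta>_def[abs_def] divide_inverse mult.commute)
      show ?thesis
        using s h by (intro radial_weak_derivative_estimate[OF wg G2 w uw sm \<theta>(1) s(1) _ \<theta>(2,3)]) auto
    qed
    define \<beta>0 where "\<beta>0 s = (indicator {s1<..<s1 + h} s - indicator {s2<..<s2 + h} s) / h" for s :: real
    have "(\<lambda>m. LINT s|lborel. W s * \<beta> m s) \<longlonglongrightarrow> (LINT s|lborel. W s * \<beta>0 s)"
    proof (rule integral_dominated_convergence)
      show "integrable lborel (\<lambda>s. (1 / h) * \<bar>indicator {s1..s2 + h} s * W s\<bar>)"
        by (intro integrable_mult_right integrable_abs Wint)
      show "AE s in lborel. (\<lambda>m. W s * \<beta> m s) \<longlonglongrightarrow> W s * \<beta>0 s"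
        unfolding \<beta>_def \<beta>0_def using h by (intro AE_I2 tendsto_intros bump_tendsto) auto
      show "AE s in lborel. norm (W s * \<beta> m s) \<le> (1 / h) * \<bar>indicator {s1..s2 + h} s * W s\<bar>" for m
      proof (rule AE_I2)
        fix t
        show "norm (W t * \<beta> m t) \<le> (1 / h) * \<bar>indicator {s1..s2 + h} t * W t\<bar>"
        proof (cases "t \<in> {s1..s2 + h}")
          case True
          have "\<bar>bump m s1 (s1 + h) t - bump m s2 (s2 + h) t\<bar> \<le> 1"
            using bump_bounds[of m s1 "s1 + h" t] bump_bounds[of m s2 "s2 + h" t] by linarith
          then have "\<bar>\<beta> m t\<bar> \<le> 1 / h" using h by (simp add: \<beta>_def divide_right_mono)
          from mult_left_mono[OF this, of "\<bar>W t\<bar>"] True show ?thesis by (simp add: abs_mult mult.commute)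
        next
          case False
          then have "bump m s1 (s1 + h) t = 0" "bump m s2 (s2 + h) t = 0"
            using s h by (auto intro!: bump_eq_0)
          then have "\<beta> m t = 0" by (simp add: \<beta>_def)
          then show ?thesis using h by simp
        qed
      qed
    qed (auto simp: \<beta>0_def[abs_def])
    moreover have "(LINT s|lborel. W s * \<beta>0 s) = I s1 (s1 + h) / h - I s2 (s2 + h) / h"
    proof -
      have i: "integrable lborel (\<lambda>t. W t * indicator {a<..<b} t)" for a b
      proof (rule Bochner_Integration.integrable_bound[OF Wint[of a b]])
        show "AE t in lborel. norm (W t * indicator {a<..<b} t) \<le> norm (indicator {a..b} t * W t)"
          by (auto simp: indicator_def)
      qed measurable
      have "(LINT s|lborel. W s * \<beta>0 s)
        = (LINT t|lborel. (W t * indicator {s1<..<s1 + h} t - W t * indicator {s2<..<s2 + h} t) / h)"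
        by (intro Bochner_Integration.integral_cong) (auto simp: \<beta>0_def algebra_simps diff_divide_distrib)
      also have "\<dots> = (I s1 (s1 + h) - I s2 (s2 + h)) / h"
        unfolding I_def using i by simp
      finally show ?thesis by (simp add: diff_divide_distrib)
    qed
    ultimately have "(\<lambda>m. (LINT s|lborel. W s * \<beta> m s)\<^sup>2) \<longlonglongrightarrow> (I s1 (s1 + h) / h - I s2 (s2 + h) / h)\<^sup>2"
      by (intro tendsto_power) simp
    moreover have "(LINT s|lborel. W s * \<beta> m s)\<^sup>2 \<le> ln ((s2 + h) / s1) / (4 * pi)" for m
      using est[of m] by (simp add: W_def mult.assoc)
    ultimately show ?thesis by (intro LIMSEQ_le_const2) auto
  qed
  have Won: "W integrable_on cbox a b" and WI: "integral (cbox a b) W = I a b" for a b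
  proof -
    have s: "set_integrable lborel {a..b} W" using Wint by (simp add: set_integrable_def)
    show "W integrable_on cbox a b" using set_borel_integral_eq_integral(1)[OF s] by simp
    have "I a b = (LINT s:{a..b}|lborel. W s)"
      unfolding I_def set_lebesgue_integral_def
    proof (rule integral_cong_AE)
      have "AE s in lborel. s \<noteq> a \<and> s \<noteq> b"
        using AE_lborel_singleton[of a] AE_lborel_singleton[of b] by eventually_elim auto
      then show "AE s in lborel. W s * indicator {a<..<b} s = indicator {a..b} s *\<^sub>R W s"
        by eventually_elim (auto simp: indicator_def)
    qed measurable
    then show "integral (cbox a b) W = I a b" using set_borel_integral_eq_integral(2)[OF s] by simp
  qed
  obtain N where N: "negligible N" "\<And>x e. \<lbrakk>x \<notin> N; 0 < e\<rbrakk> \<Longrightarrow>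
      \<exists>d>0. \<forall>h. 0 < h \<and> h < d \<longrightarrow>
        norm (integral (cbox x (x + h *\<^sub>R One)) W /\<^sub>R h ^ DIM(real) - W x) < e"
    by (rule integrable_ccontinuous_explicit[OF Won]) (rule that)
  have avg: "(\<lambda>n. I s (s + 1 / (real n + 1)) / (1 / (real n + 1))) \<longlonglongrightarrow> W s" if s: "s \<notin> N" for s
  proof (rule LIMSEQ_I)
    fix r :: real assume "0 < r"
    from N(2)[OF s this] obtain d where d: "d > 0"
      "\<And>h. 0 < h \<and> h < d \<Longrightarrow> norm (integral (cbox s (s + h *\<^sub>R One)) W /\<^sub>R h ^ DIM(real) - W s) < r" by blast
    have "eventually (\<lambda>n. 1 / (real n + 1) < d) sequentially"
      by (rule order_tendstoD(2)[OF LIMSEQ_const_over_Suc d(1)])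
    then obtain M where M: "\<And>n. n \<ge> M \<Longrightarrow> 1 / (real n + 1) < d" by (auto simp: eventually_sequentially)
    have "norm (I s (s + 1 / (real n + 1)) / (1 / (real n + 1)) - W s) < r" if "n \<ge> M" for n
      using d(2)[of "1 / (real n + 1)"] M[OF that] unfolding WI by (simp add: divide_inverse mult.commute)
    then show "\<exists>M. \<forall>n\<ge>M. norm (I s (s + 1 / (real n + 1)) / (1 / (real n + 1)) - W s) < r" by blast
  qed
  have hold: "(W s1 - W s2)\<^sup>2 \<le> ln (s2 / s1) / (4 * pi)" if "s1 \<notin> N" "s2 \<notin> N" "0 < s1" "s1 \<le> s2" for s1 s2
  proof (rule LIMSEQ_le)
    show "(\<lambda>n. (I s1 (s1 + 1 / (real n + 1)) / (1 / (real n + 1)) - I s2 (s2 + 1 / (real n + 1)) / (1 / (real n + 1)))\<^sup>2)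
        \<longlonglongrightarrow> (W s1 - W s2)\<^sup>2"
      by (intro tendsto_power tendsto_diff avg that)
    show "(\<lambda>n. ln ((s2 + 1 / (real n + 1)) / s1) / (4 * pi)) \<longlonglongrightarrow> ln (s2 / s1) / (4 * pi)"
      using that by (intro ln_ratio_limit) auto
    show "\<exists>M. \<forall>n\<ge>M. (I s1 (s1 + 1 / (real n + 1)) / (1 / (real n + 1)) - I s2 (s2 + 1 / (real n + 1)) / (1 / (real n + 1)))\<^sup>2
        \<le> ln ((s2 + 1 / (real n + 1)) / s1) / (4 * pi)"
      using that by (intro exI allI impI step) auto
  qed
  define X where "X = {\<tau>. exp \<tau> \<notin> N}"
  have hX: "(W (exp \<sigma>) - W (exp \<tau>))\<^sup>2 \<le> \<bar>\<sigma> - \<tau>\<bar> / (4 * pi)" if "\<sigma> \<in> X" "\<tau> \<in> X" for \<sigma> \<tau>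
  proof (cases "\<sigma> \<le> \<tau>")
    case True
    then show ?thesis using hold[of "exp \<sigma>" "exp \<tau>"] that by (simp add: X_def ln_div abs_if)
  next
    case False
    then show ?thesis using hold[of "exp \<tau>" "exp \<sigma>"] that by (simp add: X_def ln_div abs_if power2_commute)
  qed
  have dense: "\<exists>\<tau>'\<in>X. \<tau> < \<tau>' \<and> \<tau>' < \<tau> + e" if "e > 0" for \<tau> e
  proof -
    have "\<not> {exp \<tau><..<exp (\<tau> + e)} \<subseteq> N"
      using N(1) negligible_subset[of N] open_not_negligible[of "{exp \<tau><..<exp (\<tau> + e)}"] that by auto
    then obtain s where s: "exp \<tau> < s" "s < exp (\<tau> + e)" "s \<notin> N"
      unfolding subset_iff greaterThanLessThan_iff by blast
    then have "s > 0" using exp_gt_zero[of \<tau>] by linarith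
    have "ln (exp \<tau>) < ln s" using s(1) \<open>s > 0\<close> by (subst ln_less_cancel_iff) auto
    moreover have "ln s < ln (exp (\<tau> + e))" using s(2) \<open>s > 0\<close> by (subst ln_less_cancel_iff) auto
    moreover have "ln s \<in> X" using s(3) \<open>s > 0\<close> by (simp add: X_def)
    ultimately show ?thesis by auto
  qed
  have uc: "uniformly_continuous_on X (\<lambda>\<tau>. W (exp \<tau>))"
    unfolding uniformly_continuous_on_def
  proof (intro allI impI)
    fix e :: real assume e: "e > 0"
    show "\<exists>d>0. \<forall>x\<in>X. \<forall>x'\<in>X. dist x' x < d \<longrightarrow> dist (W (exp x')) (W (exp x)) < e"
    proof (intro exI[of _ "4 * pi * e\<^sup>2"] conjI ballI impI)
      fix x x' assume x: "x \<in> X" "x' \<in> X" "dist x' x < 4 * pi * e\<^sup>2"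
      have "(W (exp x') - W (exp x))\<^sup>2 \<le> \<bar>x' - x\<bar> / (4 * pi)" by (rule hX[OF x(2,1)])
      also have "\<dots> < e\<^sup>2" using x(3) by (simp add: dist_real_def pos_divide_less_eq mult.commute)
      finally have "\<bar>W (exp x') - W (exp x)\<bar>\<^sup>2 < e\<^sup>2" by simp
      then have "\<bar>W (exp x') - W (exp x)\<bar> < e" by (rule power2_less_imp_less) (use e in simp)
      then show "dist (W (exp x')) (W (exp x)) < e" by (simp add: dist_real_def)
    qed (use e in simp)
  qed
  obtain F where F: "uniformly_continuous_on (closure X) F" "\<And>x. x \<in> X \<Longrightarrow> W (exp x) = F x"
  proof (rule uniformly_continuous_on_extension_on_closure[OF uc])
    fix g assume g: "uniformly_continuous_on (closure X) g" "\<And>x. x \<in> X \<Longrightarrow> W (exp x) = g x"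
    show thesis by (rule that[of g, OF g])
  qed
  have "\<exists>f. (\<forall>n::nat. f n \<in> X) \<and> f \<longlonglongrightarrow> \<tau>" for \<tau>
  proof -
    have "\<forall>n::nat. \<exists>t. t \<in> X \<and> \<tau> < t \<and> t < \<tau> + 1 / (real n + 1)"
    proof
      fix n :: nat
      have "0 < 1 / (real n + 1)" by simp
      from dense[OF this] show "\<exists>t. t \<in> X \<and> \<tau> < t \<and> t < \<tau> + 1 / (real n + 1)" by blast
    qed
    then obtain f where f: "\<And>n::nat. f n \<in> X" "\<And>n. \<tau> < f n" "\<And>n. f n < \<tau> + 1 / (real n + 1)" by metis
    have "f \<longlonglongrightarrow> \<tau>"
    proof (rule tendsto_sandwich[of "\<lambda>n. \<tau>" f sequentially "\<lambda>n. \<tau> + 1 / (real n + 1)"])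
      show "(\<lambda>n. \<tau> + 1 / (real n + 1)) \<longlonglongrightarrow> \<tau>"
        using tendsto_add[OF tendsto_const[of \<tau>] LIMSEQ_const_over_Suc[of 1]] by simp
    qed (use f in \<open>auto intro!: always_eventually less_imp_le\<close>)
    with f(1) show ?thesis by blast
  qed
  then obtain sq where sq: "\<And>\<tau> n. sq \<tau> n \<in> X" "\<And>\<tau>. sq \<tau> \<longlonglongrightarrow> \<tau>" by metis
  have "\<tau> \<in> closure X" for \<tau>
    unfolding closure_sequential using sq[of \<tau>] by blast
  then have cl: "closure X = UNIV" by blast
  have cF: "isCont F \<tau>" for \<tau>
    using uniformly_continuous_imp_continuous[OF F(1)] unfolding cl
    by (simp add: continuous_on_eq_continuous_at)
  have FH: "(F \<sigma> - F \<tau>)\<^sup>2 \<le> \<bar>\<sigma> - \<tau>\<bar> / (4 * pi)" for \<sigma> \<tau>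
  proof (rule LIMSEQ_le)
    show "(\<lambda>n. (F (sq \<sigma> n) - F (sq \<tau> n))\<^sup>2) \<longlonglongrightarrow> (F \<sigma> - F \<tau>)\<^sup>2"
      by (intro tendsto_power tendsto_diff isCont_tendsto_compose[OF cF] sq(2))
    show "(\<lambda>n. \<bar>sq \<sigma> n - sq \<tau> n\<bar> / (4 * pi)) \<longlonglongrightarrow> \<bar>\<sigma> - \<tau>\<bar> / (4 * pi)"
      by (intro tendsto_intros sq(2)) simp
    show "\<exists>M. \<forall>n\<ge>M. (F (sq \<sigma> n) - F (sq \<tau> n))\<^sup>2 \<le> \<bar>sq \<sigma> n - sq \<tau> n\<bar> / (4 * pi)"
      using hX[OF sq(1) sq(1), of \<sigma> _ \<tau>] unfolding F(2)[OF sq(1)] by blast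
  qed
  have "AE s in lebesgue. s \<notin> N" using N(1) by (simp add: negligible_iff_null_sets AE_not_in)
  then have "AE s in lborel. s \<notin> N" by (simp only: AE_completion_iff)
  then have "AE s in lborel. s > 0 \<longrightarrow> w s = F (ln s)"
  proof eventually_elim
    case (elim s)
    show ?case
    proof
      assume s: "s > 0"
      then have "ln s \<in> X" using elim by (simp add: X_def)
      from F(2)[OF this] s show "w s = F (ln s)" by (simp add: W_def)
    qed
  qed
  from AE_radial[OF this] have "AE x in lebesgue. w ((norm (x::real^2))\<^sup>2) = F (ln ((norm x)\<^sup>2))" .
  with uw have "has_profile u F" by eventually_elim simp
  with FH that show ?thesis by blast
qed

section \<open>Decay and tails of profiles\<close>

text \<open>
  The image of planar Lebesgue measure under \<open>x \<mapsto> |x|\<^sup>2\<close>.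
\<close>

definition radial_measure :: "real measure" where
  "radial_measure = density lborel (\<lambda>s. ennreal pi * indicator {0<..} s)"

lemma sets_radial_measure [simp, measurable_cong]: "sets radial_measure = sets borel"
  by (simp add: radial_measure_def)

lemma space_radial_measure [simp]: "space radial_measure = UNIV"
  by (simp add: radial_measure_def)

lemma nn_integral_norm_sq:
  assumes "H \<in> borel_measurable borel"
  shows "(\<integral>\<^sup>+ x. H ((norm (x::real^2))\<^sup>2) \<partial>lebesgue) = (\<integral>\<^sup>+ s. H s \<partial>radial_measure)"
  unfolding radial_measure_def
  by (subst nn_integral_density) (use assms in \<open>auto simp: nn_integral_radial[OF assms]\<close>)

lemma AE_radial_measure_pos: "AE s in radial_measure. s > 0"
  unfolding radial_measure_def by (subst AE_density) (auto simp: indicator_def)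

lemma emeasure_radial_measure:
  assumes "0 \<le> a" "a \<le> b"
  shows "emeasure radial_measure {a<..<b} = ennreal (pi * (b - a))"
proof -
  have "emeasure radial_measure {a<..<b} = (\<integral>\<^sup>+ t. ennreal pi * indicator {a<..<b} t \<partial>lborel)"
    unfolding radial_measure_def using assms
    by (subst emeasure_density) (auto intro!: nn_integral_cong simp: indicator_def)
  also have "\<dots> = ennreal (pi * (b - a))"
    using assms by (subst nn_integral_cmult_indicator) (auto simp: ennreal_mult)
  finally show ?thesis .
qed

lemma nn_integral_powr_radial:
  assumes "\<kappa> < 1"
  shows "(\<integral>\<^sup>+ s. ennreal (s powr (- \<kappa>)) * indicator {0<..<1} s \<partial>radial_measure) < \<infinity>"
proof -
  have "((\<lambda>s. s powr (- \<kappa>)) has_integral (1 powr (- \<kappa> + 1) / (- \<kappa> + 1))) {0..1}"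
    using assms by (intro has_integral_powr_from_0) auto
  then have I: "(\<integral>\<^sup>+ s. ennreal (s powr (- \<kappa>)) * indicator {0..1} s \<partial>lborel) = ennreal (1 / (1 - \<kappa>))"
    by (subst nn_integral_has_integral_lebesgue') auto
  have "(\<integral>\<^sup>+ s. ennreal (s powr (- \<kappa>)) * indicator {0<..<1} s \<partial>radial_measure)
      = (\<integral>\<^sup>+ s. ennreal pi * indicator {0<..} s * (ennreal (s powr (- \<kappa>)) * indicator {0<..<1} s) \<partial>lborel)"
    unfolding radial_measure_def by (subst nn_integral_density) auto
  also have "\<dots> \<le> (\<integral>\<^sup>+ s. ennreal pi * (ennreal (s powr (- \<kappa>)) * indicator {0..1} s) \<partial>lborel)"
    by (intro nn_integral_mono) (auto simp: indicator_def)
  also have "\<dots> = ennreal pi * ennreal (1 / (1 - \<kappa>))"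
    by (subst nn_integral_cmult) (auto simp: I)
  also have "\<dots> < \<infinity>" by (simp add: ennreal_mult_less_top)
  finally show ?thesis .
qed

text \<open>
  The Hoelder condition that the profile of a radial function with Dirichlet integral at most 1 satisfies.
\<close>

definition log_hoelder :: "(real \<Rightarrow> real) \<Rightarrow> bool" where
  "log_hoelder F \<longleftrightarrow> (\<forall>\<sigma> \<tau>. (F \<sigma> - F \<tau>)\<^sup>2 \<le> \<bar>\<sigma> - \<tau>\<bar> / (4 * pi))"

lemma log_hoelder_abs: "log_hoelder F \<Longrightarrow> \<bar>F \<sigma> - F \<tau>\<bar> \<le> sqrt (\<bar>\<sigma> - \<tau>\<bar> / (4 * pi))"
  by (auto simp: log_hoelder_def intro: sq_le_imp_dist_le_sqrt)

lemma log_hoelder_continuous: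
  assumes "log_hoelder F"
  shows "continuous_on UNIV F"
proof (rule continuous_at_imp_continuous_on, rule ballI)
  fix \<tau>
  have "((\<lambda>\<sigma>. sqrt (\<bar>\<sigma> - \<tau>\<bar> / (4 * pi))) \<longlongrightarrow> sqrt (\<bar>\<tau> - \<tau>\<bar> / (4 * pi))) (at \<tau>)"
    by (intro tendsto_intros) auto
  then have "((\<lambda>\<sigma>. sqrt (\<bar>\<sigma> - \<tau>\<bar> / (4 * pi))) \<longlongrightarrow> 0) (at \<tau>)" by simp
  then have "((\<lambda>\<sigma>. F \<sigma> - F \<tau>) \<longlongrightarrow> 0) (at \<tau>)"
    by (rule Lim_null_comparison[rotated]) (use log_hoelder_abs[OF assms] in auto)
  then show "isCont F \<tau>" unfolding isCont_def by (simp add: LIM_zero_iff)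
qed

lemma log_hoelder_measurable: "log_hoelder F \<Longrightarrow> F \<in> borel_measurable borel"
  by (intro borel_measurable_continuous_onI log_hoelder_continuous)

lemma log_hoelder_limit:
  assumes "\<And>n. log_hoelder (Fn n)" "\<And>\<tau>. (\<lambda>n. Fn n \<tau>) \<longlonglongrightarrow> F \<tau>"
  shows "log_hoelder F"
  unfolding log_hoelder_def
proof (intro allI)
  fix \<sigma> \<tau>
  have "(\<lambda>n. (Fn n \<sigma> - Fn n \<tau>)\<^sup>2) \<longlonglongrightarrow> (F \<sigma> - F \<tau>)\<^sup>2"
    by (intro tendsto_power tendsto_diff assms(2))
  then show "(F \<sigma> - F \<tau>)\<^sup>2 \<le> \<bar>\<sigma> - \<tau>\<bar> / (4 * pi)"
    by (rule LIMSEQ_le_const2) (use assms(1) in \<open>auto simp: log_hoelder_def\<close>)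
qed

text \<open>
  Dividing by \<open>B + 1 + |x|\<close> makes the sequence uniformly bounded, so that a diagonal sequence converges
  at all rational points; equicontinuity does the rest.
\<close>

lemma log_hoelder_compact:
  fixes Fn :: "nat \<Rightarrow> real \<Rightarrow> real"
  assumes H: "\<And>n. log_hoelder (Fn n)" and B: "\<And>n. \<bar>Fn n 0\<bar> \<le> B"
  obtains r F where "strict_mono r" "\<And>\<tau>. (\<lambda>n. Fn (r n) \<tau>) \<longlonglongrightarrow> F \<tau>"
proof -
  have B0: "0 \<le> B" using B[of 0] by linarith
  define f where "f n x = Fn n x / (B + 1 + \<bar>x\<bar>)" for n x
  have "norm (f n x) \<le> 1" for n x
  proof -
    have "sqrt (\<bar>x\<bar> / (4 * pi)) \<le> sqrt ((1 + \<bar>x\<bar>)\<^sup>2)"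
    proof (rule real_sqrt_le_mono)
      have "\<bar>x\<bar> / (4 * pi) \<le> \<bar>x\<bar> / 1" using pi_ge_two by (intro divide_left_mono) auto
      also have "\<dots> \<le> (1 + \<bar>x\<bar>)\<^sup>2" by (simp add: power2_eq_square algebra_simps)
      finally show "\<bar>x\<bar> / (4 * pi) \<le> (1 + \<bar>x\<bar>)\<^sup>2" .
    qed
    then have "\<bar>Fn n x\<bar> \<le> B + 1 + \<bar>x\<bar>"
      using log_hoelder_abs[OF H, of n x 0] B[of n] by simp
    then show ?thesis using B0 by (simp add: f_def)
  qed
  then obtain r where r: "strict_mono (r::nat\<Rightarrow>nat)" "\<And>x. x \<in> \<rat> \<Longrightarrow> \<exists>l. (\<lambda>n. f (r n) x) \<longlonglongrightarrow> l"
    using function_convergent_subsequence[of "\<rat>" f 1] countable_rat by blast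
  have rat: "Cauchy (\<lambda>n. Fn (r n) x)" if x: "x \<in> \<rat>" for x
  proof -
    obtain l where "(\<lambda>n. f (r n) x) \<longlonglongrightarrow> l" using r(2)[OF x] by blast
    then have "(\<lambda>n. f (r n) x * (B + 1 + \<bar>x\<bar>)) \<longlonglongrightarrow> l * (B + 1 + \<bar>x\<bar>)"
      by (intro tendsto_mult tendsto_const)
    moreover have "f (r n) x * (B + 1 + \<bar>x\<bar>) = Fn (r n) x" for n using B0 by (simp add: f_def)
    ultimately show ?thesis by (simp add: LIMSEQ_imp_Cauchy)
  qed
  have "convergent (\<lambda>n. Fn (r n) \<tau>)" for \<tau>
  proof (rule Cauchy_convergent, rule metric_CauchyI)
    fix e :: real assume e: "e > 0"
    obtain x where x: "x \<in> \<rat>" "\<tau> < x" "x < \<tau> + (e / 3)\<^sup>2"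
      using Rats_dense_in_real[of \<tau> "\<tau> + (e / 3)\<^sup>2"] e by auto
    have "sqrt (\<bar>\<tau> - x\<bar> / (4 * pi)) \<le> sqrt ((e / 3)\<^sup>2)"
    proof (rule real_sqrt_le_mono)
      have "\<bar>\<tau> - x\<bar> / (4 * pi) \<le> \<bar>\<tau> - x\<bar> / 1" using pi_ge_two by (intro divide_left_mono) auto
      also have "\<dots> \<le> (e / 3)\<^sup>2" using x by simp
      finally show "\<bar>\<tau> - x\<bar> / (4 * pi) \<le> (e / 3)\<^sup>2" .
    qed
    then have c: "\<bar>Fn n \<tau> - Fn n x\<bar> \<le> e / 3" for n
      using log_hoelder_abs[OF H, of n \<tau> x] e by simp
    obtain M where M: "\<And>m n. m \<ge> M \<Longrightarrow> n \<ge> M \<Longrightarrow> dist (Fn (r m) x) (Fn (r n) x) < e / 3"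
      using metric_CauchyD[OF rat[OF x(1)], of "e / 3"] e by auto
    have "dist (Fn (r m) \<tau>) (Fn (r n) \<tau>) < e" if "m \<ge> M" "n \<ge> M" for m n
      using M[OF that] c[of "r m"] c[of "r n"] unfolding dist_real_def by linarith
    then show "\<exists>M. \<forall>m\<ge>M. \<forall>n\<ge>M. dist (Fn (r m) \<tau>) (Fn (r n) \<tau>) < e" by blast
  qed
  then have "\<exists>l. (\<lambda>n. Fn (r n) \<tau>) \<longlonglongrightarrow> l" for \<tau> by (simp add: convergent_def)
  then obtain F where "\<And>\<tau>. (\<lambda>n. Fn (r n) \<tau>) \<longlonglongrightarrow> F \<tau>" by metis
  with r(1) that show ?thesis by blast
qed

text \<open>
  Profiles of functions in the unit ball: besides the Hoelder condition, the integral of \<open>|u|\<^sup>p\<close> over the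
  disc of radius \<open>\<surd>R\<close> is at most \<open>C R\<^sup>\<beta>\<close> for \<open>R \<ge> 1\<close>.
\<close>

definition profile :: "real \<Rightarrow> real \<Rightarrow> real \<Rightarrow> (real \<Rightarrow> real) \<Rightarrow> bool" where
  "profile p C \<beta> F \<longleftrightarrow> log_hoelder F \<and>
     (\<forall>R\<ge>1. (\<integral>\<^sup>+ s. ennreal (\<bar>F (ln s)\<bar> powr p) * indicator {..<R} s \<partial>radial_measure) \<le> ennreal (C * R powr \<beta>))"

text \<open>
  If \<open>|F (ln s)| = a\<close>, then \<open>|F (ln t)| \<ge> a / 2\<close> for \<open>t\<close> between \<open>s\<close> and \<open>s exp (\<pi> a\<^sup>2)\<close>. The minimum with 1
  keeps the interval inside \<open>[s, e s]\<close>, where the growth bound has the order \<open>s\<^sup>\<beta>\<close>.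
\<close>

lemma profile_mass_lower_bound:
  assumes p: "1 < p" and C: "0 < C" and \<beta>: "0 < \<beta>" "\<beta> < 1"
    and F: "profile p C \<beta> F" and s: "1 \<le> s" and a: "a = \<bar>F (ln s)\<bar>" "a > 0"
  shows "a powr p * (pi * min 1 (pi * a\<^sup>2)) \<le> 2 powr p * C * exp \<beta> * s powr (\<beta> - 1)"
proof -
  have H: "log_hoelder F" using F by (simp add: profile_def)
  note [measurable] = log_hoelder_measurable[OF H]
  define x where "x = min 1 (pi * a\<^sup>2)"
  have x: "0 < x" "x \<le> 1" "x \<le> pi * a\<^sup>2" using a by (auto simp: x_def)
  have lower: "a / 2 \<le> \<bar>F (ln t)\<bar>" if t: "s < t" "t < s * exp x" for t
  proof -
    have "ln s < ln t" using s t by simp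
    moreover have "ln t < ln (s * exp x)" using s t by (subst ln_less_cancel_iff) auto
    ultimately have d: "\<bar>ln s - ln t\<bar> \<le> x" using s by (simp add: ln_mult)
    have "sqrt (\<bar>ln s - ln t\<bar> / (4 * pi)) \<le> sqrt ((a / 2)\<^sup>2)"
    proof (rule real_sqrt_le_mono)
      have "\<bar>ln s - ln t\<bar> / (4 * pi) \<le> pi * a\<^sup>2 / (4 * pi)"
        using d x by (intro divide_right_mono) auto
      then show "\<bar>ln s - ln t\<bar> / (4 * pi) \<le> (a / 2)\<^sup>2" by (simp add: power_divide)
    qed
    then have "\<bar>F (ln s) - F (ln t)\<bar> \<le> a / 2"
      using log_hoelder_abs[OF H, of "ln s" "ln t"] a by simp
    then show ?thesis using a(1) by linarith
  qed
  have sx: "s \<le> s * exp x" using s x by simp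
  have "ennreal ((a / 2) powr p * (pi * (s * x))) \<le> ennreal ((a / 2) powr p) * emeasure radial_measure {s<..<s * exp x}"
  proof -
    have "s * x \<le> s * exp x - s"
      using exp_ge_add_one_self[of x] mult_left_mono[of "1 + x" "exp x" s] s by (simp add: algebra_simps)
    then have "(a / 2) powr p * (pi * (s * x)) \<le> (a / 2) powr p * (pi * (s * exp x - s))"
      by (intro mult_left_mono) auto
    then show ?thesis
      using s sx by (subst emeasure_radial_measure) (auto simp: ennreal_mult[symmetric] intro!: ennreal_leI)
  qed
  also have "\<dots> = (\<integral>\<^sup>+ t. ennreal ((a / 2) powr p) * indicator {s<..<s * exp x} t \<partial>radial_measure)"
    by (rule nn_integral_cmult_indicator[symmetric]) simp
  also have "\<dots> \<le> (\<integral>\<^sup>+ t. ennreal (\<bar>F (ln t)\<bar> powr p) * indicator {..<s * exp x} t \<partial>radial_measure)"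
    using lower a p by (intro nn_integral_mono) (auto simp: indicator_def intro!: ennreal_leI powr_mono2)
  also have "\<dots> \<le> ennreal (C * (s * exp x) powr \<beta>)"
    using F order_trans[OF s sx] unfolding profile_def by blast
  finally have "(a / 2) powr p * (pi * (s * x)) \<le> C * (s * exp x) powr \<beta>"
    using C by (subst (asm) ennreal_le_iff) auto
  also have "\<dots> \<le> C * (exp \<beta> * s powr \<beta>)"
  proof -
    have "(s * exp x) powr \<beta> = s powr \<beta> * exp (x * \<beta>)"
      using s by (simp add: powr_def ln_mult distrib_left exp_add mult.commute)
    also have "\<dots> \<le> s powr \<beta> * exp \<beta>"
      using x \<beta> by (intro mult_left_mono) (auto simp: mult_le_cancel_right1)
    finally show ?thesis using C by (simp add: mult.commute)
  qed
  finally have "(a / 2) powr p * (pi * (s * x)) \<le> C * (exp \<beta> * s powr \<beta>)" .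
  moreover have "(a / 2) powr p = a powr p / 2 powr p" using a by (simp add: powr_divide)
  ultimately have "a powr p * (pi * x) * s \<le> 2 powr p * C * exp \<beta> * s powr \<beta>"
    by (simp add: field_simps)
  moreover have "s powr \<beta> = s powr (\<beta> - 1) * s" using s by (simp add: powr_diff)
  ultimately have "a powr p * (pi * x) * s \<le> 2 powr p * C * exp \<beta> * s powr (\<beta> - 1) * s"
    by (simp add: mult.assoc)
  then show ?thesis using s by (simp add: x_def)
qed

lemma profile_decay:
  assumes p: "1 < p" and C: "0 < C" and \<beta>: "0 < \<beta>" "\<beta> < 1"
  obtains B where "B > 0" "\<And>F s. profile p C \<beta> F \<Longrightarrow> 1 \<le> s \<Longrightarrow> \<bar>F (ln s)\<bar> \<le> B * s powr (- ((1 - \<beta>) / (p + 2)))"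
proof -
  define C1 where "C1 = 2 powr p * C * exp \<beta>"
  define A where "A = (1 + C1 powr (2 / p)) * C1"
  have C1: "C1 > 0" using C by (simp add: C1_def)
  have A: "A > 0" using C1 by (simp add: A_def add_pos_nonneg)
  have "\<bar>F (ln s)\<bar> \<le> A powr (1 / (p + 2)) * s powr (- ((1 - \<beta>) / (p + 2)))"
    if F: "profile p C \<beta> F" and s: "1 \<le> s" for F s
  proof (cases "F (ln s) = 0")
    case False
    define a where "a = \<bar>F (ln s)\<bar>"
    have a: "a > 0" using False by (simp add: a_def)
    define D where "D = C1 * s powr (\<beta> - 1)"
    have D0: "0 \<le> D" using C1 by (simp add: D_def)
    have "s powr (\<beta> - 1) \<le> s powr 0" using s \<beta> by (intro powr_mono) auto
    then have DC: "D \<le> C1" using C1 s by (simp add: D_def)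
    have main: "a powr p * (pi * min 1 (pi * a\<^sup>2)) \<le> D"
      using profile_mass_lower_bound[OF p C \<beta> F s a_def a] by (simp add: D_def C1_def)
    have pi1: "1 \<le> pi" using pi_ge_two by linarith
    have "a powr p * a\<^sup>2 \<le> (1 + C1 powr (2 / p)) * D"
    proof (cases "pi * a\<^sup>2 \<le> 1")
      case True
      have "1 * (a powr p * a\<^sup>2) \<le> (pi * pi) * (a powr p * a\<^sup>2)"
        using pi1 mult_mono[OF pi1 pi1] by (intro mult_right_mono) auto
      also have "\<dots> \<le> D" using main True by (simp add: min_def mult_ac)
      also have "\<dots> \<le> (1 + C1 powr (2 / p)) * D" using D0 by (simp add: algebra_simps)
      finally show ?thesis by simp
    next
      case False
      have "1 * a powr p \<le> pi * a powr p" using pi1 by (intro mult_right_mono) auto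
      then have ap: "a powr p \<le> D" using main False by (simp add: min_def mult.commute)
      have "a\<^sup>2 = (a powr p) powr (2 / p)" using a p by (simp add: powr_powr)
      also have "\<dots> \<le> C1 powr (2 / p)" using ap DC p by (intro powr_mono2) auto
      finally have "a powr p * a\<^sup>2 \<le> D * C1 powr (2 / p)" using ap D0 by (intro mult_mono) auto
      also have "\<dots> \<le> (1 + C1 powr (2 / p)) * D" using D0 by (simp add: algebra_simps)
      finally show ?thesis .
    qed
    moreover have "a powr (p + 2) = a powr p * a\<^sup>2" using a by (simp add: powr_add)
    ultimately have "a powr (p + 2) \<le> A * s powr (\<beta> - 1)" by (simp add: A_def D_def mult.assoc)
    then have "(a powr (p + 2)) powr (1 / (p + 2)) \<le> (A * s powr (\<beta> - 1)) powr (1 / (p + 2))"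
      using p by (intro powr_mono2) auto
    also have "\<dots> = A powr (1 / (p + 2)) * s powr ((\<beta> - 1) / (p + 2))"
      using A by (simp add: powr_mult powr_powr)
    also have "(\<beta> - 1) / (p + 2) = - ((1 - \<beta>) / (p + 2))" by (simp add: minus_divide_left)
    finally show ?thesis using a p by (simp add: powr_powr a_def)
  qed simp
  moreover have "A powr (1 / (p + 2)) > 0" using A by simp
  ultimately show ?thesis using that by blast
qed

lemma ex_dyadic:
  fixes s N :: real
  assumes "1 \<le> N" "N \<le> s"
  obtains k :: nat where "2 ^ k * N \<le> s" "s < 2 ^ Suc k * N"
proof -
  have "\<exists>n. s / N < 2 ^ n" by (rule real_arch_pow) simp
  then have L: "s / N < 2 ^ (LEAST n. s / N < 2 ^ n)" by (rule LeastI_ex)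
  have "(LEAST n. s / N < 2 ^ n) \<noteq> 0"
  proof
    assume "(LEAST n. s / N < 2 ^ n) = 0"
    with L have "s / N < 1" by simp
    then show False using assms by (simp add: field_simps)
  qed
  then obtain k where k: "(LEAST n. s / N < 2 ^ n) = Suc k" using not0_implies_Suc by blast
  have "\<not> s / N < 2 ^ k" using not_less_Least[of k "\<lambda>n. s / N < 2 ^ n"] k by simp
  with L k that[of k] assms show ?thesis by (simp add: field_simps)
qed

text \<open>
  On the dyadic annulus \<open>2\<^sup>k N \<le> s < 2\<^sup>k\<^sup>+\<^sup>1 N\<close> the factor \<open>|F|\<^sup>m\<close> is bounded by the pointwise decay and the
  integral of \<open>|F|\<^sup>p\<close> by the growth bound; the hypothesis on \<open>m\<close> makes the resulting series geometric.
\<close>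

lemma profile_tail:
  assumes p: "1 < p" and C: "0 < C" and \<beta>: "0 < \<beta>" "\<beta> < 1"
    and m: "0 < m" "\<beta> < (1 - \<beta>) / (p + 2) * m"
  obtains D \<gamma> where "0 < D" "0 < \<gamma>" "\<And>F N. profile p C \<beta> F \<Longrightarrow> 1 \<le> N \<Longrightarrow>
    (\<integral>\<^sup>+ s. ennreal (\<bar>F (ln s)\<bar> powr (p + m)) * indicator {N..} s \<partial>radial_measure) \<le> ennreal (D * N powr (- \<gamma>))"
proof -
  define \<delta> where "\<delta> = (1 - \<beta>) / (p + 2)"
  define \<gamma> where "\<gamma> = \<delta> * m - \<beta>"
  have \<gamma>: "\<gamma> > 0" using m by (simp add: \<gamma>_def \<delta>_def)
  have \<delta>: "\<delta> > 0" using p \<beta> by (simp add: \<delta>_def)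
  obtain B where B': "B > 0"
    "\<And>F s. profile p C \<beta> F \<Longrightarrow> 1 \<le> s \<Longrightarrow> \<bar>F (ln s)\<bar> \<le> B * s powr (- ((1 - \<beta>) / (p + 2)))"
    by (rule profile_decay[OF p C \<beta>]) (rule that)
  note B = B'(1) B'(2)[folded \<delta>_def]
  define q where "q = 2 powr (- \<gamma>)"
  have q: "0 < q" "q < 1" using \<gamma> by (auto simp: q_def powr_less_one)
  define E where "E = B powr m * C * 2 powr \<beta>"
  have E: "E > 0" using B C by (simp add: E_def)
  have "(\<integral>\<^sup>+ s. ennreal (\<bar>F (ln s)\<bar> powr (p + m)) * indicator {N..} s \<partial>radial_measure)
      \<le> ennreal (E / (1 - q) * N powr (- \<gamma>))" if F: "profile p C \<beta> F" and N: "1 \<le> N" for F N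
  proof -
    have H: "log_hoelder F" using F by (simp add: profile_def)
    note [measurable] = log_hoelder_measurable[OF H]
    define c where "c k = B powr m * (2 ^ k * N) powr (- (\<delta> * m))" for k :: nat
    define T where "T k s = ennreal (c k) * (ennreal (\<bar>F (ln s)\<bar> powr p) * indicator {..<2 ^ Suc k * N} s)" for k s
    have "(\<integral>\<^sup>+ s. ennreal (\<bar>F (ln s)\<bar> powr (p + m)) * indicator {N..} s \<partial>radial_measure)
        \<le> (\<integral>\<^sup>+ s. (\<Sum>k. T k s) \<partial>radial_measure)"
    proof (rule nn_integral_mono)
      fix s
      show "ennreal (\<bar>F (ln s)\<bar> powr (p + m)) * indicator {N..} s \<le> (\<Sum>k. T k s)"
      proof (cases "N \<le> s")
        case True
        obtain k where k: "2 ^ k * N \<le> s" "s < 2 ^ Suc k * N" using ex_dyadic[OF N True] .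
        have kN: "1 \<le> 2 ^ k * N" using mult_mono[of 1 "2 ^ k" 1 N] N by simp
        have "\<bar>F (ln s)\<bar> powr m \<le> (B * s powr (- \<delta>)) powr m"
          using B(2)[OF F, of s] True N m by (intro powr_mono2) auto
        also have "\<dots> = B powr m * s powr (- (\<delta> * m))"
          using B(1) by (simp add: powr_mult powr_powr)
        also have "\<dots> \<le> c k"
          unfolding c_def using k(1) kN \<delta> m by (intro mult_left_mono powr_mono2') auto
        finally have "\<bar>F (ln s)\<bar> powr m \<le> c k" .
        then have "\<bar>F (ln s)\<bar> powr (p + m) \<le> c k * \<bar>F (ln s)\<bar> powr p"
          unfolding powr_add mult.commute[of "\<bar>F (ln s)\<bar> powr p"] by (intro mult_right_mono) auto
        then have "ennreal (\<bar>F (ln s)\<bar> powr (p + m)) \<le> T k s"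
          using k(2) by (simp add: T_def c_def ennreal_mult[symmetric] ennreal_leI)
        also have "T k s \<le> (\<Sum>k. T k s)"
          using sum_le_suminf[of "\<lambda>k. T k s" "{k}"] by simp
        finally show ?thesis using True by simp
      qed simp
    qed
    also have "\<dots> = (\<Sum>k. \<integral>\<^sup>+ s. T k s \<partial>radial_measure)"
      unfolding T_def by (rule nn_integral_suminf) measurable
    also have "\<dots> \<le> (\<Sum>k. ennreal (E * N powr (- \<gamma>) * q ^ k))"
    proof (rule suminf_le)
      fix k
      have kN: "1 \<le> 2 ^ Suc k * N" using mult_mono[of 1 "2 ^ Suc k" 1 N] N one_le_power[of "2::real" "Suc k"] by simp
      have "(\<integral>\<^sup>+ s. T k s \<partial>radial_measure)
          = ennreal (c k) * (\<integral>\<^sup>+ s. ennreal (\<bar>F (ln s)\<bar> powr p) * indicator {..<2 ^ Suc k * N} s \<partial>radial_measure)"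
        unfolding T_def by (rule nn_integral_cmult) measurable
      also have "\<dots> \<le> ennreal (c k) * ennreal (C * (2 ^ Suc k * N) powr \<beta>)"
        using F kN unfolding profile_def by (intro mult_left_mono) auto
      also have "\<dots> = ennreal (E * N powr (- \<gamma>) * q ^ k)"
      proof -
        have "(2 ^ k * N) powr (- (\<delta> * m)) * (2 ^ Suc k * N) powr \<beta> = 2 powr \<beta> * ((2 ^ k * N) powr (- (\<delta> * m)) * (2 ^ k * N) powr \<beta>)"
          using N by (simp add: powr_mult)
        also have "(2 ^ k * N) powr (- (\<delta> * m)) * (2 ^ k * N) powr \<beta> = (2 ^ k * N) powr (- \<gamma>)"
          using N by (simp add: powr_add[symmetric] \<gamma>_def)
        also have "(2 ^ k * N) powr (- \<gamma>) = q ^ k * N powr (- \<gamma>)"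
          using N by (simp add: powr_mult q_def powr_realpow[symmetric] powr_powr mult.commute)
        finally show ?thesis using B C
          by (subst ennreal_mult[symmetric]) (auto simp: c_def E_def mult_ac)
      qed
      finally show "(\<integral>\<^sup>+ s. T k s \<partial>radial_measure) \<le> ennreal (E * N powr (- \<gamma>) * q ^ k)" .
    qed auto
    also have "\<dots> = ennreal (E * N powr (- \<gamma>) * (1 / (1 - q)))"
      using q E by (intro suminf_ennreal_eq sums_mult geometric_sums) auto
    finally show ?thesis by simp
  qed
  moreover have "E / (1 - q) > 0" using E q by simp
  ultimately show ?thesis using that \<gamma> by blast
qed

lemma log_hoelder_exp_bound:
  assumes \<nu>: "0 < \<nu>" "\<nu> < 4 * pi" and B: "0 \<le> B"
  obtains \<kappa> E where "\<kappa> < 1" "0 < E" "\<And>F s. log_hoelder F \<Longrightarrow> \<bar>F 0\<bar> \<le> B \<Longrightarrow> 0 < s \<Longrightarrow> s < 1 \<Longrightarrow>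
    exp (\<nu> * (F (ln s))\<^sup>2) \<le> E * s powr (- \<kappa>)"
proof -
  define \<kappa> where "\<kappa> = (1 + \<nu> / (4 * pi)) / 2"
  have n1: "\<nu> / (4 * pi) < 1" using \<nu> by (simp add: field_simps)
  have "(1 + x) / 2 < 1 \<and> x < (1 + x) / 2" if "x < 1" for x :: real using that by simp
  from this[OF n1] have \<kappa>: "\<kappa> < 1" "\<nu> / (4 * pi) < \<kappa>" by (simp_all only: \<kappa>_def)
  \<comment> \<open>Chosen so that \<open>(1 + \<epsilon>) \<nu> / (4 \<pi>) = \<kappa>\<close>.\<close>
  define \<epsilon> where "\<epsilon> = \<kappa> / (\<nu> / (4 * pi)) - 1"
  have \<epsilon>: "\<epsilon> > 0" using \<kappa>(2) \<nu> by (simp add: \<epsilon>_def field_simps)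
  have \<epsilon>\<kappa>: "\<nu> * ((1 + \<epsilon>) * (x / (4 * pi))) = \<kappa> * x" for x using \<nu> by (simp add: \<epsilon>_def)
  define E where "E = exp (\<nu> * ((1 + 1 / \<epsilon>) * B\<^sup>2))"
  have "exp (\<nu> * (F (ln s))\<^sup>2) \<le> E * s powr (- \<kappa>)"
    if F: "log_hoelder F" "\<bar>F 0\<bar> \<le> B" and s: "0 < s" "s < 1" for F s
  proof -
    define y where "y = sqrt (\<bar>ln s\<bar> / (4 * pi))"
    have y: "0 \<le> y" "y\<^sup>2 = \<bar>ln s\<bar> / (4 * pi)" by (auto simp: y_def)
    have "\<bar>F (ln s)\<bar> \<le> B + y" using log_hoelder_abs[OF F(1), of "ln s" 0] F(2) by (simp add: y_def)
    then have "(F (ln s))\<^sup>2 \<le> (B + y)\<^sup>2" using power_mono[of "\<bar>F (ln s)\<bar>" "B + y" 2] by simp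
    also have "\<dots> \<le> (1 + 1 / \<epsilon>) * B\<^sup>2 + (1 + \<epsilon>) * y\<^sup>2"
    proof -
      define t where "t = sqrt \<epsilon>"
      have t: "t > 0" "t\<^sup>2 = \<epsilon>" using \<epsilon> by (auto simp: t_def)
      have "2 * (B / t) * (t * y) \<le> (B / t)\<^sup>2 + (t * y)\<^sup>2" by (rule sum_squares_bound)
      then have "2 * B * y \<le> B\<^sup>2 / \<epsilon> + \<epsilon> * y\<^sup>2" using t by (simp add: power_divide power_mult_distrib)
      then show ?thesis by (simp add: power2_sum algebra_simps)
    qed
    finally have "\<nu> * (F (ln s))\<^sup>2 \<le> \<nu> * ((1 + 1 / \<epsilon>) * B\<^sup>2 + (1 + \<epsilon>) * y\<^sup>2)"
      using \<nu> by (intro mult_left_mono) auto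
    also have "\<dots> = \<nu> * ((1 + 1 / \<epsilon>) * B\<^sup>2) + \<kappa> * \<bar>ln s\<bar>"
      unfolding y(2) distrib_left \<epsilon>\<kappa> by simp
    finally have "exp (\<nu> * (F (ln s))\<^sup>2) \<le> E * exp (\<kappa> * \<bar>ln s\<bar>)"
      unfolding E_def exp_add[symmetric] by simp
    also have "exp (\<kappa> * \<bar>ln s\<bar>) = s powr (- \<kappa>)" using s by (simp add: powr_def)
    finally show ?thesis .
  qed
  then show ?thesis using that[of \<kappa> E] \<kappa>(1) by (auto simp: E_def)
qed

section \<open>The functional on profiles\<close>

lemma psi_sums: "(\<lambda>j. t ^ (j + n) / fact (j + n)) sums psi n t"
proof -
  have "(\<lambda>j. t ^ j / fact j) sums exp t"
    using exp_converges[of t] by (simp add: divide_inverse scaleR_conv_of_real mult.commute)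
  then show ?thesis by (subst sums_iff_shift) (simp add: psi_def)
qed

lemma psi_nonneg: "0 \<le> t \<Longrightarrow> 0 \<le> psi n t"
  by (rule sums_le[OF _ sums_zero psi_sums]) auto

lemma psi_le_exp: "0 \<le> t \<Longrightarrow> psi n t \<le> exp t"
  unfolding psi_def by (simp add: sum_nonneg)

lemma psi_le_power_exp:
  assumes t: "0 \<le> t"
  shows "psi n t \<le> t ^ n * exp t"
proof (rule sums_le[OF _ psi_sums])
  show "(\<lambda>j. t ^ n * (t ^ j / fact j)) sums (t ^ n * exp t)"
    using exp_converges[of t] by (intro sums_mult) (simp add: divide_inverse scaleR_conv_of_real mult.commute)
  fix j
  have "t ^ (j + n) / fact (j + n) \<le> t ^ (j + n) / fact j"
    using t by (intro divide_left_mono fact_mono) auto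
  then show "t ^ (j + n) / fact (j + n) \<le> t ^ n * (t ^ j / fact j)" by (simp add: power_add mult.commute)
qed

lemma psi_scale:
  assumes t: "0 \<le> t" and c: "1 \<le> c" and n: "1 \<le> n"
  shows "c * psi n t \<le> psi n (c * t)"
proof (rule sums_le[OF _ sums_mult[OF psi_sums] psi_sums])
  fix j
  have "c ^ 1 \<le> c ^ (j + n)" using c n by (intro power_increasing) auto
  then have "c * t ^ (j + n) \<le> c ^ (j + n) * t ^ (j + n)" using t by (intro mult_right_mono) auto
  then show "c * (t ^ (j + n) / fact (j + n)) \<le> (c * t) ^ (j + n) / fact (j + n)"
    by (simp add: power_mult_distrib divide_right_mono)
qed

lemma psi_pos:
  assumes t: "0 < t"
  shows "0 < psi n t"
proof -
  have "(\<Sum>j\<in>{0}. t ^ (j + n) / fact (j + n)) \<le> (\<Sum>j. t ^ (j + n) / fact (j + n))"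
    using t sums_summable[OF psi_sums] by (intro sum_le_suminf) auto
  moreover have "0 < t ^ n / fact n" using t by simp
  ultimately show ?thesis unfolding sums_unique[OF psi_sums, symmetric] by simp
qed

lemma continuous_on_psi: "continuous_on A f \<Longrightarrow> continuous_on A (\<lambda>x. psi n (f x))"
  unfolding psi_def by (intro continuous_intros) auto

lemma tendsto_psi: "(f \<longlongrightarrow> l) F \<Longrightarrow> ((\<lambda>x. psi n (f x)) \<longlongrightarrow> psi n l) F"
  unfolding psi_def by (intro tendsto_intros) auto

lemma borel_measurable_psi [measurable]: "psi n \<in> borel_measurable borel"
  by (intro borel_measurable_continuous_onI continuous_on_psi continuous_on_id)

lemma emeasure_radial_measure_lessThan: "emeasure radial_measure {..<N} = ennreal (pi * max 0 N)"
proof -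
  have "emeasure radial_measure {..<N} = (\<integral>\<^sup>+ t. ennreal pi * indicator {0<..<N} t \<partial>lborel)"
    unfolding radial_measure_def
    by (subst emeasure_density) (auto intro!: nn_integral_cong simp: indicator_def)
  also have "\<dots> = ennreal (pi * max 0 N)"
    by (subst nn_integral_cmult_indicator) (auto simp: ennreal_mult max_def)
  finally show ?thesis .
qed

text \<open>
  For \<open>\<kappa> < 1\<close> this function of \<open>s > 0\<close> is integrable on bounded sets. Suitable constants make it dominate
  \<open>|u|\<close> and \<open>exp (\<nu> u\<^sup>2)\<close> for all profiles at once.
\<close>

definition dominator :: "real \<Rightarrow> real \<Rightarrow> real \<Rightarrow> real \<Rightarrow> real" where
  "dominator K E \<kappa> s = K + E * (s powr (- \<kappa>) * indicator {0<..<1} s)"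

lemma dominator_measurable [measurable]: "dominator K E \<kappa> \<in> borel_measurable borel"
  unfolding dominator_def by measurable

lemma dominator_nonneg: "0 \<le> K \<Longrightarrow> 0 \<le> E \<Longrightarrow> 0 \<le> dominator K E \<kappa> s"
  by (simp add: dominator_def)

lemma dominator_locally_integrable:
  assumes "0 \<le> K" "0 \<le> E" "\<kappa> < 1"
  shows "(\<integral>\<^sup>+ s. ennreal (dominator K E \<kappa> s) * indicator {..<N} s \<partial>radial_measure) < \<infinity>"
proof -
  have "(\<integral>\<^sup>+ s. ennreal (dominator K E \<kappa> s) * indicator {..<N} s \<partial>radial_measure)
      \<le> (\<integral>\<^sup>+ s. ennreal K * indicator {..<N} s + ennreal E * (ennreal (s powr (- \<kappa>)) * indicator {0<..<1} s) \<partial>radial_measure)"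
    using assms by (intro nn_integral_mono)
      (auto simp: dominator_def indicator_def ennreal_mult[symmetric] ennreal_plus[symmetric] simp del: ennreal_plus)
  also have "\<dots> = ennreal K * emeasure radial_measure {..<N}
      + ennreal E * (\<integral>\<^sup>+ s. ennreal (s powr (- \<kappa>)) * indicator {0<..<1} s \<partial>radial_measure)"
    by (subst nn_integral_add) (auto simp: nn_integral_cmult nn_integral_cmult_indicator)
  also have "\<dots> < \<infinity>"
    using nn_integral_powr_radial[OF assms(3)]
    by (simp add: emeasure_radial_measure_lessThan ennreal_mult_less_top)
  finally show ?thesis .
qed

lemma profile_dominated:
  assumes p: "1 < p" and C: "0 < C" and \<beta>: "0 < \<beta>" "\<beta> < 1" and \<nu>: "0 < \<nu>" "\<nu> < 4 * pi"
  obtains B K E \<kappa> where "0 < B" "0 < K" "0 < E" "\<kappa> < 1"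
    "\<And>F s. profile p C \<beta> F \<Longrightarrow> 1 \<le> s \<Longrightarrow> \<bar>F (ln s)\<bar> \<le> B"
    "\<And>F s. profile p C \<beta> F \<Longrightarrow> 0 < s \<Longrightarrow> exp (\<nu> * (F (ln s))\<^sup>2) \<le> dominator K E \<kappa> s"
    "\<And>F s. profile p C \<beta> F \<Longrightarrow> 0 < s \<Longrightarrow> \<bar>F (ln s)\<bar> \<le> dominator K E \<kappa> s"
proof -
  obtain B where B: "B > 0"
    "\<And>F s. profile p C \<beta> F \<Longrightarrow> 1 \<le> s \<Longrightarrow> \<bar>F (ln s)\<bar> \<le> B * s powr (- ((1 - \<beta>) / (p + 2)))"
    by (rule profile_decay[OF p C \<beta>]) (rule that)
  have B1: "\<bar>F (ln s)\<bar> \<le> B" if F: "profile p C \<beta> F" and s: "1 \<le> s" for F s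
  proof -
    have "s powr (- ((1 - \<beta>) / (p + 2))) \<le> s powr 0" using s p \<beta> by (intro powr_mono) auto
    then have "B * s powr (- ((1 - \<beta>) / (p + 2))) \<le> B * 1" using s B(1) by (intro mult_left_mono) auto
    then show ?thesis using B(2)[OF F s] by linarith
  qed
  have B0: "\<bar>F 0\<bar> \<le> B" if F: "profile p C \<beta> F" for F using B1[OF F, of 1] by simp
  have "0 \<le> B" using B(1) by simp
  then obtain \<kappa> E where \<kappa>: "\<kappa> < 1" "0 < E"
    "\<And>F s. log_hoelder F \<Longrightarrow> \<bar>F 0\<bar> \<le> B \<Longrightarrow> 0 < s \<Longrightarrow> s < 1 \<Longrightarrow> exp (\<nu> * (F (ln s))\<^sup>2) \<le> E * s powr (- \<kappa>)"
    using log_hoelder_exp_bound[OF \<nu>, of B thesis] by blast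
  define K where "K = 1 + B + exp (\<nu> * B\<^sup>2)"
  define E' where "E' = E + E / \<nu>"
  have K: "0 < K" using B(1) by (simp add: K_def add_pos_pos)
  have E': "0 < E'" using \<kappa>(2) \<nu> by (simp add: E'_def add_pos_pos)
  have e1: "exp (\<nu> * (F (ln s))\<^sup>2) \<le> E * s powr (- \<kappa>)" if "profile p C \<beta> F" "0 < s" "s < 1" for F s
    using \<kappa>(3)[of F s] that B0[of F] by (simp add: profile_def)
  have a: "exp (\<nu> * (F (ln s))\<^sup>2) \<le> dominator K E' \<kappa> s" if F: "profile p C \<beta> F" "0 < s" for F s
  proof (cases "s < 1")
    case True
    have "E * s powr (- \<kappa>) \<le> E' * s powr (- \<kappa>)" using \<kappa>(2) \<nu> by (intro mult_right_mono) (auto simp: E'_def)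
    with e1[OF F True] K have "exp (\<nu> * (F (ln s))\<^sup>2) \<le> K + E' * s powr (- \<kappa>)" by linarith
    then show ?thesis using True F(2) by (simp add: dominator_def)
  next
    case False
    have "(F (ln s))\<^sup>2 \<le> B\<^sup>2" using B1[OF F(1), of s] False power_mono[of "\<bar>F (ln s)\<bar>" B 2] by simp
    then have "exp (\<nu> * (F (ln s))\<^sup>2) \<le> exp (\<nu> * B\<^sup>2)" using \<nu> by simp
    then have "exp (\<nu> * (F (ln s))\<^sup>2) \<le> K" using B(1) unfolding K_def by linarith
    then show ?thesis using False by (simp add: dominator_def)
  qed
  have c: "\<bar>F (ln s)\<bar> \<le> dominator K E' \<kappa> s" if F: "profile p C \<beta> F" "0 < s" for F s
  proof (cases "s < 1")
    case True
    have "2 * \<bar>F (ln s)\<bar> * 1 \<le> \<bar>F (ln s)\<bar>\<^sup>2 + 1\<^sup>2" by (rule sum_squares_bound)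
    then have "\<bar>F (ln s)\<bar> \<le> 1 + (F (ln s))\<^sup>2"
      using zero_le_power2[of "F (ln s)"] unfolding power2_abs power_one by linarith
    also have "(F (ln s))\<^sup>2 = (\<nu> * (F (ln s))\<^sup>2) / \<nu>" using \<nu> by simp
    also have "\<dots> \<le> exp (\<nu> * (F (ln s))\<^sup>2) / \<nu>"
      using \<nu> exp_ge_add_one_self[of "\<nu> * (F (ln s))\<^sup>2"] by (intro divide_right_mono) linarith+
    also have "\<dots> \<le> E * s powr (- \<kappa>) / \<nu>" using e1[OF F True] \<nu> by (intro divide_right_mono) auto
    also have "\<dots> \<le> E' * s powr (- \<kappa>)"
      using \<kappa>(2) \<nu> by (simp add: E'_def distrib_right)
    finally have "\<bar>F (ln s)\<bar> \<le> 1 + E' * s powr (- \<kappa>)" by simp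
    moreover have "1 \<le> K" using B(1) exp_gt_zero[of "\<nu> * B\<^sup>2"] unfolding K_def by linarith
    ultimately have "\<bar>F (ln s)\<bar> \<le> K + E' * s powr (- \<kappa>)" by linarith
    then show ?thesis using True F(2) by (simp add: dominator_def)
  next
    case False
    then have "\<bar>F (ln s)\<bar> \<le> K"
      using B1[OF F(1), of s] exp_gt_zero[of "\<nu> * B\<^sup>2"] unfolding K_def by linarith
    then show ?thesis using False by (simp add: dominator_def)
  qed
  show ?thesis
    by (rule that[OF B(1) K E' \<kappa>(1)]) (erule (1) B1, erule (1) a, erule (1) c)
qed

text \<open>
  The functional \<open>\<Psi>\<^sub>\<nu>\<close> in terms of the profile.
\<close>

definition radial_functional :: "nat \<Rightarrow> real \<Rightarrow> (real \<Rightarrow> real) \<Rightarrow> ennreal" where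
  "radial_functional n \<nu> F = (\<integral>\<^sup>+ s. ennreal (psi n (\<nu> * (F (ln s))\<^sup>2)) \<partial>radial_measure)"

text \<open>
  Both parts split the integral at \<open>s = N\<close>: dominated convergence applies below \<open>N\<close>, and the part above
  \<open>N\<close> is uniformly small because there \<open>psi n (\<nu> F\<^sup>2) \<le> Q |F|\<^bsup>2n\<^esup>\<close>.
\<close>

lemma profile_functional:
  assumes p: "1 < p" and C: "0 < C" and \<beta>: "0 < \<beta>" "\<beta> < 1" and \<nu>: "0 < \<nu>" "\<nu> < 4 * pi"
    and n: "(p + 2 * \<beta>) / (1 - \<beta>) < 2 * real n"
  shows profile_functional_bounded: "\<exists>M<\<infinity>. \<forall>F. profile p C \<beta> F \<longrightarrow> radial_functional n \<nu> F \<le> M"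
    and profile_functional_limit: "\<And>Fn F S. (\<And>k::nat. profile p C \<beta> (Fn k)) \<Longrightarrow>
      (\<And>\<tau>. (\<lambda>k. Fn k \<tau>) \<longlonglongrightarrow> F \<tau>) \<Longrightarrow> (\<lambda>k. radial_functional n \<nu> (Fn k)) \<longlonglongrightarrow> S \<Longrightarrow>
      S \<le> radial_functional n \<nu> F"
proof -
  obtain B K E \<kappa> where dom: "0 < B" "0 < K" "0 < E" "\<kappa> < 1"
    "\<And>F s. profile p C \<beta> F \<Longrightarrow> 1 \<le> s \<Longrightarrow> \<bar>F (ln s)\<bar> \<le> B"
    "\<And>F s. profile p C \<beta> F \<Longrightarrow> 0 < s \<Longrightarrow> exp (\<nu> * (F (ln s))\<^sup>2) \<le> dominator K E \<kappa> s"
    by (rule profile_dominated[OF p C \<beta> \<nu>]) (rule that)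
  define m where "m = 2 * real n - p"
  have np: "p + 2 * \<beta> < 2 * real n * (1 - \<beta>)" using n \<beta> by (simp add: pos_divide_less_eq)
  have "2 * real n * (1 - \<beta>) \<le> 2 * real n" using \<beta> by (simp add: algebra_simps)
  then have m: "0 < m" using np \<beta> by (simp add: m_def)
  have m2: "\<beta> < (1 - \<beta>) / (p + 2) * m"
  proof -
    have "\<beta> * (p + 2) < (1 - \<beta>) * m" using np by (simp add: m_def algebra_simps)
    then show ?thesis using p by (simp add: pos_less_divide_eq)
  qed
  obtain D \<gamma> where D: "0 < D" "0 < \<gamma>" "\<And>F N. profile p C \<beta> F \<Longrightarrow> 1 \<le> N \<Longrightarrow>
    (\<integral>\<^sup>+ s. ennreal (\<bar>F (ln s)\<bar> powr (p + m)) * indicator {N..} s \<partial>radial_measure) \<le> ennreal (D * N powr (- \<gamma>))"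
    by (rule profile_tail[OF p C \<beta> m m2]) (rule that)
  define Q where "Q = \<nu> ^ n * exp (\<nu> * B\<^sup>2)"
  have Q: "0 < Q" using \<nu> by (simp add: Q_def)
  have n1: "n > 0" using m p by (cases n) (auto simp: m_def)
  have meas: "(\<lambda>s. ennreal (psi n (\<nu> * (F (ln s))\<^sup>2))) \<in> borel_measurable radial_measure" if "log_hoelder F" for F
    using log_hoelder_measurable[OF that] by measurable
  have H: "log_hoelder F" if "profile p C \<beta> F" for F using that by (simp add: profile_def)
  have tail: "(\<integral>\<^sup>+ s. ennreal (psi n (\<nu> * (F (ln s))\<^sup>2)) * indicator {N..} s \<partial>radial_measure) \<le> ennreal (Q * D * N powr (- \<gamma>))"
    if F: "profile p C \<beta> F" and N: "1 \<le> N" for F N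
  proof -
    note [measurable] = log_hoelder_measurable[OF H[OF F]]
    have "(\<integral>\<^sup>+ s. ennreal (psi n (\<nu> * (F (ln s))\<^sup>2)) * indicator {N..} s \<partial>radial_measure)
        \<le> (\<integral>\<^sup>+ s. ennreal Q * (ennreal (\<bar>F (ln s)\<bar> powr (p + m)) * indicator {N..} s) \<partial>radial_measure)"
    proof (rule nn_integral_mono)
      fix s
      have "psi n (\<nu> * (F (ln s))\<^sup>2) \<le> Q * \<bar>F (ln s)\<bar> powr (p + m)" if s: "N \<le> s"
      proof -
        have b: "\<bar>F (ln s)\<bar> \<le> B" using dom(5)[OF F, of s] s N by simp
        have "psi n (\<nu> * (F (ln s))\<^sup>2) \<le> (\<nu> * (F (ln s))\<^sup>2) ^ n * exp (\<nu> * (F (ln s))\<^sup>2)"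
          using \<nu> by (intro psi_le_power_exp) auto
        also have "\<dots> \<le> (\<nu> * (F (ln s))\<^sup>2) ^ n * exp (\<nu> * B\<^sup>2)"
          using \<nu> power_mono[OF b, of 2] by (intro mult_left_mono) auto
        also have "(\<nu> * (F (ln s))\<^sup>2) ^ n = \<nu> ^ n * \<bar>F (ln s)\<bar> powr (p + m)"
        proof (cases "F (ln s) = 0")
          case False
          have "((F (ln s))\<^sup>2) ^ n = \<bar>F (ln s)\<bar> ^ (2 * n)" by (simp add: power_mult)
          also have "\<dots> = \<bar>F (ln s)\<bar> powr (p + m)" using False by (simp add: powr_realpow[symmetric] m_def)
          finally show ?thesis by (simp add: power_mult_distrib)
        qed (use n1 in auto)
        finally show ?thesis by (simp add: Q_def mult_ac)
      qed
      then show "ennreal (psi n (\<nu> * (F (ln s))\<^sup>2)) * indicator {N..} s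
          \<le> ennreal Q * (ennreal (\<bar>F (ln s)\<bar> powr (p + m)) * indicator {N..} s)"
        using Q by (auto simp: indicator_def ennreal_mult[symmetric] intro!: ennreal_leI)
    qed
    also have "\<dots> = ennreal Q * (\<integral>\<^sup>+ s. ennreal (\<bar>F (ln s)\<bar> powr (p + m)) * indicator {N..} s \<partial>radial_measure)"
      by (rule nn_integral_cmult) measurable
    also have "\<dots> \<le> ennreal Q * ennreal (D * N powr (- \<gamma>))"
      by (intro mult_left_mono D(3)[OF F N]) simp
    also have "\<dots> = ennreal (Q * D * N powr (- \<gamma>))"
      using Q D(1) by (subst ennreal_mult[symmetric]) (auto simp: mult.assoc)
    finally show ?thesis .
  qed
  have split: "radial_functional n \<nu> F
      = (\<integral>\<^sup>+ s. ennreal (psi n (\<nu> * (F (ln s))\<^sup>2)) * indicator {..<N} s \<partial>radial_measure)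
      + (\<integral>\<^sup>+ s. ennreal (psi n (\<nu> * (F (ln s))\<^sup>2)) * indicator {N..} s \<partial>radial_measure)" if "log_hoelder F" for F N
  proof -
    note [measurable] = log_hoelder_measurable[OF that]
    show ?thesis
      unfolding radial_functional_def
    proof (subst nn_integral_add[symmetric])
      show "(\<integral>\<^sup>+ s. ennreal (psi n (\<nu> * (F (ln s))\<^sup>2)) \<partial>radial_measure)
        = (\<integral>\<^sup>+ s. ennreal (psi n (\<nu> * (F (ln s))\<^sup>2)) * indicator {..<N} s
            + ennreal (psi n (\<nu> * (F (ln s))\<^sup>2)) * indicator {N..} s \<partial>radial_measure)"
        by (intro nn_integral_cong) (auto simp: indicator_def)
    qed measurable
  qed
  have inner: "AE s in radial_measure. ennreal (psi n (\<nu> * (F (ln s))\<^sup>2)) * indicator {..<N} s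
      \<le> ennreal (dominator K E \<kappa> s) * indicator {..<N} s" if F: "profile p C \<beta> F" for F N
    using AE_radial_measure_pos
  proof eventually_elim
    case (elim s)
    have "psi n (\<nu> * (F (ln s))\<^sup>2) \<le> dominator K E \<kappa> s"
      using \<nu> psi_le_exp[of "\<nu> * (F (ln s))\<^sup>2" n] dom(6)[OF F elim] by simp
    then show ?case by (intro mult_right_mono ennreal_leI) auto
  qed
  have domfin: "(\<integral>\<^sup>+ s. ennreal (dominator K E \<kappa> s) * indicator {..<N} s \<partial>radial_measure) < \<infinity>" for N
    using dom by (intro dominator_locally_integrable) auto
  show "\<exists>M<\<infinity>. \<forall>F. profile p C \<beta> F \<longrightarrow> radial_functional n \<nu> F \<le> M"
  proof (intro exI conjI allI impI)
    show "(\<integral>\<^sup>+ s. ennreal (dominator K E \<kappa> s) * indicator {..<1} s \<partial>radial_measure) + ennreal (Q * D * 1 powr (- \<gamma>)) < \<infinity>"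
      using domfin[of 1] by simp
    show "radial_functional n \<nu> F \<le> (\<integral>\<^sup>+ s. ennreal (dominator K E \<kappa> s) * indicator {..<1} s \<partial>radial_measure) + ennreal (Q * D * 1 powr (- \<gamma>))"
      if F: "profile p C \<beta> F" for F
      unfolding split[OF H[OF F], of 1] by (intro add_mono nn_integral_mono_AE inner F tail) auto
  qed
  fix Fn F S
  assume Fn: "\<And>k::nat. profile p C \<beta> (Fn k)" and lim: "\<And>\<tau>. (\<lambda>k. Fn k \<tau>) \<longlonglongrightarrow> F \<tau>"
    and S: "(\<lambda>k. radial_functional n \<nu> (Fn k)) \<longlonglongrightarrow> S"
  have HF: "log_hoelder F" using log_hoelder_limit[OF H[OF Fn] lim] .
  have le: "S \<le> radial_functional n \<nu> F + ennreal (Q * D * N powr (- \<gamma>))" if N: "1 \<le> N" for N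
  proof -
    have "(\<lambda>k. \<integral>\<^sup>+ s. ennreal (psi n (\<nu> * (Fn k (ln s))\<^sup>2)) * indicator {..<N} s \<partial>radial_measure)
        \<longlonglongrightarrow> (\<integral>\<^sup>+ s. ennreal (psi n (\<nu> * (F (ln s))\<^sup>2)) * indicator {..<N} s \<partial>radial_measure)"
    proof (rule nn_integral_dominated_convergence)
      show "(\<integral>\<^sup>+ s. ennreal (dominator K E \<kappa> s) * indicator {..<N} s \<partial>radial_measure) < \<infinity>" by (rule domfin)
      show "AE s in radial_measure. ennreal (psi n (\<nu> * (Fn k (ln s))\<^sup>2)) * indicator {..<N} s
          \<le> ennreal (dominator K E \<kappa> s) * indicator {..<N} s" for k by (rule inner[OF Fn])
      show "AE s in radial_measure. (\<lambda>k. ennreal (psi n (\<nu> * (Fn k (ln s))\<^sup>2)) * indicator {..<N} s)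
          \<longlonglongrightarrow> ennreal (psi n (\<nu> * (F (ln s))\<^sup>2)) * indicator {..<N} s"
      proof (rule AE_I2)
        fix s
        have "(\<lambda>k. ennreal (psi n (\<nu> * (Fn k (ln s))\<^sup>2))) \<longlonglongrightarrow> ennreal (psi n (\<nu> * (F (ln s))\<^sup>2))"
          by (intro tendsto_ennrealI tendsto_psi tendsto_mult tendsto_const tendsto_power lim)
        then show "(\<lambda>k. ennreal (psi n (\<nu> * (Fn k (ln s))\<^sup>2)) * indicator {..<N} s)
          \<longlonglongrightarrow> ennreal (psi n (\<nu> * (F (ln s))\<^sup>2)) * indicator {..<N} s"
          by (auto simp: indicator_def)
      qed
    qed (auto intro!: borel_measurable_times_ennreal meas H Fn HF)
    then have "(\<lambda>k. (\<integral>\<^sup>+ s. ennreal (psi n (\<nu> * (Fn k (ln s))\<^sup>2)) * indicator {..<N} s \<partial>radial_measure) + ennreal (Q * D * N powr (- \<gamma>)))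
        \<longlonglongrightarrow> (\<integral>\<^sup>+ s. ennreal (psi n (\<nu> * (F (ln s))\<^sup>2)) * indicator {..<N} s \<partial>radial_measure) + ennreal (Q * D * N powr (- \<gamma>))"
      by (intro tendsto_add tendsto_const)
    then have "S \<le> (\<integral>\<^sup>+ s. ennreal (psi n (\<nu> * (F (ln s))\<^sup>2)) * indicator {..<N} s \<partial>radial_measure) + ennreal (Q * D * N powr (- \<gamma>))"
    proof (rule LIMSEQ_le[OF S], intro exI allI impI)
      fix k
      show "radial_functional n \<nu> (Fn k) \<le> (\<integral>\<^sup>+ s. ennreal (psi n (\<nu> * (Fn k (ln s))\<^sup>2)) * indicator {..<N} s \<partial>radial_measure) + ennreal (Q * D * N powr (- \<gamma>))"
        unfolding split[OF H[OF Fn], of k N] by (intro add_left_mono tail Fn N)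
    qed
    also have "\<dots> \<le> radial_functional n \<nu> F + ennreal (Q * D * N powr (- \<gamma>))"
      unfolding split[OF HF, of N] by (intro add_right_mono) simp
    finally show ?thesis .
  qed
  have "filterlim (\<lambda>N. real N + 1) at_top sequentially"
    using filterlim_tendsto_add_at_top[OF tendsto_const[of "1::real"] filterlim_real_sequentially]
    by (simp add: add.commute)
  then have "(\<lambda>N. (real N + 1) powr (- \<gamma>)) \<longlonglongrightarrow> 0"
    using D(2) by (intro tendsto_neg_powr) auto
  then have "(\<lambda>N. radial_functional n \<nu> F + ennreal (Q * D * (real N + 1) powr (- \<gamma>))) \<longlonglongrightarrow> radial_functional n \<nu> F + ennreal (Q * D * 0)"
    by (intro tendsto_add tendsto_const tendsto_ennrealI tendsto_mult)
  then show "S \<le> radial_functional n \<nu> F"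
    by (intro LIMSEQ_le_const[of "\<lambda>N. radial_functional n \<nu> F + ennreal (Q * D * (real N + 1) powr (- \<gamma>))"])
       (use le in auto)
qed

section \<open>The norm and the unit ball\<close>

lemma ennreal_infinity_cases: obtains (top) "x = \<infinity>" | (real) r where "x = ennreal r" "0 \<le> r"
  by (cases x) auto

lemma epowr_ennreal: "0 \<le> r \<Longrightarrow> epowr (ennreal r) a = ennreal (r powr a)"
  and epowr_top [simp]: "epowr \<infinity> a = \<infinity>" "epowr top a = top"
  by (simp_all add: epowr_def)

lemma epowr_measurable [measurable]: "(\<lambda>x. epowr x a) \<in> borel_measurable borel"
  unfolding epowr_def by measurable

lemma epowr_epowr: "epowr (epowr x a) b = epowr x (a * b)"
  by (cases x rule: ennreal_infinity_cases) (simp_all add: epowr_ennreal powr_powr)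

lemma epowr_one: "epowr x 1 = x"
  by (cases x rule: ennreal_infinity_cases) (simp_all add: epowr_ennreal)

lemma epowr_mono: "0 < a \<Longrightarrow> x \<le> y \<Longrightarrow> epowr x a \<le> epowr y a"
  by (cases x rule: ennreal_infinity_cases; cases y rule: ennreal_infinity_cases)
     (auto simp: epowr_ennreal top_unique intro!: ennreal_leI powr_mono2)

lemma epowr_strict_mono: "0 < a \<Longrightarrow> x < y \<Longrightarrow> epowr x a < epowr y a"
  by (cases x rule: ennreal_infinity_cases; cases y rule: ennreal_infinity_cases)
     (auto simp: epowr_ennreal ennreal_less_iff intro!: powr_less_mono2)

lemma epowr_le_one_iff: "0 < a \<Longrightarrow> epowr x a \<le> 1 \<longleftrightarrow> x \<le> 1"
  using epowr_mono[of a x 1] epowr_strict_mono[of a 1 x] epowr_ennreal[of 1 a]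
  by (auto simp: not_le[symmetric])

lemma epowr_less_top_iff: "epowr x a < top \<longleftrightarrow> x < top"
  by (cases x rule: ennreal_infinity_cases) (simp_all add: epowr_ennreal)

lemma epowr_mult: "0 < c \<Longrightarrow> epowr (ennreal c * x) a = ennreal (c powr a) * epowr x a"
  by (cases x rule: ennreal_infinity_cases)
     (simp_all add: epowr_ennreal ennreal_mult[symmetric] powr_mult ennreal_mult_top)

lemma epowr_liminf:
  assumes "0 < a"
  shows "epowr (liminf x) a \<le> liminf (\<lambda>k. epowr (x k) a)"
  unfolding le_Liminf_iff
proof (intro allI impI)
  fix y assume "y < epowr (liminf x) a"
  then have "epowr y (1 / a) < epowr (epowr (liminf x) a) (1 / a)"
    using assms by (intro epowr_strict_mono) auto
  then have "epowr y (1 / a) < liminf x" using assms by (simp add: epowr_epowr epowr_one)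
  then have "eventually (\<lambda>k. epowr y (1 / a) < x k) sequentially" by (rule less_LiminfD)
  then show "eventually (\<lambda>k. y < epowr (x k) a) sequentially"
  proof eventually_elim
    case (elim k)
    then have "epowr (epowr y (1 / a)) a < epowr (x k) a" using assms by (intro epowr_strict_mono)
    then show ?case using assms by (simp add: epowr_epowr epowr_one)
  qed
qed

text \<open>
  The power \<open>pq\<close> of the weighted norm.
\<close>

definition growth_energy :: "real \<Rightarrow> real \<Rightarrow> real \<Rightarrow> (real^2 \<Rightarrow> real) \<Rightarrow> ennreal" where
  "growth_energy p q b u = (\<integral>\<^sup>+ \<rho> \<in> {0<..}. ennreal (\<rho> powr (- b)) * epowr (h_fun p u \<rho>) q \<partial>lebesgue)"

lemma E_norm_eq:
  assumes "0 < p * q" "has_weak_gradient u G"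
  shows "E_norm p q b u = epowr (epowr (sq_integral G) (p * q)
    + epowr (growth_energy p q b u) 2) (1 / (2 * p * q))"
proof -
  have "p \<noteq> 0" "q \<noteq> 0" using assms(1) by auto
  then show ?thesis
    unfolding E_norm_def grad_norm_eq[OF assms(2)] Lpqb_norm_def growth_energy_def[symmetric]
    by (simp add: epowr_epowr)
qed

lemma in_U_ball_iff:
  assumes pq: "0 < p * q"
  shows "u \<in> U_ball p q b \<longleftrightarrow> radially_symmetric u \<and> (\<exists>G. has_weak_gradient u G \<and>
    epowr (sq_integral G) (p * q) + epowr (growth_energy p q b u) 2 \<le> 1)"
proof -
  have pos: "0 < 1 / (2 * p * q)" using pq by (simp add: mult.assoc)
  have E: "E_norm p q b u \<le> 1 \<longleftrightarrow>
      epowr (sq_integral G) (p * q) + epowr (growth_energy p q b u) 2 \<le> 1"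
    if "has_weak_gradient u G" for G
    unfolding E_norm_eq[OF pq that] by (rule epowr_le_one_iff[OF pos])
  have fin: "grad_norm u + Lpqb_norm p q b u < \<infinity>"
    if G: "has_weak_gradient u G"
      and le: "epowr (sq_integral G) (p * q) + epowr (growth_energy p q b u) 2 \<le> 1" for G
  proof -
    have "epowr (sq_integral G) (p * q) + epowr (growth_energy p q b u) 2 < \<infinity>"
      using le by (rule order_le_less_trans) simp
    then have "epowr (sq_integral G) (p * q) < \<infinity>" "epowr (growth_energy p q b u) 2 < \<infinity>"
      by (simp_all add: ennreal_add_less_top)
    then show ?thesis
      unfolding grad_norm_eq[OF G] Lpqb_norm_def growth_energy_def[symmetric]
      by (simp only: epowr_less_top_iff infinity_ennreal_def ennreal_add_less_top simp_thms)
  qed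
  show ?thesis
  proof
    assume "u \<in> U_ball p q b"
    then have u: "radially_symmetric u" "weakly_differentiable u" "E_norm p q b u \<le> 1"
      by (auto simp: U_ball_def E_rad_def E_space_def)
    then obtain G where "has_weak_gradient u G" by (auto simp: weakly_differentiable_def)
    with u E show "radially_symmetric u \<and> (\<exists>G. has_weak_gradient u G \<and>
      epowr (sq_integral G) (p * q) + epowr (growth_energy p q b u) 2 \<le> 1)" by blast
  next
    assume "radially_symmetric u \<and> (\<exists>G. has_weak_gradient u G \<and>
      epowr (sq_integral G) (p * q) + epowr (growth_energy p q b u) 2 \<le> 1)"
    then obtain G where r: "radially_symmetric u" and G: "has_weak_gradient u G"
      and le: "epowr (sq_integral G) (p * q) + epowr (growth_energy p q b u) 2 \<le> 1" by blast
    show "u \<in> U_ball p q b"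
      using r fin[OF G le] E[OF G] le G
      by (auto simp: U_ball_def E_rad_def E_space_def weakly_differentiable_def)
  qed
qed

lemma h_fun_mono: "\<rho> \<le> \<sigma> \<Longrightarrow> h_fun p u \<rho> \<le> h_fun p u \<sigma>"
  unfolding h_fun_def by (intro nn_integral_mono) (auto simp: indicator_def)

text \<open>
  Since \<open>h_fun\<close> increases, the integral over \<open>[\<rho>, 2 \<rho>]\<close> alone already controls \<open>h_fun p u \<rho>\<close>.
\<close>

lemma h_fun_bound:
  assumes q: "0 < q" and L: "growth_energy p q b u \<le> 1" and \<rho>: "0 < \<rho>" and b: "0 < b"
  shows "h_fun p u \<rho> \<le> ennreal (2 powr (b / q) * \<rho> powr ((b - 1) / q))"
proof -
  define X where "X = epowr (h_fun p u \<rho>) q"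
  define c where "c = (2 * \<rho>) powr (- b) * \<rho>"
  have c: "0 < c" using \<rho> by (simp add: c_def)
  have "ennreal c * X = ennreal ((2 * \<rho>) powr (- b)) * X * emeasure lborel {\<rho>..2 * \<rho>}"
    using \<rho> by (simp add: c_def ennreal_mult mult_ac)
  also have "\<dots> = (\<integral>\<^sup>+ r. ennreal ((2 * \<rho>) powr (- b)) * X * indicator {\<rho>..2 * \<rho>} r \<partial>lebesgue)"
    by (subst nn_integral_cmult_indicator) auto
  also have "\<dots> \<le> growth_energy p q b u"
    unfolding growth_energy_def
  proof (rule nn_integral_mono)
    fix r
    show "ennreal ((2 * \<rho>) powr (- b)) * X * indicator {\<rho>..2 * \<rho>} r
      \<le> ennreal (r powr (- b)) * epowr (h_fun p u r) q * indicator {0<..} r"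
    proof (cases "r \<in> {\<rho>..2 * \<rho>}")
      case True
      then have "(2 * \<rho>) powr (- b) \<le> r powr (- b)" using \<rho> b by (intro powr_mono2') auto
      moreover have "X \<le> epowr (h_fun p u r) q"
        unfolding X_def using True q by (intro epowr_mono h_fun_mono) auto
      ultimately show ?thesis using True \<rho> by (auto intro!: mult_mono ennreal_leI)
    qed simp
  qed
  finally have "ennreal c * X \<le> 1" using L by (rule order_trans)
  then have "ennreal (1 / c) * (ennreal c * X) \<le> ennreal (1 / c) * 1" by (intro mult_left_mono) auto
  then have "X \<le> ennreal (1 / c)" using c by (simp add: mult.assoc[symmetric] ennreal_mult[symmetric])
  then have "epowr X (1 / q) \<le> epowr (ennreal (1 / c)) (1 / q)" using q by (intro epowr_mono) auto
  also have "epowr X (1 / q) = h_fun p u \<rho>" using q by (simp add: X_def epowr_epowr epowr_one)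
  also have "epowr (ennreal (1 / c)) (1 / q) = ennreal (2 powr (b / q) * \<rho> powr ((b - 1) / q))"
  proof -
    have "1 / c = 2 powr b * \<rho> powr (b - 1)"
      using \<rho> by (simp add: c_def powr_mult powr_minus powr_diff field_simps)
    then show ?thesis using c \<rho> by (subst epowr_ennreal) (auto simp: powr_mult powr_powr)
  qed
  finally show ?thesis .
qed

lemma U_ball_profile:
  assumes p: "1 < p" and q: "1 \<le> q" and b: "1 < b" and u: "u \<in> U_ball p q b"
  obtains F G where "profile p (2 powr (b / q)) ((b - 1) / (2 * q)) F"
    "has_profile u F" "has_weak_gradient u G"
    "sq_integral G \<le> 1" "growth_energy p q b u \<le> 1"
    "epowr (sq_integral G) (p * q) + epowr (growth_energy p q b u) 2 \<le> 1"
    "\<And>\<rho>. h_fun p u \<rho> < \<infinity>"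
proof -
  have pq: "0 < p * q" using p q by simp
  obtain G where r: "radially_symmetric u" and G: "has_weak_gradient u G"
    and le: "epowr (sq_integral G) (p * q) + epowr (growth_energy p q b u) 2 \<le> 1"
    using u unfolding in_U_ball_iff[OF pq] by blast
  have "epowr (sq_integral G) (p * q) \<le> 1"
    using le by (rule order_trans[rotated]) simp
  then have G1: "sq_integral G \<le> 1" by (simp add: epowr_le_one_iff[OF pq])
  have "epowr (growth_energy p q b u) 2 \<le> 1" using le by (rule order_trans[rotated]) simp
  then have L1: "growth_energy p q b u \<le> 1" by (simp add: epowr_le_one_iff)
  obtain F where F: "\<And>\<sigma> \<tau>. (F \<sigma> - F \<tau>)\<^sup>2 \<le> \<bar>\<sigma> - \<tau>\<bar> / (4 * pi)"
    "has_profile u F"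
    by (rule radial_representative[OF G G1 r]) (rule that)
  have H: "log_hoelder F" using F(1) by (simp add: log_hoelder_def)
  note [measurable] = log_hoelder_measurable[OF H]
  have hb: "h_fun p u \<rho> \<le> ennreal (2 powr (b / q) * \<rho> powr ((b - 1) / q))" if "0 < \<rho>" for \<rho>
    using that q b by (intro h_fun_bound L1) auto
  have "(\<integral>\<^sup>+ s. ennreal (\<bar>F (ln s)\<bar> powr p) * indicator {..<R} s \<partial>radial_measure)
      \<le> ennreal (2 powr (b / q) * R powr ((b - 1) / (2 * q)))" if R: "1 \<le> R" for R
  proof -
    have "(\<integral>\<^sup>+ s. ennreal (\<bar>F (ln s)\<bar> powr p) * indicator {..<R} s \<partial>radial_measure)
        = (\<integral>\<^sup>+ x. ennreal (\<bar>F (ln ((norm (x::real^2))\<^sup>2))\<bar> powr p) * indicator {..<R} ((norm x)\<^sup>2) \<partial>lebesgue)"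
      by (rule nn_integral_norm_sq[symmetric]) measurable
    also have "\<dots> = h_fun p u (sqrt R)"
      unfolding h_fun_def
    proof (rule nn_integral_cong_AE)
      show "AE x in lebesgue. ennreal (\<bar>F (ln ((norm x)\<^sup>2))\<bar> powr p) * indicator {..<R} ((norm x)\<^sup>2)
          = ennreal (\<bar>u x\<bar> powr p) * indicator (ball 0 (sqrt R)) x"
        using F(2)
      proof eventually_elim
        case (elim x)
        have "(norm x)\<^sup>2 < R \<longleftrightarrow> norm x < sqrt R"
          using R by (metis norm_ge_zero real_less_rsqrt real_sqrt_less_iff real_sqrt_unique)
        then show ?case using elim by (auto simp: indicator_def)
      qed
    qed
    also have "\<dots> \<le> ennreal (2 powr (b / q) * sqrt R powr ((b - 1) / q))" using R by (intro hb) auto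
    also have "sqrt R powr ((b - 1) / q) = R powr ((b - 1) / (2 * q))"
      using R by (simp add: powr_half_sqrt[symmetric] powr_powr)
    finally show ?thesis .
  qed
  then have "profile p (2 powr (b / q)) ((b - 1) / (2 * q)) F" using H by (simp add: profile_def)
  moreover have "h_fun p u \<rho> < \<infinity>" for \<rho>
  proof -
    have "h_fun p u \<rho> \<le> h_fun p u (max \<rho> 1)" by (rule h_fun_mono) simp
    also have "\<dots> < \<infinity>" by (rule order_le_less_trans[OF hb]) auto
    finally show ?thesis .
  qed
  ultimately show ?thesis using that[OF _ F(2) G G1 L1 le] by blast
qed

lemma Psi_eq_radial_functional:
  assumes H: "log_hoelder F" and u: "has_profile u F"
  shows "Psi p q b \<nu> u = radial_functional (n_min p q b) \<nu> F"
proof -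
  note [measurable] = log_hoelder_measurable[OF H]
  have "Psi p q b \<nu> u = (\<integral>\<^sup>+ x. ennreal (psi (n_min p q b) (\<nu> * (F (ln ((norm (x::real^2))\<^sup>2)))\<^sup>2)) \<partial>lebesgue)"
    unfolding Psi_def using u by (intro nn_integral_cong_AE) (auto elim: eventually_mono)
  also have "\<dots> = radial_functional (n_min p q b) \<nu> F"
    unfolding radial_functional_def by (rule nn_integral_norm_sq) measurable
  finally show ?thesis .
qed

lemma h_fun_measurable:
  assumes "\<And>\<rho>. h_fun p u \<rho> < \<infinity>"
  shows "(\<lambda>\<rho>. ennreal (\<rho> powr (- b)) * epowr (h_fun p u \<rho>) q) \<in> borel_measurable lebesgue"
proof (rule measurable_completion)
  have "mono (\<lambda>\<rho>. enn2real (h_fun p u \<rho>))"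
    using assms h_fun_mono by (auto intro!: monoI enn2real_mono)
  then have [measurable]: "(\<lambda>\<rho>. enn2real (h_fun p u \<rho>)) \<in> borel_measurable borel" by (rule borel_measurable_mono)
  have "h_fun p u \<rho> = ennreal (enn2real (h_fun p u \<rho>))" for \<rho>
    using assms[of \<rho>] by simp
  then have "(\<lambda>\<rho>. h_fun p u \<rho>) = (\<lambda>\<rho>. ennreal (enn2real (h_fun p u \<rho>)))" by auto
  also have "\<dots> \<in> borel_measurable borel" by measurable
  finally have [measurable]: "(\<lambda>\<rho>. h_fun p u \<rho>) \<in> borel_measurable borel" .
  show "(\<lambda>\<rho>. ennreal (\<rho> powr (- b)) * epowr (h_fun p u \<rho>) q) \<in> borel_measurable lborel" by measurable
qed

lemma growth_energy_liminf:
  fixes u :: "nat \<Rightarrow> real^2 \<Rightarrow> real"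
  assumes um: "\<And>k. u k \<in> borel_measurable lebesgue"
    and lim: "AE x in lebesgue. (\<lambda>k. u k x) \<longlonglongrightarrow> v x"
    and p: "0 < p" and q: "0 < q" and fin: "\<And>k \<rho>. h_fun p (u k) \<rho> < \<infinity>"
  shows "growth_energy p q b v \<le> liminf (\<lambda>k. growth_energy p q b (u k))"
proof -
  note [measurable] = um
  have h: "h_fun p v \<rho> \<le> liminf (\<lambda>k. h_fun p (u k) \<rho>)" for \<rho>
  proof -
    have [measurable]: "ball 0 \<rho> \<in> sets (lebesgue :: (real^2) measure)" by simp
    have "h_fun p v \<rho> = (\<integral>\<^sup>+ y. liminf (\<lambda>k. ennreal (\<bar>u k y\<bar> powr p) * indicator (ball 0 \<rho>) y) \<partial>lebesgue)"
      unfolding h_fun_def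
    proof (rule nn_integral_cong_AE)
      show "AE y in lebesgue. ennreal (\<bar>v y\<bar> powr p) * indicator (ball 0 \<rho>) y
          = liminf (\<lambda>k. ennreal (\<bar>u k y\<bar> powr p) * indicator (ball 0 \<rho>) y)"
        using lim
      proof eventually_elim
        case (elim y)
        have "(\<lambda>k. \<bar>u k y\<bar> powr p) \<longlonglongrightarrow> \<bar>v y\<bar> powr p"
          using elim p by (intro tendsto_powr') (auto intro: tendsto_rabs)
        then have "(\<lambda>k. ennreal (\<bar>u k y\<bar> powr p) * indicator (ball 0 \<rho>) y) \<longlonglongrightarrow> ennreal (\<bar>v y\<bar> powr p) * indicator (ball 0 \<rho>) y"
          by (auto simp: indicator_def intro: tendsto_ennrealI)
        then show ?case by (rule lim_imp_Liminf[OF trivial_limit_sequentially, symmetric])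
      qed
    qed
    also have "\<dots> \<le> liminf (\<lambda>k. h_fun p (u k) \<rho>)"
      unfolding h_fun_def by (rule nn_integral_liminf) measurable
    finally show ?thesis .
  qed
  have "growth_energy p q b v \<le> (\<integral>\<^sup>+ \<rho>. liminf (\<lambda>k. ennreal (\<rho> powr (- b)) * epowr (h_fun p (u k) \<rho>) q * indicator {0<..} \<rho>) \<partial>lebesgue)"
    unfolding growth_energy_def
  proof (rule nn_integral_mono)
    fix \<rho> :: real
    show "ennreal (\<rho> powr (- b)) * epowr (h_fun p v \<rho>) q * indicator {0<..} \<rho>
      \<le> liminf (\<lambda>k. ennreal (\<rho> powr (- b)) * epowr (h_fun p (u k) \<rho>) q * indicator {0<..} \<rho>)"
    proof (cases "\<rho> > 0")
      case True
      have "epowr (h_fun p v \<rho>) q \<le> epowr (liminf (\<lambda>k. h_fun p (u k) \<rho>)) q"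
        by (intro epowr_mono q h)
      also have "\<dots> \<le> liminf (\<lambda>k. epowr (h_fun p (u k) \<rho>) q)" by (rule epowr_liminf[OF q])
      finally have "ennreal (\<rho> powr (- b)) * epowr (h_fun p v \<rho>) q
          \<le> ennreal (\<rho> powr (- b)) * liminf (\<lambda>k. epowr (h_fun p (u k) \<rho>) q)"
        by (intro mult_left_mono) auto
      also have "\<dots> = liminf (\<lambda>k. ennreal (\<rho> powr (- b)) * epowr (h_fun p (u k) \<rho>) q)"
        by (rule Liminf_compose_continuous_mono[symmetric, of "\<lambda>y. ennreal (\<rho> powr (- b)) * y"])
           (auto intro!: ennreal_continuous_on_cmult continuous_on_id monoI mult_left_mono)
      finally show ?thesis using True by simp
    qed simp
  qed
  also have "\<dots> \<le> liminf (\<lambda>k. growth_energy p q b (u k))"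
    unfolding growth_energy_def
    by (rule nn_integral_liminf) (intro borel_measurable_times_ennreal h_fun_measurable fin borel_measurable_indicator, simp)
  finally show ?thesis .
qed

lemma profile_limit_locally_integrable:
  assumes p: "1 < p" and C: "0 < C" and \<beta>: "0 < \<beta>" "\<beta> < 1"
    and Fn: "\<And>k::nat. profile p C \<beta> (Fn k)" and lim: "\<And>\<tau>. (\<lambda>k. Fn k \<tau>) \<longlonglongrightarrow> F \<tau>"
    and u: "\<And>k. AE x in lebesgue. u k x = Fn k (ln ((norm (x::real^2))\<^sup>2))"
    and um: "\<And>k. u k \<in> borel_measurable lebesgue"
  shows "locally_integrable (\<lambda>x::real^2. F (ln ((norm x)\<^sup>2)))" (is ?A)
    and "test_function \<phi> \<Longrightarrow> (\<lambda>k. LINT x|lebesgue. u k x * partial_deriv i \<phi> x)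
      \<longlonglongrightarrow> (LINT x|lebesgue. F (ln ((norm x)\<^sup>2)) * partial_deriv i \<phi> x)" (is "_ \<Longrightarrow> ?B")
proof -
  obtain K E \<kappa> where dom: "0 < K" "0 < E" "\<kappa> < 1"
    "\<And>F s. profile p C \<beta> F \<Longrightarrow> 0 < s \<Longrightarrow> \<bar>F (ln s)\<bar> \<le> dominator K E \<kappa> s"
    by (rule profile_dominated[OF p C \<beta> zero_less_one]) (use pi_ge_two in linarith, rule that)
  have HF: "log_hoelder F" using log_hoelder_limit[OF _ lim] Fn by (simp add: profile_def)
  note [measurable] = log_hoelder_measurable[OF HF]
  have F0: "\<bar>F (ln s)\<bar> \<le> dominator K E \<kappa> s" if "0 < s" for s
    by (rule LIMSEQ_le_const2[OF tendsto_rabs[OF lim]]) (use dom(4)[OF Fn that] in auto)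
  have dn: "0 \<le> dominator K E \<kappa> s" for s using dom by (intro dominator_nonneg) auto
  define W where "W R x = dominator K E \<kappa> ((norm x)\<^sup>2) * indicator {..<R} ((norm x)\<^sup>2)" for R and x :: "real^2"
  have Wi: "integrable lebesgue (W R)" for R
  proof -
    have m: "W R \<in> borel_measurable lebesgue" unfolding W_def by (intro measurable_completion) measurable
    have "(\<integral>\<^sup>+ x. ennreal (norm (W R x)) \<partial>lebesgue)
        = (\<integral>\<^sup>+ x. ennreal (dominator K E \<kappa> ((norm (x::real^2))\<^sup>2)) * indicator {..<R} ((norm x)\<^sup>2) \<partial>lebesgue)"
      by (intro nn_integral_cong) (auto simp: W_def indicator_def dn)
    also have "\<dots> = (\<integral>\<^sup>+ s. ennreal (dominator K E \<kappa> s) * indicator {..<R} s \<partial>radial_measure)"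
      by (rule nn_integral_norm_sq) measurable
    also have "\<dots> < \<infinity>" using dom by (intro dominator_locally_integrable) auto
    finally show ?thesis using m by (simp add: integrable_iff_bounded)
  qed
  have pos: "AE x in lebesgue. 0 < (norm (x::real^2))\<^sup>2" by (rule AE_radial) simp
  have Fm: "(\<lambda>x::real^2. F (ln ((norm x)\<^sup>2))) \<in> borel_measurable lebesgue"
    by (intro measurable_completion) measurable
  show ?A
    unfolding locally_integrable_def
  proof (intro allI impI)
    fix S :: "(real^2) set" assume S: "compact S"
    then obtain R where R: "0 < R" "S \<subseteq> ball 0 R" using bounded_subset_ballD[OF compact_imp_bounded[OF S], of 0] by blast
    show "set_integrable lebesgue S (\<lambda>x. F (ln ((norm x)\<^sup>2)))"
      unfolding set_integrable_def
    proof (rule Bochner_Integration.integrable_bound[OF Wi[of "R\<^sup>2"]])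
      show "(\<lambda>x. indicat_real S x *\<^sub>R F (ln ((norm x)\<^sup>2))) \<in> borel_measurable lebesgue"
        using lmeasurable_compact[OF S] by (intro borel_measurable_scaleR borel_measurable_indicator Fm) auto
      show "AE x in lebesgue. norm (indicat_real S x *\<^sub>R F (ln ((norm x)\<^sup>2))) \<le> norm (W (R\<^sup>2) x)"
        using pos
      proof eventually_elim
        case (elim x)
        have "(norm x)\<^sup>2 < R\<^sup>2" if "x \<in> S" using that R by (intro power_strict_mono) auto
        then show ?case using F0[OF elim] dn[of "(norm x)\<^sup>2"] by (auto simp: W_def indicator_def)
      qed
    qed
  qed
  assume t: "test_function \<phi>"
  obtain R M where *: "M > 0" "\<And>i. continuous_on UNIV (partial_deriv i \<phi>)"
    "\<And>x i. norm x > R \<Longrightarrow> partial_deriv i \<phi> x = 0" "\<And>x i. \<bar>partial_deriv i \<phi> x\<bar> \<le> M" "R > 0"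
    by (rule test_functionE[OF t]) (rule that)
  have pm: "partial_deriv i \<phi> \<in> borel_measurable lebesgue" by (rule continuous_lebesgue_measurable[OF *(2)])
  show ?B
  proof (rule integral_dominated_convergence)
    show "integrable lebesgue (\<lambda>x. M * W (R\<^sup>2 + 1) x)" by (intro integrable_mult_right Wi)
    have allu: "AE x in lebesgue. \<forall>k. u k x = Fn k (ln ((norm x)\<^sup>2))" using u by (simp add: AE_all_countable)
    show "AE x in lebesgue. (\<lambda>k. u k x * partial_deriv i \<phi> x) \<longlonglongrightarrow> F (ln ((norm x)\<^sup>2)) * partial_deriv i \<phi> x"
      using allu
    proof eventually_elim
      case (elim x)
      show ?case unfolding elim[rule_format] by (intro tendsto_mult tendsto_const lim)
    qed
    show "AE x in lebesgue. norm (u k x * partial_deriv i \<phi> x) \<le> M * W (R\<^sup>2 + 1) x" for k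
      using u[of k] pos
    proof eventually_elim
      case (elim x)
      show ?case
      proof (cases "norm x > R")
        case False
        then have "(norm x)\<^sup>2 \<le> R\<^sup>2" by (intro power_mono) auto
        then have W: "W (R\<^sup>2 + 1) x = dominator K E \<kappa> ((norm x)\<^sup>2)" by (simp add: W_def)
        have "\<bar>u k x\<bar> * \<bar>partial_deriv i \<phi> x\<bar> \<le> dominator K E \<kappa> ((norm x)\<^sup>2) * M"
          using dom(4)[OF Fn elim(2), of k] *(4) dn unfolding elim(1) by (intro mult_mono) auto
        then show ?thesis unfolding W by (simp add: abs_mult mult.commute)
      next
        case True
        then show ?thesis using *(1) *(3) dn by (simp add: W_def)
      qed
    qed
  qed (intro borel_measurable_times um pm Fm)+
qed

section \<open>Classical gradients and scaling\<close>

text \<open>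
  The difference quotients in the coordinate direction have integral zero by translation invariance, and
  they converge boundedly.
\<close>

lemma integral_partial_derivative_zero:
  fixes f :: "real^'n \<Rightarrow> real"
  assumes D: "\<And>x. (f has_derivative D x) (at x)"
    and cd: "continuous_on UNIV (\<lambda>x. D x (axis i 1))"
    and supp: "\<And>x. norm x > R \<Longrightarrow> f x = 0" and M: "\<And>x. \<bar>D x (axis i 1)\<bar> \<le> M" and R: "R > 0"
  shows "(LINT x|lebesgue. D x (axis i 1)) = 0"
proof -
  define e :: "real^'n" where "e = axis i 1"
  have ne: "norm e = 1" by (simp add: e_def)
  have cf: "continuous_on UNIV f"
    by (intro continuous_at_imp_continuous_on ballI has_derivative_continuous[OF D])
  have fm [measurable]: "f \<in> borel_measurable borel" by (rule borel_measurable_continuous_onI[OF cf])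
  have M0: "0 \<le> M" using M[of 0] by linarith
  have fi: "integrable lebesgue f"
  proof -
    have "set_integrable lebesgue (cball 0 R) f"
      using continuous_locally_integrable[OF cf] by (auto simp: locally_integrable_def)
    then have "integrable lebesgue (\<lambda>x. indicator (cball 0 R) x *\<^sub>R f x)" by (simp add: set_integrable_def)
    moreover have "(\<lambda>x. indicator (cball 0 R) x *\<^sub>R f x) = f" using supp by (auto simp: indicator_def fun_eq_iff not_le)
    ultimately show ?thesis by simp
  qed
  then have fib: "integrable lborel f" by (simp add: integrable_completion)
  have shift: "integrable lborel (\<lambda>x. f (c + x))" "(LINT x|lborel. f (c + x)) = (LINT x|lborel. f x)" for c
  proof -
    have d: "distr lborel borel ((+) c) = (lborel :: (real^'n) measure)" by (rule lborel_distr_plus)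
    have "integrable (distr lborel borel ((+) c)) f" unfolding d by (rule fib)
    then show "integrable lborel (\<lambda>x. f (c + x))" by (subst (asm) integrable_distr_eq) auto
    have "(LINT x|distr lborel borel ((+) c). f x) = (LINT x|lborel. f (c + x))" by (subst integral_distr) auto
    then show "(LINT x|lborel. f (c + x)) = (LINT x|lborel. f x)" unfolding d by simp
  qed
  define h where "h n = 1 / (real n + 1)" for n :: nat
  have h: "0 < h n" "h n \<le> 1" for n by (auto simp: h_def)
  define g where "g n x = (f (h n *\<^sub>R e + x) - f x) / h n" for n x
  have g0: "(LINT x|lborel. g n x) = 0" for n
    unfolding g_def using shift fib by simp
  have line: "((\<lambda>t. f (x + t *\<^sub>R e)) has_real_derivative D (x + t *\<^sub>R e) e) (at t)" for x t
  proof -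
    have "((\<lambda>t. x + t *\<^sub>R e) has_derivative (\<lambda>t. t *\<^sub>R e)) (at t)" by (auto intro!: derivative_eq_intros)
    from has_derivative_compose[OF this D]
    have "((\<lambda>t. f (x + t *\<^sub>R e)) has_derivative (\<lambda>s. D (x + t *\<^sub>R e) (s *\<^sub>R e))) (at t)" .
    moreover have "D (x + t *\<^sub>R e) (s *\<^sub>R e) = D (x + t *\<^sub>R e) e * s" for s
      using linear_scale[OF has_derivative_linear[OF D]] by simp
    ultimately show ?thesis by (simp add: has_field_derivative_def)
  qed
  have hlim: "filterlim h (at 0) sequentially"
    unfolding filterlim_at using LIMSEQ_const_over_Suc[of 1] h by (auto simp: h_def[abs_def])
  have "(\<lambda>n. LINT x|lborel. g n x) \<longlonglongrightarrow> (LINT x|lborel. D x e)"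
  proof (rule integral_dominated_convergence)
    show "integrable lborel (\<lambda>x::real^'n. M * indicator (cball 0 (R + 1)) x)"
      by (intro integrable_mult_right integrable_real_indicator) (auto simp: emeasure_lborel_cball_finite[unfolded infinity_ennreal_def])
    show "AE x in lborel. (\<lambda>n. g n x) \<longlonglongrightarrow> D x e"
    proof (rule AE_I2)
      fix x
      have "((\<lambda>k. (f (x + k *\<^sub>R e) - f x) / k) \<longlongrightarrow> D x e) (at 0)"
        using line[of x 0] by (simp add: DERIV_def)
      from filterlim_compose[OF this hlim] show "(\<lambda>n. g n x) \<longlonglongrightarrow> D x e"
        by (simp add: g_def add.commute)
    qed
    show "AE x in lborel. norm (g n x) \<le> M * indicator (cball 0 (R + 1)) x" for n
    proof (rule AE_I2)
      fix x
      show "norm (g n x) \<le> M * indicator (cball 0 (R + 1)) x"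
      proof (cases "norm x \<le> R + 1")
        case True
        have "\<exists>z>0. z < h n \<and> f (x + h n *\<^sub>R e) - f (x + 0 *\<^sub>R e) = (h n - 0) * D (x + z *\<^sub>R e) e"
          using line by (intro MVT2 h(1)) auto
        then obtain z where "f (x + h n *\<^sub>R e) - f x = h n * D (x + z *\<^sub>R e) e" by auto
        then have "g n x = D (x + z *\<^sub>R e) e" using h(1)[of n] by (simp add: g_def add.commute)
        then show ?thesis using M[of "x + z *\<^sub>R e"] True by (simp add: e_def)
      next
        case False
        have "norm x \<le> norm (h n *\<^sub>R e + x) + norm (h n *\<^sub>R e)"
          using norm_triangle_ineq4[of "h n *\<^sub>R e + x" "h n *\<^sub>R e"] by simp
        then have "norm (h n *\<^sub>R e + x) > R" using False h[of n] ne by simp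
        then have "g n x = 0" using supp False by (simp add: g_def)
        then show ?thesis using M0 by (simp add: indicator_def)
      qed
    qed
    show "(\<lambda>x. D x e) \<in> borel_measurable lborel"
      using borel_measurable_continuous_onI[OF cd] by (simp add: e_def)
    show "g n \<in> borel_measurable lborel" for n unfolding g_def by measurable
  qed
  then have "(LINT x|lborel. D x e) = 0" unfolding g0 by (simp add: LIMSEQ_const_iff)
  moreover have "(LINT x|lebesgue. D x (axis i 1)) = (LINT x|lborel. D x (axis i 1))"
    using borel_measurable_continuous_onI[OF cd] by (intro integral_completion) simp
  ultimately show ?thesis by (simp add: e_def)
qed

lemma test_function_has_weak_gradient:
  fixes \<psi> :: "real^'n \<Rightarrow> real"
  assumes t: "test_function \<psi>"
  shows "has_weak_gradient \<psi> (\<lambda>x. \<chi> i. partial_deriv i \<psi> x)"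
    and "(\<integral>\<^sup>+ x. ennreal ((norm (\<chi> i. partial_deriv i \<psi> x))\<^sup>2) \<partial>lebesgue) < \<infinity>"
proof -
  obtain R M where 1: "R > 0" "M > 0"
    "\<And>x. (\<psi> has_derivative frechet_derivative \<psi> (at x)) (at x)"
    "continuous_on UNIV \<psi>" "\<And>i. continuous_on UNIV (partial_deriv i \<psi>)"
    "\<And>x. norm x > R \<Longrightarrow> \<psi> x = 0" "\<And>x i. norm x > R \<Longrightarrow> partial_deriv i \<psi> x = 0"
    "\<And>x. \<bar>\<psi> x\<bar> \<le> M" "\<And>x i. \<bar>partial_deriv i \<psi> x\<bar> \<le> M"
    by (rule test_functionE[OF t]) (rule that)
  have cg: "continuous_on UNIV (\<lambda>x. \<chi> i. partial_deriv i \<psi> x)"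
    by (intro continuous_on_vec_lambda 1(5))
  show "has_weak_gradient \<psi> (\<lambda>x. \<chi> i. partial_deriv i \<psi> x)"
    unfolding has_weak_gradient_def
  proof (intro conjI allI impI)
    show "locally_integrable \<psi>" "locally_integrable (\<lambda>x. \<chi> i. partial_deriv i \<psi> x)"
      by (intro continuous_locally_integrable 1(4) cg)+
    fix \<phi> :: "real^'n \<Rightarrow> real" and i assume t2: "test_function \<phi>"
    obtain R' M' where 2: "R' > 0" "M' > 0"
      "\<And>x. (\<phi> has_derivative frechet_derivative \<phi> (at x)) (at x)"
      "continuous_on UNIV \<phi>" "\<And>i. continuous_on UNIV (partial_deriv i \<phi>)"
      "\<And>x. norm x > R' \<Longrightarrow> \<phi> x = 0" "\<And>x i. norm x > R' \<Longrightarrow> partial_deriv i \<phi> x = 0"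
      "\<And>x. \<bar>\<phi> x\<bar> \<le> M'" "\<And>x i. \<bar>partial_deriv i \<phi> x\<bar> \<le> M'"
      by (rule test_functionE[OF t2]) (rule that)
    define D where "D x h = \<psi> x * frechet_derivative \<phi> (at x) h + frechet_derivative \<psi> (at x) h * \<phi> x" for x h
    have De: "D x (axis i 1) = \<psi> x * partial_deriv i \<phi> x + partial_deriv i \<psi> x * \<phi> x" for x
      by (simp add: D_def partial_deriv_def)
    have "(LINT x|lebesgue. D x (axis i 1)) = 0"
    proof (rule integral_partial_derivative_zero[where f = "\<lambda>x. \<psi> x * \<phi> x"])
      show "((\<lambda>x. \<psi> x * \<phi> x) has_derivative D x) (at x)" for x
        unfolding D_def by (rule has_derivative_mult[OF 1(3) 2(3)])
      show "continuous_on UNIV (\<lambda>x. D x (axis i 1))"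
        unfolding De by (intro continuous_intros 1 2)
      show "\<bar>D x (axis i 1)\<bar> \<le> M * M' + M * M'" for x
      proof -
        have "\<bar>\<psi> x * partial_deriv i \<phi> x\<bar> \<le> M * M'" "\<bar>partial_deriv i \<psi> x * \<phi> x\<bar> \<le> M * M'"
          using 1(2) 2(2) unfolding abs_mult by (intro mult_mono 1 2; simp)+
        then show ?thesis unfolding De by linarith
      qed
    qed (use 1 in auto)
    then have "(LINT x|lebesgue. \<psi> x * partial_deriv i \<phi> x) + (LINT x|lebesgue. partial_deriv i \<psi> x * \<phi> x) = 0"
      unfolding De
      by (subst (asm) Bochner_Integration.integral_add)
         (intro test_function_integrable[OF t2] continuous_locally_integrable 1(4,5))+
    then show "(LINT x|lebesgue. \<psi> x * partial_deriv i \<phi> x) = - (LINT x|lebesgue. (\<chi> i. partial_deriv i \<psi> x) $ i * \<phi> x)"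
      by simp
  qed
  have "(\<integral>\<^sup>+ x. ennreal ((norm (\<chi> i. partial_deriv i \<psi> x))\<^sup>2) \<partial>lebesgue)
      \<le> (\<integral>\<^sup>+ x. ennreal (real CARD('n) * M\<^sup>2) * indicator (cball 0 R) (x::real^'n) \<partial>lebesgue)"
  proof (rule nn_integral_mono)
    fix x :: "real^'n"
    have "(norm (\<chi> i. partial_deriv i \<psi> x))\<^sup>2 = (\<Sum>i\<in>UNIV. (partial_deriv i \<psi> x)\<^sup>2)"
      unfolding norm_sq_eq_sum by (simp add: power2_eq_square)
    also have "\<dots> \<le> (\<Sum>i\<in>(UNIV::'n set). M\<^sup>2)"
      using 1(9) by (intro sum_mono) (metis abs_ge_zero power2_abs power_mono)
    finally have le: "(norm (\<chi> i. partial_deriv i \<psi> x))\<^sup>2 \<le> real CARD('n) * M\<^sup>2" by simp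
    show "ennreal ((norm (\<chi> i. partial_deriv i \<psi> x))\<^sup>2) \<le> ennreal (real CARD('n) * M\<^sup>2) * indicator (cball 0 R) x"
    proof (cases "norm x > R")
      case True
      then have "(\<chi> i. partial_deriv i \<psi> x) = 0" using 1(7) by (simp add: vec_eq_iff)
      then show ?thesis by simp
    qed (use le in \<open>auto intro!: ennreal_leI\<close>)
  qed
  also have "\<dots> = ennreal (real CARD('n) * M\<^sup>2) * emeasure lebesgue (cball (0::real^'n) R)"
    by (rule nn_integral_cmult_indicator) auto
  also have "\<dots> < \<infinity>" by (simp add: ennreal_mult_less_top emeasure_lborel_cball_finite[unfolded infinity_ennreal_def])
  finally show "(\<integral>\<^sup>+ x. ennreal ((norm (\<chi> i. partial_deriv i \<psi> x))\<^sup>2) \<partial>lebesgue) < \<infinity>" .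
qed

lemma has_weak_gradient_scale:
  assumes "has_weak_gradient u G"
  shows "has_weak_gradient (\<lambda>x. c * u x) (\<lambda>x. c *\<^sub>R G x)"
  using assms unfolding has_weak_gradient_def locally_integrable_def
  by (auto simp: mult.assoc intro!: set_integrable_mult_right set_integrable_scaleR_right)

lemma growth_energy_scale:
  assumes c: "0 < c" and u: "u \<in> borel_measurable lebesgue" and fin: "\<And>\<rho>. h_fun p u \<rho> < \<infinity>"
  shows "growth_energy p q b (\<lambda>x. c * u x) = ennreal (c powr (p * q)) * growth_energy p q b u"
proof -
  note [measurable] = u
  have h: "h_fun p (\<lambda>x. c * u x) \<rho> = ennreal (c powr p) * h_fun p u \<rho>" for \<rho>
  proof -
    have [measurable]: "ball 0 \<rho> \<in> sets (lebesgue :: (real^2) measure)" by simp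
    show ?thesis
      unfolding h_fun_def using c
      by (subst nn_integral_cmult[symmetric]) (auto simp: abs_mult powr_mult ennreal_mult mult.assoc)
  qed
  have e: "epowr (ennreal (c powr p) * X) q = ennreal (c powr (p * q)) * epowr X q" for X
    using c by (subst epowr_mult) (auto simp: powr_powr)
  have "growth_energy p q b (\<lambda>x. c * u x)
      = (\<integral>\<^sup>+ \<rho>. ennreal (c powr (p * q)) * (ennreal (\<rho> powr (- b)) * epowr (h_fun p u \<rho>) q * indicator {0<..} \<rho>) \<partial>lebesgue)"
    unfolding growth_energy_def h e by (intro nn_integral_cong) (simp add: mult_ac)
  also have "\<dots> = ennreal (c powr (p * q)) * growth_energy p q b u"
    unfolding growth_energy_def
    by (rule nn_integral_cmult) (intro borel_measurable_times_ennreal h_fun_measurable fin borel_measurable_indicator, simp)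
  finally show ?thesis .
qed

text \<open>
  The power \<open>2pq\<close> of the norm of \<open>E\<close>, for a given weak gradient \<open>G\<close> of \<open>u\<close>.
\<close>

definition total_energy :: "real \<Rightarrow> real \<Rightarrow> real \<Rightarrow> (real^2 \<Rightarrow> real) \<Rightarrow> (real^2 \<Rightarrow> real^2) \<Rightarrow> ennreal" where
  "total_energy p q b u G =
     epowr (sq_integral G) (p * q) + epowr (growth_energy p q b u) 2"

lemma total_energy_scale:
  assumes c: "0 < c" and G: "has_weak_gradient u G" and fin: "\<And>\<rho>. h_fun p u \<rho> < \<infinity>"
  shows "total_energy p q b (\<lambda>x. c * u x) (\<lambda>x. c *\<^sub>R G x) = ennreal (c powr (2 * p * q)) * total_energy p q b u G"
proof -
  have u: "u \<in> borel_measurable lebesgue" and Gm [measurable]: "G \<in> borel_measurable lebesgue"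
    using G by (auto simp: has_weak_gradient_def intro: locally_integrable_measurable)
  have "(\<integral>\<^sup>+ x. ennreal ((norm (c *\<^sub>R G x))\<^sup>2) \<partial>lebesgue) = (\<integral>\<^sup>+ x. ennreal (c\<^sup>2) * ennreal ((norm (G x))\<^sup>2) \<partial>lebesgue)"
    by (intro nn_integral_cong) (simp add: power_mult_distrib ennreal_mult)
  also have "\<dots> = ennreal (c\<^sup>2) * sq_integral G"
    by (rule nn_integral_cmult) measurable
  finally have g: "(\<integral>\<^sup>+ x. ennreal ((norm (c *\<^sub>R G x))\<^sup>2) \<partial>lebesgue) = ennreal (c\<^sup>2) * sq_integral G" .
  have e1: "epowr (ennreal (c\<^sup>2) * X) (p * q) = ennreal (c powr (2 * p * q)) * epowr X (p * q)" for X
  proof -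
    have "(c\<^sup>2) powr (p * q) = (c powr 2) powr (p * q)" using c by simp
    also have "\<dots> = c powr (2 * p * q)" by (simp only: powr_powr mult.assoc)
    finally show ?thesis using c by (subst epowr_mult) auto
  qed
  have e2: "epowr (ennreal (c powr (p * q)) * X) 2 = ennreal (c powr (2 * p * q)) * epowr X 2" for X
    using c by (subst epowr_mult) (auto simp: powr_powr mult_ac)
  show ?thesis
    unfolding total_energy_def g growth_energy_scale[OF c u fin] e1 e2 by (simp only: distrib_left)
qed

lemma in_U_ballI:
  assumes "0 < p * q" "radially_symmetric u" "has_weak_gradient u G" "total_energy p q b u G \<le> 1"
  shows "u \<in> U_ball p q b"
  unfolding in_U_ball_iff[OF assms(1)] using assms by (auto simp: total_energy_def)

lemma radially_symmetric_scale: "radially_symmetric u \<Longrightarrow> radially_symmetric (\<lambda>x. c * u x)"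
  unfolding radially_symmetric_def
proof (elim exE)
  fix f assume "AE x in lebesgue. u x = f (norm x)"
  then have "AE x in lebesgue. c * u x = c * f (norm x)" by eventually_elim simp
  then show "\<exists>f. AE x in lebesgue. c * u x = f (norm x)" by (intro exI[of _ "\<lambda>t. c * f t"])
qed

lemma Psi_scale:
  assumes \<nu>: "0 < \<nu>" and c: "1 \<le> c" and n: "1 \<le> n_min p q b" and u: "u \<in> borel_measurable lebesgue"
  shows "ennreal (c\<^sup>2) * Psi p q b \<nu> u \<le> Psi p q b \<nu> (\<lambda>x. c * u x)"
proof -
  note [measurable] = u
  have c2: "1 \<le> c\<^sup>2" using c by (simp add: one_le_power)
  have "ennreal (c\<^sup>2) * Psi p q b \<nu> u = (\<integral>\<^sup>+ x. ennreal (c\<^sup>2) * ennreal (psi (n_min p q b) (\<nu> * (u x)\<^sup>2)) \<partial>lebesgue)"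
    unfolding Psi_def by (rule nn_integral_cmult[symmetric]) measurable
  also have "\<dots> \<le> Psi p q b \<nu> (\<lambda>x. c * u x)"
    unfolding Psi_def
  proof (rule nn_integral_mono)
    fix x
    have "c\<^sup>2 * psi (n_min p q b) (\<nu> * (u x)\<^sup>2) \<le> psi (n_min p q b) (c\<^sup>2 * (\<nu> * (u x)\<^sup>2))"
      using \<nu> c2 n by (intro psi_scale) auto
    then show "ennreal (c\<^sup>2) * ennreal (psi (n_min p q b) (\<nu> * (u x)\<^sup>2)) \<le> ennreal (psi (n_min p q b) (\<nu> * (c * u x)\<^sup>2))"
      using psi_nonneg[of "\<nu> * (u x)\<^sup>2"] \<nu>
      by (simp add: ennreal_mult[symmetric] power_mult_distrib mult_ac ennreal_leI)
  qed
  finally show ?thesis .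
qed

section \<open>Compactness and the maximizer\<close>

lemma bump_pos: "s \<in> {a<..<b} \<Longrightarrow> 0 < bump m a b s"
  by (simp add: bump_def flat_def mult_le_0_iff)

text \<open>
  A test function supported in an annulus; since it vanishes near the origin, the weight \<open>\<rho>\<^bsup>-b\<^esup>\<close>
  causes no difficulty. A multiple of it shows that the functional is not identically zero on the unit ball.
\<close>

definition annular_bump :: "real^2 \<Rightarrow> real" where
  "annular_bump x = bump 0 1 2 ((norm x)\<^sup>2)"

lemma test_function_annular_bump: "test_function annular_bump"
proof (rule test_functionI)
  show "csmooth annular_bump"
    unfolding annular_bump_def[abs_def] by (intro csmooth_comp[OF smooth_bump] csmooth_norm_sq)
  show "norm x \<le> 2" if "annular_bump x \<noteq> 0" for x
  proof (rule ccontr)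
    assume "\<not> norm x \<le> 2"
    then have "2\<^sup>2 \<le> (norm x)\<^sup>2" by (intro power_mono) auto
    then have "annular_bump x = 0" unfolding annular_bump_def by (intro bump_eq_0) auto
    with that show False by simp
  qed
qed

lemma annular_bump_bounds: "0 \<le> annular_bump x" "annular_bump x \<le> 1"
  by (simp_all add: annular_bump_def bump_bounds)

lemma h_fun_annular_bump:
  assumes p: "0 < p"
  shows "h_fun p annular_bump \<rho> \<le> ennreal (4 * pi)" "\<rho> \<le> 1 \<Longrightarrow> h_fun p annular_bump \<rho> = 0"
proof -
  have "h_fun p annular_bump \<rho> \<le> (\<integral>\<^sup>+ y. indicator (ball 0 2) (y::real^2) \<partial>lebesgue)"
    unfolding h_fun_def
  proof (rule nn_integral_mono)
    fix y :: "real^2"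
    show "ennreal (\<bar>annular_bump y\<bar> powr p) * indicator (ball 0 \<rho>) y \<le> indicator (ball 0 2) y"
    proof (cases "norm y < 2")
      case True
      have "\<bar>annular_bump y\<bar> powr p \<le> 1 powr p"
        using annular_bump_bounds[of y] p by (intro powr_mono2) auto
      then show ?thesis using True by (auto simp: indicator_def)
    next
      case False
      then have "2\<^sup>2 \<le> (norm y)\<^sup>2" by (intro power_mono) auto
      then have "annular_bump y = 0" unfolding annular_bump_def by (intro bump_eq_0) auto
      then show ?thesis by simp
    qed
  qed
  also have "\<dots> = emeasure lborel (ball (0::real^2) 2)" by simp
  also have "\<dots> = ennreal (4 * pi)" by (simp add: emeasure_ball unit_ball_vol_2 mult.commute)
  finally show "h_fun p annular_bump \<rho> \<le> ennreal (4 * pi)" .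
  assume \<rho>: "\<rho> \<le> 1"
  have 0: "ennreal (\<bar>annular_bump y\<bar> powr p) * indicator (ball 0 \<rho>) y = 0" for y
  proof (cases "norm y < \<rho>")
    case True
    then have "(norm y)\<^sup>2 \<le> 1\<^sup>2" using \<rho> by (intro power_mono) auto
    then have "annular_bump y = 0" unfolding annular_bump_def by (intro bump_eq_0) auto
    then show ?thesis by simp
  qed simp
  show "h_fun p annular_bump \<rho> = 0" unfolding h_fun_def 0 by simp
qed

lemma growth_energy_annular_bump:
  assumes p: "0 < p" and q: "0 < q" and b: "1 < b"
  shows "growth_energy p q b annular_bump < \<infinity>"
proof -
  define c where "c = (4 * pi) powr q"
  have I: "((\<lambda>x. x powr (- b)) has_integral -(1 powr (- b + 1)) / (- b + 1)) {1..}"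
    using b by (intro has_integral_powr_to_inf) auto
  have "growth_energy p q b annular_bump \<le> (\<integral>\<^sup>+ \<rho>. ennreal c * (ennreal (\<rho> powr (- b)) * indicator {1..} \<rho>) \<partial>lebesgue)"
    unfolding growth_energy_def
  proof (rule nn_integral_mono)
    fix \<rho> :: real
    show "ennreal (\<rho> powr (- b)) * epowr (h_fun p annular_bump \<rho>) q * indicator {0<..} \<rho>
      \<le> ennreal c * (ennreal (\<rho> powr (- b)) * indicator {1..} \<rho>)"
    proof (cases "1 \<le> \<rho>")
      case True
      have "epowr (h_fun p annular_bump \<rho>) q \<le> epowr (ennreal (4 * pi)) q"
        by (intro epowr_mono q h_fun_annular_bump p)
      also have "\<dots> = ennreal c" by (simp add: epowr_ennreal c_def)
      finally have "ennreal (\<rho> powr (- b)) * epowr (h_fun p annular_bump \<rho>) q \<le> ennreal (\<rho> powr (- b)) * ennreal c"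
        by (intro mult_left_mono) auto
      then show ?thesis using True by (simp add: mult.commute)
    next
      case False
      then have "epowr (h_fun p annular_bump \<rho>) q = 0"
        using h_fun_annular_bump(2)[OF p, of \<rho>] epowr_ennreal[of 0 q] by simp
      then show ?thesis by simp
    qed
  qed
  also have "\<dots> = ennreal c * (\<integral>\<^sup>+ \<rho>. ennreal (\<rho> powr (- b)) * indicator {1..} \<rho> \<partial>lborel)"
    by (simp add: nn_integral_completion nn_integral_cmult)
  also have "(\<integral>\<^sup>+ \<rho>. ennreal (\<rho> powr (- b)) * indicator {1..} \<rho> \<partial>lborel) = ennreal (-(1 powr (- b + 1)) / (- b + 1))"
    by (rule nn_integral_has_integral_lebesgue'[OF _ I]) simp
  also have "ennreal c * \<dots> < \<infinity>" by (simp add: ennreal_mult_less_top)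
  finally show ?thesis .
qed

lemma n_min_spec:
  assumes "1 < p" "1 \<le> q" "1 < b" "b < 1 + 2 * q"
  shows "2 * (p * q + b - 1) / (2 * q + 1 - b) < 2 * real (n_min p q b)" "1 \<le> n_min p q b"
proof -
  obtain n where "2 * (p * q + b - 1) / (2 * q + 1 - b) < real n" using reals_Archimedean2 by blast
  then have "2 * real n > 2 * (p * q + b - 1) / (2 * q + 1 - b)" by simp
  then show 1: "2 * (p * q + b - 1) / (2 * q + 1 - b) < 2 * real (n_min p q b)"
    unfolding n_min_def by (rule LeastI)
  have "0 < p * q" using assms by simp
  then have "0 < 2 * (p * q + b - 1) / (2 * q + 1 - b)" using assms by (intro divide_pos_pos mult_pos_pos) linarith+
  with 1 show "1 \<le> n_min p q b" by (cases "n_min p q b") auto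
qed

lemma ex_U_ball_Psi_pos:
  assumes p: "1 < p" and q: "1 \<le> q" and b: "1 < b" and \<nu>: "0 < \<nu>"
  shows "\<exists>u\<in>U_ball p q b. 0 < Psi p q b \<nu> u"
proof -
  note t = test_function_annular_bump
  have pq: "0 < p * q" using p q by simp
  define G where "G = (\<lambda>x. \<chi> i. partial_deriv i annular_bump x)"
  have G: "has_weak_gradient annular_bump G" "sq_integral G < \<infinity>"
    unfolding G_def by (rule test_function_has_weak_gradient[OF t])+
  have L: "growth_energy p q b annular_bump < \<infinity>" using p q b by (intro growth_energy_annular_bump) auto
  have hfin: "h_fun p annular_bump \<rho> < \<infinity>" for \<rho>
    by (rule order_le_less_trans[OF h_fun_annular_bump(1)]) (use p in auto)
  have "total_energy p q b annular_bump G < \<infinity>"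
    using G(2) L by (simp add: total_energy_def epowr_less_top_iff)
  then obtain X where X: "total_energy p q b annular_bump G = ennreal X" "0 \<le> X"
    by (cases "total_energy p q b annular_bump G") auto
  define c where "c = (1 / (X + 1)) powr (1 / (2 * p * q))"
  have c: "0 < c" using X(2) by (simp add: c_def)
  have cp: "c powr (2 * p * q) = 1 / (X + 1)"
    using X(2) p q by (simp add: c_def powr_powr)
  have "1 / (X + 1) * X \<le> 1" using X(2) by (simp add: divide_le_eq)
  then have "total_energy p q b (\<lambda>x. c * annular_bump x) (\<lambda>x. c *\<^sub>R G x) \<le> 1"
    unfolding total_energy_scale[OF c G(1) hfin] X(1) cp using X(2)
    by (simp add: ennreal_mult[symmetric])
  moreover have "radially_symmetric (\<lambda>x. c * annular_bump x)"
    by (intro radially_symmetric_scale) (auto simp: radially_symmetric_def annular_bump_def intro!: exI[of _ "\<lambda>r. bump 0 1 2 (r\<^sup>2)"])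
  ultimately have U: "(\<lambda>x. c * annular_bump x) \<in> U_ball p q b"
    by (intro in_U_ballI[OF pq _ has_weak_gradient_scale[OF G(1)]])
  have "Psi p q b \<nu> (\<lambda>x. c * annular_bump x) \<noteq> 0"
  proof
    assume 0: "Psi p q b \<nu> (\<lambda>x. c * annular_bump x) = 0"
    have m [measurable]: "annular_bump \<in> borel_measurable lebesgue"
      by (rule test_function_sq_integrable(1)[OF t])
    have "AE x in lebesgue. ennreal (psi (n_min p q b) (\<nu> * (c * annular_bump x)\<^sup>2)) = 0"
      using 0 unfolding Psi_def by (subst (asm) nn_integral_0_iff_AE) measurable
    then have "AE x in lebesgue. x \<notin> {x::real^2. 1 < (norm x)\<^sup>2 \<and> (norm x)\<^sup>2 < 2}"
    proof eventually_elim
      case (elim x)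
      show ?case
      proof
        assume "x \<in> {x::real^2. 1 < (norm x)\<^sup>2 \<and> (norm x)\<^sup>2 < 2}"
        then have "0 < annular_bump x" unfolding annular_bump_def by (intro bump_pos) auto
        then have "0 < psi (n_min p q b) (\<nu> * (c * annular_bump x)\<^sup>2)" using \<nu> c by (intro psi_pos) auto
        with elim show False by simp
      qed
    qed
    moreover have op: "open {x::real^2. 1 < (norm x)\<^sup>2 \<and> (norm x)\<^sup>2 < 2}"
      by (intro open_Collect_conj open_Collect_less continuous_intros)
    ultimately have "negligible {x::real^2. 1 < (norm x)\<^sup>2 \<and> (norm x)\<^sup>2 < 2}"
      unfolding negligible_iff_null_sets by (subst (asm) AE_iff_null_sets[symmetric]) auto
    moreover have "vec2 (6/5, 0) \<in> {x::real^2. 1 < (norm x)\<^sup>2 \<and> (norm x)\<^sup>2 < 2}"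
      unfolding mem_Collect_eq norm_sq_real2 by (simp add: power2_eq_square)
    ultimately show False using open_not_negligible[OF op] by blast
  qed
  with U show ?thesis by (intro bexI[of _ "\<lambda>x. c * annular_bump x"]) (auto simp: zero_less_iff_neq_zero)
qed

lemma ennreal_sum_le_oneD:
  assumes "epowr (ennreal x) a + epowr (ennreal y) c \<le> 1" "0 \<le> x" "0 \<le> y"
  shows "x powr a + y powr c \<le> 1"
proof -
  have "ennreal (x powr a + y powr c) \<le> ennreal 1"
    using assms by (simp add: epowr_ennreal ennreal_plus)
  then show ?thesis by (subst (asm) ennreal_le_iff) auto
qed

text \<open>
  In terms of \<open>\<beta>\<close>, the exponent of the squared radius in the growth bound, the threshold that defines \<open>n\<close> is
  \<open>(p + 2 \<beta>) / (1 - \<beta>)\<close>.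
\<close>

lemma critical_exponent_eq:
  fixes p q b \<beta> :: real
  assumes "1 < p" "1 \<le> q" "1 < b" "b < 1 + 2 * q" and "\<beta> = (b - 1) / (2 * q)"
  shows "0 < \<beta>" "\<beta> < 1" "(p + 2 * \<beta>) / (1 - \<beta>) = 2 * (p * q + b - 1) / (2 * q + 1 - b)"
proof -
  show "0 < \<beta>" unfolding assms(5) using assms(1-4) by (intro divide_pos_pos) auto
  show "\<beta> < 1" unfolding assms(5) using assms(1-4) by (simp add: divide_less_eq)
  have "p + 2 * \<beta> = (2 * (p * q + b - 1)) / (2 * q)" using assms by (simp add: field_simps)
  moreover have "1 - \<beta> = (2 * q + 1 - b) / (2 * q)" using assms by (simp add: field_simps)
  ultimately show "(p + 2 * \<beta>) / (1 - \<beta>) = 2 * (p * q + b - 1) / (2 * q + 1 - b)"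
    using assms by simp
qed

text \<open>
  Sequential compactness of the unit ball with respect to pointwise convergence of the profiles. The
  Dirichlet integrals and the weighted parts are first made convergent, so that the constraint that
  couples them passes to the limit.
\<close>

lemma U_ball_compact:
  fixes u :: "nat \<Rightarrow> real^2 \<Rightarrow> real"
  assumes p: "1 < p" and q: "1 \<le> q" and b: "1 < b" "b < 1 + 2 * q"
    and u: "\<And>k. u k \<in> U_ball p q b"
  obtains r v Fn F where "strict_mono r" "v \<in> U_ball p q b"
    "\<And>k. profile p (2 powr (b / q)) ((b - 1) / (2 * q)) (Fn k)"
    "\<And>k. has_profile (u (r k)) (Fn k)"
    "\<And>\<tau>. (\<lambda>k. Fn k \<tau>) \<longlonglongrightarrow> F \<tau>" "has_profile v F"
proof -
  have pq: "0 < p * q" using p q by simp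
  define C where "C = 2 powr (b / q)"
  define \<beta> where "\<beta> = (b - 1) / (2 * q)"
  have C: "0 < C" by (simp add: C_def)
  note \<beta> = critical_exponent_eq(1,2)[OF p q b \<beta>_def]
  have "\<forall>k. \<exists>F G. profile p C \<beta> F \<and> (has_profile (u k) F) \<and> has_weak_gradient (u k) G \<and>
    sq_integral G \<le> 1 \<and> growth_energy p q b (u k) \<le> 1 \<and>
    epowr (sq_integral G) (p * q) + epowr (growth_energy p q b (u k)) 2 \<le> 1 \<and>
    (\<forall>\<rho>. h_fun p (u k) \<rho> < \<infinity>)"
  proof
    fix k
    show "\<exists>F G. profile p C \<beta> F \<and> (has_profile (u k) F) \<and> has_weak_gradient (u k) G \<and>
      sq_integral G \<le> 1 \<and> growth_energy p q b (u k) \<le> 1 \<and>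
      epowr (sq_integral G) (p * q) + epowr (growth_energy p q b (u k)) 2 \<le> 1 \<and>
      (\<forall>\<rho>. h_fun p (u k) \<rho> < \<infinity>)"
      unfolding C_def \<beta>_def by (rule U_ball_profile[OF p q b(1) u[of k]]) blast
  qed
  then obtain F0 G0 where FG: "\<And>k. profile p C \<beta> (F0 k)" "\<And>k. has_profile (u k) (F0 k)"
    "\<And>k. has_weak_gradient (u k) (G0 k)"
    "\<And>k. sq_integral (G0 k) \<le> 1" "\<And>k. growth_energy p q b (u k) \<le> 1"
    "\<And>k. epowr (sq_integral (G0 k)) (p * q) + epowr (growth_energy p q b (u k)) 2 \<le> 1"
    "\<And>k \<rho>. h_fun p (u k) \<rho> < \<infinity>"
    unfolding choice_iff by blast
  obtain B where B: "\<And>F s. profile p C \<beta> F \<Longrightarrow> 1 \<le> s \<Longrightarrow> \<bar>F (ln s)\<bar> \<le> B"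
    by (rule profile_dominated[OF p C \<beta> zero_less_one]) (use pi_ge_two in linarith, rule that)
  have H: "log_hoelder (F0 k)" for k using FG(1)[of k] by (simp add: profile_def)
  have F00: "\<bar>F0 k 0\<bar> \<le> B" for k using B[OF FG(1)[of k], of 1] by simp
  obtain r1 F where r1: "strict_mono r1" and F: "\<And>\<tau>. (\<lambda>n. F0 (r1 n) \<tau>) \<longlonglongrightarrow> F \<tau>"
    by (rule log_hoelder_compact[of F0 B, OF H F00]) (rule that)
  define a where "a k = enn2real (sq_integral (G0 k))" for k
  define l where "l k = enn2real (growth_energy p q b (u k))" for k
  have a: "sq_integral (G0 k) = ennreal (a k)" "0 \<le> a k" "a k \<le> 1" for k
  proof -
    have "sq_integral (G0 k) < top" by (rule order_le_less_trans[OF FG(4)]) simp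
    then show e: "sq_integral (G0 k) = ennreal (a k)" by (simp add: a_def)
    show "0 \<le> a k" by (simp add: a_def)
    show "a k \<le> 1" using FG(4)[of k] unfolding e by simp
  qed
  have l: "growth_energy p q b (u k) = ennreal (l k)" "0 \<le> l k" "l k \<le> 1" for k
  proof -
    have "growth_energy p q b (u k) < top" by (rule order_le_less_trans[OF FG(5)]) simp
    then show e: "growth_energy p q b (u k) = ennreal (l k)" by (simp add: l_def)
    show "0 \<le> l k" by (simp add: l_def)
    show "l k \<le> 1" using FG(5)[of k] unfolding e by simp
  qed
  obtain r2 where r2: "strict_mono (r2::nat\<Rightarrow>nat)"
    "\<And>i. i \<in> {False, True} \<Longrightarrow> \<exists>y. (\<lambda>n. if i then a (r1 (r2 n)) else l (r1 (r2 n))) \<longlonglongrightarrow> y"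
    by (rule function_convergent_subsequence[of "{False, True}" "\<lambda>n i. if i then a (r1 n) else l (r1 n)" 1])
       (use a l that in auto)
  define r where "r = r1 \<circ> r2"
  have r: "strict_mono r" unfolding r_def by (rule strict_mono_o[OF r1 r2(1)])
  obtain \<gamma> \<mu> where \<gamma>: "(\<lambda>n. a (r n)) \<longlonglongrightarrow> \<gamma>" and \<mu>: "(\<lambda>n. l (r n)) \<longlonglongrightarrow> \<mu>"
    using r2(2)[of True] r2(2)[of False] by (auto simp: r_def)
  have Fr: "(\<lambda>n. F0 (r n) \<tau>) \<longlonglongrightarrow> F \<tau>" for \<tau>
    using LIMSEQ_subseq_LIMSEQ[OF F[of \<tau>] r2(1)] by (simp add: r_def o_def)
  have \<gamma>0: "0 \<le> \<gamma>" by (rule LIMSEQ_le_const[OF \<gamma>]) (use a in auto)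
  have \<mu>0: "0 \<le> \<mu>" by (rule LIMSEQ_le_const[OF \<mu>]) (use l in auto)
  have lim1: "\<gamma> powr (p * q) + \<mu> powr 2 \<le> 1"
  proof (rule LIMSEQ_le_const2)
    show "(\<lambda>n. a (r n) powr (p * q) + l (r n) powr 2) \<longlonglongrightarrow> \<gamma> powr (p * q) + \<mu> powr 2"
      using pq a l by (intro tendsto_add tendsto_powr' \<gamma> \<mu> tendsto_const) auto
    show "\<exists>N. \<forall>n\<ge>N. a (r n) powr (p * q) + l (r n) powr 2 \<le> 1"
    proof (intro exI allI impI)
      fix n
      show "a (r n) powr (p * q) + l (r n) powr 2 \<le> 1"
        by (rule ennreal_sum_le_oneD) (use FG(6)[of "r n"] a l in auto)
    qed
  qed
  define v where "v = (\<lambda>x::real^2. F (ln ((norm x)\<^sup>2)))"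
  have um: "u k \<in> borel_measurable lebesgue" for k
    using FG(3)[of k] by (auto simp: has_weak_gradient_def intro: locally_integrable_measurable)
  note lim = profile_limit_locally_integrable[of p C \<beta> "\<lambda>k. F0 (r k)" F "\<lambda>k. u (r k)",
      OF p C \<beta> FG(1) Fr FG(2) um]
  have vl: "locally_integrable v" unfolding v_def by (rule lim(1))
  obtain g where g: "has_weak_gradient v g" "sq_integral g \<le> ennreal \<gamma>"
  proof (rule weak_gradient_limit[of "\<lambda>k. u (r k)" "\<lambda>k. G0 (r k)" v "\<lambda>k. a (r k)" \<gamma>])
    show "(\<lambda>k. LINT x|lebesgue. u (r k) x * partial_deriv i \<phi> x) \<longlonglongrightarrow> (LINT x|lebesgue. v x * partial_deriv i \<phi> x)"
      if "test_function \<phi>" for \<phi> i unfolding v_def by (rule lim(2)[OF that])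
  qed (use FG(3) vl a \<gamma> in auto)
  have "growth_energy p q b v \<le> liminf (\<lambda>k. growth_energy p q b (u (r k)))"
  proof (rule growth_energy_liminf)
    have "AE x in lebesgue. \<forall>k. u k x = F0 k (ln ((norm x)\<^sup>2))" using FG(2) by (simp add: AE_all_countable)
    then show "AE x in lebesgue. (\<lambda>k. u (r k) x) \<longlonglongrightarrow> v x"
    proof eventually_elim
      case (elim x)
      show ?case unfolding elim[rule_format] v_def by (rule Fr)
    qed
  qed (use um p q FG(7) in auto)
  also have "\<dots> = ennreal \<mu>"
    unfolding l(1) by (rule lim_imp_Liminf[OF trivial_limit_sequentially]) (intro tendsto_ennrealI \<mu>)
  finally have gv: "growth_energy p q b v \<le> ennreal \<mu>" .
  have "total_energy p q b v g \<le> epowr (ennreal \<gamma>) (p * q) + epowr (ennreal \<mu>) 2"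
    unfolding total_energy_def by (intro add_mono epowr_mono pq g(2) gv) auto
  also have "\<dots> = ennreal (\<gamma> powr (p * q) + \<mu> powr 2)" using \<gamma>0 \<mu>0 by (simp add: epowr_ennreal ennreal_plus)
  also have "\<dots> \<le> ennreal 1" by (rule ennreal_leI[OF lim1])
  finally have tot: "total_energy p q b v g \<le> 1" by simp
  have "radially_symmetric v" unfolding radially_symmetric_def v_def by (intro exI[of _ "\<lambda>t. F (ln (t\<^sup>2))"]) simp
  then have vU: "v \<in> U_ball p q b" using in_U_ballI[OF pq _ g(1) tot] by blast
  show ?thesis
    by (rule that[of r v "\<lambda>k. F0 (r k)" F, OF r vU])
       (use FG(1,2) Fr in \<open>auto simp: C_def \<beta>_def v_def\<close>)
qed

theorem theorem2p15:
  fixes p q b \<nu> :: real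
  assumes "1 < p" and "1 \<le> q" and "p * q > 2" and "1 < b" and "b < 1 + 2 * q"
    and "0 < \<nu>" and "\<nu> < 4 * pi"
  shows "S_sup p q b \<nu> < \<infinity> \<and>
    (\<exists>u \<in> U_ball p q b. E_norm p q b u = 1 \<and> Psi p q b \<nu> u = S_sup p q b \<nu>)"
proof -
  note p = assms(1) and q = assms(2) and b = assms(4,5) and \<nu> = assms(6,7)
  have pq: "0 < p * q" using p q by simp
  define C where "C = 2 powr (b / q)"
  define \<beta> where "\<beta> = (b - 1) / (2 * q)"
  define S where "S = S_sup p q b \<nu>"
  have C: "0 < C" by (simp add: C_def)
  note \<beta> = critical_exponent_eq(1,2)[OF p q b \<beta>_def]
  note n = n_min_spec[OF p q b]
  have n': "(p + 2 * \<beta>) / (1 - \<beta>) < 2 * real (n_min p q b)"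
    using n(1) unfolding critical_exponent_eq(3)[OF p q b \<beta>_def] .
  note bounds = profile_functional[OF p C \<beta> \<nu> n']
  have le_S: "Psi p q b \<nu> u \<le> S" if "u \<in> U_ball p q b" for u
    unfolding S_def S_sup_def using that by (rule SUP_upper)
  obtain M where M: "M < \<infinity>" "\<And>F. profile p C \<beta> F \<Longrightarrow> radial_functional (n_min p q b) \<nu> F \<le> M"
    using bounds(1) by blast
  have "S \<le> M"
    unfolding S_def S_sup_def
  proof (rule SUP_least)
    fix u assume u: "u \<in> U_ball p q b"
    obtain F where F: "profile p C \<beta> F" "has_profile u F"
      by (rule U_ball_profile[OF p q b(1) u, folded C_def \<beta>_def]) (rule that)
    have "log_hoelder F" using F(1) by (simp add: profile_def)
    then show "Psi p q b \<nu> u \<le> M"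
      unfolding Psi_eq_radial_functional[OF \<open>log_hoelder F\<close> F(2)] by (intro M(2) F(1))
  qed
  then have Sfin: "S < \<infinity>" using M(1) by (rule order_le_less_trans)
  obtain u1 where u1: "u1 \<in> U_ball p q b" "0 < Psi p q b \<nu> u1"
    using ex_U_ball_Psi_pos[OF p q b(1) \<nu>(1)] by blast
  have Spos: "0 < S" using u1(2) le_S[OF u1(1)] by (rule order_less_le_trans)
  obtain f where f: "incseq f" "range f \<subseteq> Psi p q b \<nu> ` U_ball p q b" "S = (SUP i. f i)"
  proof -
    have "Psi p q b \<nu> ` U_ball p q b \<noteq> {}" using u1(1) by blast
    from ennreal_Sup_countable_SUP[OF this] obtain f where
      f: "incseq f \<and> range f \<subseteq> Psi p q b \<nu> ` U_ball p q b \<and> Sup (Psi p q b \<nu> ` U_ball p q b) = (SUP i. f i)" ..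
    have "S = (SUP i. f i)"
      unfolding S_def S_sup_def by (rule f[THEN conjunct2, THEN conjunct2])
    then show ?thesis by (rule that[OF f[THEN conjunct1] f[THEN conjunct2, THEN conjunct1]])
  qed
  have "\<forall>k. \<exists>u. u \<in> U_ball p q b \<and> Psi p q b \<nu> u = f k"
  proof
    fix k
    have "f k \<in> Psi p q b \<nu> ` U_ball p q b" by (rule subsetD[OF f(2) rangeI])
    then obtain u where "f k = Psi p q b \<nu> u" "u \<in> U_ball p q b" by (rule imageE)
    then show "\<exists>u. u \<in> U_ball p q b \<and> Psi p q b \<nu> u = f k" by (intro exI[of _ u]) simp
  qed
  from choice[OF this] obtain u where "\<forall>k. u k \<in> U_ball p q b \<and> Psi p q b \<nu> (u k) = f k" ..
  then have u: "u k \<in> U_ball p q b" "Psi p q b \<nu> (u k) = f k" for k by simp_all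
  have flim: "f \<longlonglongrightarrow> S" unfolding f(3) by (rule LIMSEQ_SUP[OF f(1)])
  obtain r v Fn F where r: "strict_mono r" and v: "v \<in> U_ball p q b"
    and Fn: "\<And>k. profile p C \<beta> (Fn k)" "\<And>k. has_profile (u (r k)) (Fn k)"
    and F: "\<And>\<tau>. (\<lambda>k. Fn k \<tau>) \<longlonglongrightarrow> F \<tau>" "has_profile v F"
    by (rule U_ball_compact[OF p q b u(1), folded C_def \<beta>_def]) (rule that)
  have H: "log_hoelder (Fn k)" for k using Fn(1)[of k] by (simp add: profile_def)
  have HF: "log_hoelder F" by (rule log_hoelder_limit[OF H F(1)])
  have "radial_functional (n_min p q b) \<nu> (Fn k) = f (r k)" for k
    unfolding u(2)[symmetric] by (rule Psi_eq_radial_functional[OF H Fn(2), symmetric])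
  then have "(\<lambda>k. radial_functional (n_min p q b) \<nu> (Fn k)) \<longlonglongrightarrow> S"
    using LIMSEQ_subseq_LIMSEQ[OF flim r] by (simp add: o_def)
  then have "S \<le> radial_functional (n_min p q b) \<nu> F" by (rule bounds(2)[OF Fn(1) F(1)])
  then have "S \<le> Psi p q b \<nu> v" unfolding Psi_eq_radial_functional[OF HF F(2)] .
  then have PS: "Psi p q b \<nu> v = S" using le_S[OF v] by (rule antisym[rotated])
  have "E_norm p q b v = 1"
  proof (rule ccontr)
    assume ne: "E_norm p q b v \<noteq> 1"
    obtain G where G: "has_weak_gradient v G" and hf: "\<And>\<rho>. h_fun p v \<rho> < \<infinity>"
      and T1: "total_energy p q b v G \<le> 1"
      by (rule U_ball_profile[OF p q b(1) v, folded total_energy_def]) (rule that)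
    have rad: "radially_symmetric v" using v by (simp add: U_ball_def E_rad_def)
    have E: "E_norm p q b v = epowr (total_energy p q b v G) (1 / (2 * p * q))"
      unfolding total_energy_def by (rule E_norm_eq[OF pq G])
    have "total_energy p q b v G \<noteq> 1"
      using ne epowr_ennreal[of 1 "1 / (2 * p * q)"] unfolding E by auto
    with T1 have "total_energy p q b v G < 1" by simp
    then obtain X where X: "total_energy p q b v G = ennreal X" "0 \<le> X" "X < 1"
      by (cases "total_energy p q b v G") (auto simp: ennreal_less_one_iff)
    \<comment> \<open>If the energy \<open>X\<close> of a maximizer is below 1, then some multiple by \<open>c > 1\<close> is still in the unit
      ball. The maximum with \<open>1/2\<close> covers the case \<open>X = 0\<close>.\<close>
    define Y where "Y = max X (1 / 2)"
    have Y: "X \<le> Y" "0 < Y" "Y < 1" using X by (auto simp: Y_def)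
    define c where "c = (1 / Y) powr (1 / (2 * p * q))"
    have cp: "c powr (2 * p * q) = 1 / Y" using Y p q by (simp add: c_def powr_powr)
    have "1 powr (1 / (2 * p * q)) < c"
      unfolding c_def using Y p q by (intro powr_less_mono2) (auto simp: field_simps)
    then have c: "1 < c" by simp
    then have c0: "0 < c" by simp
    have "total_energy p q b (\<lambda>x. c * v x) (\<lambda>x. c *\<^sub>R G x) \<le> 1"
      unfolding total_energy_scale[OF c0 G hf] X(1) cp using X Y
      by (simp add: ennreal_mult[symmetric])
    then have cv: "(\<lambda>x. c * v x) \<in> U_ball p q b"
      by (intro in_U_ballI[OF pq radially_symmetric_scale[OF rad] has_weak_gradient_scale[OF G]])
    have vm: "v \<in> borel_measurable lebesgue"
      using G by (auto simp: has_weak_gradient_def intro: locally_integrable_measurable)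
    have "ennreal (c\<^sup>2) * S \<le> Psi p q b \<nu> (\<lambda>x. c * v x)"
      using Psi_scale[OF \<nu>(1) less_imp_le[OF c] n(2) vm] unfolding PS .
    also have "\<dots> \<le> S" by (rule le_S[OF cv])
    finally have le: "ennreal (c\<^sup>2) * S \<le> S" .
    obtain s where s: "S = ennreal s" "0 < s" using Sfin Spos by (cases S) auto
    have "c\<^sup>2 * s \<le> s" using le s unfolding s(1) by (simp add: ennreal_mult[symmetric])
    moreover have "1 < c\<^sup>2" using c by (simp add: one_less_power)
    ultimately show False using s(2) by simp
  qed
  with v PS Sfin show ?thesis unfolding S_def by blast
qed

end
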